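(* (Monodromy space of type $(0,0,1)$, Painlevé V.) Let $AnalyticData$ be the affine variety of triples $(M_1,M_2,M_\infty)$ in $SL_2(\mathbb{C})$ with $M_1M_2M_\infty=1$, where $M_\infty$ has the form $\begin{pmatrix}\alpha&0\\ 0&\alpha^{-1}\end{pmatrix}\begin{pmatrix}1&0\\ f_1&1\end{pmatrix}\begin{pmatrix}1&f_2\\ 0&1\end{pmatrix}$ with $\alpha\in\mathbb{C}^*$, $f_1,f_2\in\mathbb{C}$. Let $\mathbb{G}_m$ act by simultaneous conjugation with the matrices $\mathrm{diag}(c,1)$, $c\in\mathbb C^*$, and let $\mathcal{R}=AnalyticData/\!/\mathbb{G}_m$. Write $M_j=\begin{pmatrix}a_j&b_j\\ c_j&d_j\end{pmatrix}$ for $j=1,2$, and put $s_1=\mathrm{tr}\,M_1$, $s_2=\mathrm{tr}\,M_2$, $s_3=\alpha$ $(=b_2c_1+d_1d_2)$, $x_1=d_1$, $x_2=d_2$, $x_3=b_1c_2+d_1d_2-s_2d_1-s_1d_2+s_1s_2+s_3$. Then: (1) The coordinate ring of $\mathcal{R}$ is $\mathbb{C}[x_1,x_2,x_3,s_1,s_2,s_3,s_3^{-1}]/(F)$ with $$F=x_1x_2x_3+x_1^2+x_2^2-(s_1+s_2s_3)x_1-(s_2+s_1s_3)x_2-s_3x_3+s_3^2+s_1s_2s_3+1 ,$$ so that $(s_1,s_2,s_3):\mathcal{R}\to\mathcal{P}=\mathbb{C}\times\mathbb{C}\times\mathbb{C}^*$ is a surjective family of affine cubic surfaces. (2) The singular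 locus of $\mathcal{R}$ is given by $b_1c_2=b_2c_1=a_1d_1-1=a_2d_2-1=0$; it is the image of the reducible data ($b_1=b_2=0$ or $c_1=c_2=0$). (3) The fibre over $(s_1,s_2,s_3)\in\mathcal{P}$ has a singular point if and only if $(s_1^2-4)(s_2^2-4)R_1=0$, where $R_1=(s_3+s_3^{-1})^2-s_1s_2(s_3+s_3^{-1})+s_1^2+s_2^2-4$.
   Context: $X/\!/G$ denotes the categorical quotient: for affine $X$ and reductive $G$, it is $\mathrm{Spec}(\mathcal{O}(X)^G)$. The varieties are over $\mathbb{C}$. Origin of the data: rank-two differential modules on $\mathbb{P}^1$ (with trivial determinant) having regular singularities at $0,1$ and an unramified irregular singularity of Katz invariant $1$ at $\infty$; $M_1,M_2$ are the monodromies around $0,1$ on a basis of the formal solution space at $\infty$ adapted to its decomposition into two lines, and $M_\infty$ is the product of formal monodromy and two Stokes matrices at $\infty$. *)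

theory Defs
  imports
    "HOL-Analysis.Analysis"
    "HOL-Algebra.QuotRing"
    "HOL-Algebra.Ideal_Product"
    "HOL-Library.Poly_Mapping"
    "HOL-Library.Extended_Nat"
begin

section \<open>Complex algebras and their closed points\<close>

text \<open>
  A complex algebra is given by a ring \<open>A\<close> (in the sense of HOL-Algebra) together with its
  structure map \<open>k\<close> from the complex numbers to \<open>A\<close>. The closed points of the affine scheme
  \<open>Spec A\<close>, for \<open>A\<close> of finite type, are the algebra homomorphisms from \<open>A\<close> to the
  complex numbers.
\<close>

definition type_ring :: "'a::comm_ring_1 set \<Rightarrow> 'a ring" where
  "type_ring C = \<lparr>carrier = C, mult = (*), one = 1, zero = 0, add = (+)\<rparr>"

definition alg_points :: "('a, 'm) ring_scheme \<Rightarrow> (complex \<Rightarrow> 'a) \<Rightarrow> ('a \<Rightarrow> complex) set" where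
  "alg_points A k =
     {\<xi> \<in> ring_hom A (type_ring UNIV). \<xi> \<in> extensional (carrier A) \<and> (\<forall>c. \<xi> (k c) = c)}"

definition point_ideal :: "('a, 'm) ring_scheme \<Rightarrow> ('a \<Rightarrow> complex) \<Rightarrow> 'a set" where
  "point_ideal A \<xi> = {a \<in> carrier A. \<xi> a = 0}"

text \<open>
  The height of a prime ideal \<open>m\<close>, i.e. the Krull dimension of the local ring of \<open>A\<close> at \<open>m\<close>.
\<close>

definition ideal_height :: "('a, 'm) ring_scheme \<Rightarrow> 'a set \<Rightarrow> enat" where
  "ideal_height A m =
     Sup {enat n | n. \<exists>p :: nat \<Rightarrow> 'a set.
            (\<forall>i\<le>n. primeideal (p i) A) \<and> (\<forall>i<n. p i \<subset> p (Suc i)) \<and> p n = m}"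

text \<open>
  The classes of \<open>b 0, \<dots>, b (n - 1)\<close> form a basis of the complex vector space \<open>m / m\<^sup>2\<close>,
  where \<open>m\<close> is the maximal ideal of the point \<open>\<xi>\<close>.
\<close>

definition cotangent_basis ::
    "('a, 'm) ring_scheme \<Rightarrow> (complex \<Rightarrow> 'a) \<Rightarrow> ('a \<Rightarrow> complex) \<Rightarrow> nat \<Rightarrow> (nat \<Rightarrow> 'a) \<Rightarrow> bool" where
  "cotangent_basis A k \<xi> n b \<longleftrightarrow>
     (\<forall>i<n. b i \<in> point_ideal A \<xi>) \<and>
     (\<forall>a \<in> point_ideal A \<xi>. \<exists>!c. c \<in> {..<n} \<rightarrow>\<^sub>E (UNIV :: complex set) \<and>
        a \<ominus>\<^bsub>A\<^esub> (\<Oplus>\<^bsub>A\<^esub>i\<in>{..<n}. k (c i) \<otimes>\<^bsub>A\<^esub> b i)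
          \<in> ideal_prod A (point_ideal A \<xi>) (point_ideal A \<xi>))"

text \<open>
  A point is regular if its local ring is a regular local ring: the dimension of the cotangent
  space \<open>m / m\<^sup>2\<close> (which does not change under localization at \<open>m\<close>) equals the Krull dimension
  of the local ring.
\<close>

definition regular_point ::
    "('a, 'm) ring_scheme \<Rightarrow> (complex \<Rightarrow> 'a) \<Rightarrow> ('a \<Rightarrow> complex) \<Rightarrow> bool" where
  "regular_point A k \<xi> \<longleftrightarrow>
     (\<exists>n b. cotangent_basis A k \<xi> n b \<and> ideal_height A (point_ideal A \<xi>) = enat n)"

definition singular_locus ::
    "('a, 'm) ring_scheme \<Rightarrow> (complex \<Rightarrow> 'a) \<Rightarrow> ('a \<Rightarrow> complex) set" where
  "singular_locus A k = {\<xi> \<in> alg_points A k. \<not> regular_point A k \<xi>}"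


section \<open>Polynomial rings\<close>

text \<open>
  Laurent polynomials are finitely supported maps from integer exponent vectors to coefficients.
  \<open>poly_ring U V\<close> is the ring of polynomials in the variables \<open>U\<close>, with the variables \<open>V\<close>
  adjoined together with their inverses.
\<close>

datatype var = X1 | X2 | X3 | S1 | S2 | S3

type_synonym lpoly = "(var \<Rightarrow>\<^sub>0 int) \<Rightarrow>\<^sub>0 complex"

definition Var :: "var \<Rightarrow> lpoly" where
  "Var v = Poly_Mapping.single (Poly_Mapping.single v 1) 1"

definition Const :: "complex \<Rightarrow> lpoly" where
  "Const c = Poly_Mapping.single 0 c"

definition poly_ring :: "var set \<Rightarrow> var set \<Rightarrow> lpoly ring" where
  "poly_ring U V = type_ring
     {p. \<forall>m \<in> Poly_Mapping.keys p. Poly_Mapping.keys m \<subseteq> U \<union> V \<and>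
           (\<forall>v \<in> U. Poly_Mapping.lookup m v \<ge> 0)}"

abbreviation L6 :: "lpoly ring" where "L6 \<equiv> poly_ring {X1, X2, X3, S1, S2} {S3}"

abbreviation L3 :: "lpoly ring" where "L3 \<equiv> poly_ring {X1, X2, X3} {}"

definition poly_eval :: "(var \<Rightarrow> complex) \<Rightarrow> lpoly \<Rightarrow> complex" where
  "poly_eval t p = (\<Sum>m \<in> Poly_Mapping.keys p. Poly_Mapping.lookup p m *
     (\<Prod>v \<in> Poly_Mapping.keys m. t v powi Poly_Mapping.lookup m v))"

definition total_degree :: "lpoly \<Rightarrow> int" where
  "total_degree p =
     Max ((\<lambda>m. \<Sum>v \<in> Poly_Mapping.keys m. Poly_Mapping.lookup m v) ` Poly_Mapping.keys p)"

definition cubic :: "'a::comm_ring_1 \<Rightarrow> 'a \<Rightarrow> 'a \<Rightarrow> 'a \<Rightarrow> 'a \<Rightarrow> 'a \<Rightarrow> 'a" where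
  "cubic x1 x2 x3 s1 s2 s3 =
     x1 * x2 * x3 + x1^2 + x2^2 - (s1 + s2 * s3) * x1 - (s2 + s1 * s3) * x2 - s3 * x3
       + s3^2 + s1 * s2 * s3 + 1"

definition F :: lpoly where
  "F = cubic (Var X1) (Var X2) (Var X3) (Var S1) (Var S2) (Var S3)"

definition F_at :: "complex \<times> complex \<times> complex \<Rightarrow> lpoly" where
  "F_at \<sigma> = (case \<sigma> of (\<sigma>1, \<sigma>2, \<sigma>3) \<Rightarrow>
     cubic (Var X1) (Var X2) (Var X3) (Const \<sigma>1) (Const \<sigma>2) (Const \<sigma>3))"


section \<open>The analytic data and the torus action\<close>

type_synonym mat22 = "complex^2^2"
type_synonym triple = "mat22 \<times> mat22 \<times> mat22"

definition mat22 :: "complex \<Rightarrow> complex \<Rightarrow> complex \<Rightarrow> complex \<Rightarrow> mat22" where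
  "mat22 a b c d = vector [vector [a, b], vector [c, d]]"

definition analytic_data :: "triple set" where
  "analytic_data = {(M1, M2, Minf).
     det M1 = 1 \<and> det M2 = 1 \<and> det Minf = 1 \<and> M1 ** M2 ** Minf = mat 1 \<and>
     (\<exists>\<alpha> f1 f2. \<alpha> \<noteq> 0 \<and>
        Minf = mat22 \<alpha> 0 0 (inverse \<alpha>) ** mat22 1 0 f1 1 ** mat22 1 f2 0 1)}"

definition act :: "complex \<Rightarrow> triple \<Rightarrow> triple" where
  "act c P = (case P of (M1, M2, Minf) \<Rightarrow>
     let g = mat22 c 0 0 1
     in (g ** M1 ** matrix_inv g, g ** M2 ** matrix_inv g, g ** Minf ** matrix_inv g))"

definition a1 :: "triple \<Rightarrow> complex" where "a1 P = fst P $ 1 $ 1"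
definition b1 :: "triple \<Rightarrow> complex" where "b1 P = fst P $ 1 $ 2"
definition c1 :: "triple \<Rightarrow> complex" where "c1 P = fst P $ 2 $ 1"
definition d1 :: "triple \<Rightarrow> complex" where "d1 P = fst P $ 2 $ 2"
definition a2 :: "triple \<Rightarrow> complex" where "a2 P = fst (snd P) $ 1 $ 1"
definition b2 :: "triple \<Rightarrow> complex" where "b2 P = fst (snd P) $ 1 $ 2"
definition c2 :: "triple \<Rightarrow> complex" where "c2 P = fst (snd P) $ 2 $ 1"
definition d2 :: "triple \<Rightarrow> complex" where "d2 P = fst (snd P) $ 2 $ 2"

text \<open>
  Multiplying out the prescribed form of \<open>M\<^sub>\<infinity>\<close> gives the rows \<open>(\<alpha>, \<alpha> f\<^sub>2)\<close> and
  \<open>(\<alpha>\<^sup>-\<^sup>1 f\<^sub>1, \<alpha>\<^sup>-\<^sup>1 (1 + f\<^sub>1 f\<^sub>2))\<close>, so \<open>\<alpha>\<close> is the upper left entry.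
\<close>

definition alpha :: "triple \<Rightarrow> complex" where "alpha P = snd (snd P) $ 1 $ 1"

text \<open>
  The affine variety of analytic data is the principal open subset \<open>\<alpha> \<noteq> 0\<close> of a closed
  subvariety of the space of triples of matrices. Hence its coordinate ring is the algebra of
  functions generated by the matrix entries and \<open>\<alpha>\<^sup>-\<^sup>1\<close>; it contains the functions \<open>f\<^sub>1\<close> and
  \<open>f\<^sub>2\<close>. Functions on a set are extended by \<open>undefined\<close> outside of it.
\<close>

inductive_set regular_funs :: "(triple \<Rightarrow> complex) set" where
  const: "(\<lambda>P\<in>analytic_data. c) \<in> regular_funs"
| entry1: "(\<lambda>P\<in>analytic_data. fst P $ i $ j) \<in> regular_funs"
| entry2: "(\<lambda>P\<in>analytic_data. fst (snd P) $ i $ j) \<in> regular_funs"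
| entry_inf: "(\<lambda>P\<in>analytic_data. snd (snd P) $ i $ j) \<in> regular_funs"
| inverse_alpha: "(\<lambda>P\<in>analytic_data. inverse (alpha P)) \<in> regular_funs"
| add: "f \<in> regular_funs \<Longrightarrow> g \<in> regular_funs \<Longrightarrow> (\<lambda>P\<in>analytic_data. f P + g P) \<in> regular_funs"
| mult: "f \<in> regular_funs \<Longrightarrow> g \<in> regular_funs \<Longrightarrow> (\<lambda>P\<in>analytic_data. f P * g P) \<in> regular_funs"


section \<open>The categorical quotient\<close>

text \<open>
  The quotient is the spectrum of the ring of invariant regular functions. It is represented by
  this ring, \<open>quot_ring\<close>, with structure map \<open>quot_const\<close>; its points are
  \<open>alg_points quot_ring quot_const\<close>.
\<close>

definition quot_ring :: "(triple \<Rightarrow> complex) ring" where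
  "quot_ring =
     \<lparr>carrier = {f \<in> regular_funs. \<forall>c P. c \<noteq> 0 \<longrightarrow> P \<in> analytic_data \<longrightarrow> f (act c P) = f P},
      mult = (\<lambda>f g. \<lambda>P\<in>analytic_data. f P * g P), one = (\<lambda>P\<in>analytic_data. 1),
      zero = (\<lambda>P\<in>analytic_data. 0), add = (\<lambda>f g. \<lambda>P\<in>analytic_data. f P + g P)\<rparr>"

definition quot_const :: "complex \<Rightarrow> triple \<Rightarrow> complex" where
  "quot_const c = (\<lambda>P\<in>analytic_data. c)"

definition quot_map :: "triple \<Rightarrow> (triple \<Rightarrow> complex) \<Rightarrow> complex" where
  "quot_map P = (\<lambda>f\<in>carrier quot_ring. f P)"

fun coord :: "var \<Rightarrow> triple \<Rightarrow> complex" where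
  "coord X1 P = d1 P"
| "coord X2 P = d2 P"
| "coord X3 P =
     (let s1 = trace (fst P); s2 = trace (fst (snd P)); s3 = alpha P
      in b1 P * c2 P + d1 P * d2 P - s2 * d1 P - s1 * d2 P + s1 * s2 + s3)"
| "coord S1 P = trace (fst P)"
| "coord S2 P = trace (fst (snd P))"
| "coord S3 P = alpha P"

definition coord_fun :: "var \<Rightarrow> triple \<Rightarrow> complex" where
  "coord_fun v = (\<lambda>P\<in>analytic_data. coord v P)"

definition param_space :: "(complex \<times> complex \<times> complex) set" where
  "param_space = UNIV \<times> UNIV \<times> (UNIV - {0})"

text \<open>
  The scheme-theoretic fibre over \<open>\<sigma>\<close>, again represented by its coordinate ring, the quotient by
  the ideal generated by the \<open>s\<^sub>i - \<sigma>\<^sub>i\<close>.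
\<close>

definition fibre_ideal :: "complex \<times> complex \<times> complex \<Rightarrow> (triple \<Rightarrow> complex) set" where
  "fibre_ideal \<sigma> = (case \<sigma> of (\<sigma>1, \<sigma>2, \<sigma>3) \<Rightarrow>
     genideal quot_ring
       {coord_fun S1 \<ominus>\<^bsub>quot_ring\<^esub> quot_const \<sigma>1,
        coord_fun S2 \<ominus>\<^bsub>quot_ring\<^esub> quot_const \<sigma>2,
        coord_fun S3 \<ominus>\<^bsub>quot_ring\<^esub> quot_const \<sigma>3})"

definition fibre_ring :: "complex \<times> complex \<times> complex \<Rightarrow> (triple \<Rightarrow> complex) set ring" where
  "fibre_ring \<sigma> = quot_ring Quot (fibre_ideal \<sigma>)"

definition fibre_class ::
    "complex \<times> complex \<times> complex \<Rightarrow> (triple \<Rightarrow> complex) \<Rightarrow> (triple \<Rightarrow> complex) set" where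
  "fibre_class \<sigma> f = fibre_ideal \<sigma> +>\<^bsub>quot_ring\<^esub> f"

definition R1 :: "complex \<Rightarrow> complex \<Rightarrow> complex \<Rightarrow> complex" where
  "R1 s1 s2 s3 =
     (s3 + inverse s3)^2 - s1 * s2 * (s3 + inverse s3) + s1^2 + s2^2 - 4"

end

theory Submission
  imports Defs
begin

text \<open>
  The invariants of the torus are generated by the weight zero products of matrix entries: by
  \<open>a\<^sub>1, d\<^sub>1, a\<^sub>2, d\<^sub>2\<close>, \<open>u = b\<^sub>1 c\<^sub>2\<close>, \<open>v = b\<^sub>2 c\<^sub>1\<close> and \<open>\<alpha>\<^sup>-\<^sup>1\<close>. With \<open>p = a\<^sub>1 d\<^sub>1 - 1 = b\<^sub>1 c\<^sub>1\<close> and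
  \<open>q = a\<^sub>2 d\<^sub>2 - 1 = b\<^sub>2 c\<^sub>2\<close>, the only relation is \<open>p q = u v\<close>, and this is \<open>F = 0\<close> in the coordinates
  \<open>x\<^sub>i, s\<^sub>i\<close>. Since \<open>F\<close> is monic of degree two in \<open>x\<^sub>1\<close> with nonzero discriminant, division by \<open>F\<close> shows
  that a polynomial that vanishes on the hypersurface is a multiple of \<open>F\<close>.

  A point of a hypersurface in \<open>N\<close>-space is regular iff the gradient of the equation does not vanish
  there, provided that the height of its maximal ideal is \<open>N - 1\<close>. Chains of primes are not longer
  because \<open>N + 1\<close> polynomials in \<open>N\<close> variables are algebraically dependent. A chain of this length is
  given by irreducible subsets through the point: \<open>F\<close> is linear in \<open>x\<^sub>3\<close> with leading coefficient \<open>-v\<close>,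
  so that the surface is a graph over the locus \<open>v \<noteq> 0\<close>, and slices of the graph are irreducible. Through
  a point with \<open>v = 0\<close> there passes a line in the direction of \<open>x\<^sub>3\<close>, which lies in the closure of the graph.
\<close>

section \<open>Laurent polynomials\<close>

text \<open>The relation p q = u v is a rank condition: the matrix with rows (p, u) and (v, q) is
  the column (b_1, b_2) times the row (c_1, c_2), and \<open>F\<close> is its determinant. The
  quotient is singular exactly where this matrix is zero, which happens iff b = 0 or c = 0. A fibre
  can have further singular points, because with the s_i fixed only three derivatives have to
  vanish; this is the origin of the factors s_1^2 - 4 and s_2^2 - 4.

  Regularity compares the dimension of the cotangent space with a height, so the height must be
  known at every closed point, the singular ones included. The line used at v = 0 is disjoint from
  the graph, so the inclusion of vanishing ideals there rests on a limit and not on an inclusion of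
  sets.

  The quotient and the fibres are instances of one locale, for six variables with s_3 inverted and
  for three variables. The irreducible sets always consist of points with six coordinates, so that
  the chain in a fibre is the tail of the chain in the quotient.\<close>

fun var_index :: "var \<Rightarrow> nat" where
  "var_index X1 = 0" | "var_index X2 = 1" | "var_index X3 = 2"
| "var_index S1 = 3" | "var_index S2 = 4" | "var_index S3 = 5"

lemma var_index_eq: "var_index v = var_index w \<longleftrightarrow> v = w"
  by (cases v; cases w) auto

text \<open>The order on the variables makes \<^typ>\<open>lpoly\<close> an instance of the class \<open>idom\<close>.\<close>

instantiation var :: linorder
begin
definition less_eq_var :: "var \<Rightarrow> var \<Rightarrow> bool" where "v \<le> w \<longleftrightarrow> var_index v \<le> var_index w"
definition less_var :: "var \<Rightarrow> var \<Rightarrow> bool" where "v < w \<longleftrightarrow> var_index v < var_index w"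
instance
  by standard (auto simp: less_eq_var_def less_var_def var_index_eq)
end

lemma UNIV_var: "UNIV = {X1, X2, X3, S1, S2, S3}"
  using var.exhaust by blast

instance var :: finite
  by standard (simp add: UNIV_var)

lemma type_ring_simps [simp]:
  "carrier (type_ring C) = C" "x \<otimes>\<^bsub>type_ring C\<^esub> y = x * y" "\<one>\<^bsub>type_ring C\<^esub> = 1"
  "x \<oplus>\<^bsub>type_ring C\<^esub> y = x + y" "\<zero>\<^bsub>type_ring C\<^esub> = 0"
  by (simp_all add: type_ring_def)

abbreviation Pol :: "var set \<Rightarrow> var set \<Rightarrow> lpoly set" where
  "Pol U V \<equiv> carrier (poly_ring U V)"

definition Var_inv :: "var \<Rightarrow> lpoly" where
  "Var_inv v = Poly_Mapping.single (Poly_Mapping.single v (-1)) 1"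

lemma poly_ring_simps [simp]:
  "x \<otimes>\<^bsub>poly_ring U V\<^esub> y = x * y" "\<one>\<^bsub>poly_ring U V\<^esub> = 1"
  "x \<oplus>\<^bsub>poly_ring U V\<^esub> y = x + y" "\<zero>\<^bsub>poly_ring U V\<^esub> = 0"
  by (simp_all add: poly_ring_def)

lemma Pol_iff:
  "p \<in> Pol U V \<longleftrightarrow> (\<forall>m \<in> Poly_Mapping.keys p. Poly_Mapping.keys m \<subseteq> U \<union> V \<and>
           (\<forall>v \<in> U. Poly_Mapping.lookup m v \<ge> 0))"
  by (simp add: poly_ring_def)

lemma Pol_add [intro, simp]: "p \<in> Pol U V \<Longrightarrow> q \<in> Pol U V \<Longrightarrow> p + q \<in> Pol U V"
  unfolding Pol_iff using Poly_Mapping.keys_add[of p q] by blast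

lemma Pol_uminus [intro, simp]: "p \<in> Pol U V \<Longrightarrow> - p \<in> Pol U V"
  unfolding Pol_iff by (simp add: in_keys_iff)

lemma Pol_diff [intro, simp]: "p \<in> Pol U V \<Longrightarrow> q \<in> Pol U V \<Longrightarrow> p - q \<in> Pol U V"
  using Pol_add[of p U V "- q"] by simp

lemma Pol_mult [intro, simp]:
  assumes "p \<in> Pol U V" "q \<in> Pol U V" shows "p * q \<in> Pol U V"
  unfolding Pol_iff
proof
  fix m assume "m \<in> Poly_Mapping.keys (p * q)"
  then obtain a b where ab: "a \<in> Poly_Mapping.keys p" "b \<in> Poly_Mapping.keys q" "m = a + b"
    using Poly_Mapping.keys_mult[of p q] by blast
  then have "Poly_Mapping.keys a \<subseteq> U \<union> V" "Poly_Mapping.keys b \<subseteq> U \<union> V"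
    "\<forall>v \<in> U. Poly_Mapping.lookup a v \<ge> 0" "\<forall>v \<in> U. Poly_Mapping.lookup b v \<ge> 0"
    using assms unfolding Pol_iff by auto
  then show "Poly_Mapping.keys m \<subseteq> U \<union> V \<and> (\<forall>v \<in> U. Poly_Mapping.lookup m v \<ge> 0)"
    using Poly_Mapping.keys_add[of a b] ab(3) by (auto simp: lookup_add)
qed

lemma Pol_Const [intro, simp]: "Const c \<in> Pol U V"
  by (auto simp: Pol_iff Const_def)

lemma Const_add: "Const (a + b) = Const a + Const b"
  by (simp add: Const_def single_add)

lemma Const_mult: "Const (a * b) = Const a * Const b"
  by (simp add: Const_def mult_single)

lemma Const_uminus: "Const (- a) = - Const a"
  by (simp add: Const_def single_uminus)

lemma Const_0 [simp]: "Const 0 = 0"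
  by (simp add: Const_def)

lemma Const_1 [simp]: "Const 1 = 1"
  by (simp add: Const_def)

lemma Pol_0 [intro, simp]: "0 \<in> Pol U V"
  using Pol_Const[of 0] by simp

lemma Pol_1 [intro, simp]: "1 \<in> Pol U V"
  using Pol_Const[of 1] by simp

lemma Pol_sum [intro]: "(\<And>i. i \<in> S \<Longrightarrow> f i \<in> Pol U V) \<Longrightarrow> sum f S \<in> Pol U V"
  by (induction S rule: infinite_finite_induct) auto

lemma Pol_power [intro, simp]: "p \<in> Pol U V \<Longrightarrow> p ^ n \<in> Pol U V"
  by (induction n) auto

lemma Pol_Var [intro, simp]: "v \<in> U \<union> V \<Longrightarrow> Var v \<in> Pol U V"
  by (auto simp: Pol_iff Var_def lookup_single when_def)

lemma Pol_Var_inv [intro, simp]: "v \<in> V \<Longrightarrow> U \<inter> V = {} \<Longrightarrow> Var_inv v \<in> Pol U V"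
  by (auto simp: Pol_iff Var_inv_def lookup_single when_def)

lemma Var_inv_mult [simp]: "Var_inv v * Var v = 1" "Var v * Var_inv v = 1"
  by (simp_all add: Var_def Var_inv_def mult_single flip: single_add)

text \<open>The last condition guards the sign: a variable of \<open>V\<close> may carry negative
  exponents, so it may belong to \<open>U'\<close> only if it was already in
  \<open>U\<close>.\<close>

lemma Pol_mono:
  assumes "U \<subseteq> U'" "V \<subseteq> V'" "U' \<inter> V \<subseteq> U" shows "Pol U V \<subseteq> Pol U' V'"
proof
  fix p assume p: "p \<in> Pol U V"
  show "p \<in> Pol U' V'"
    unfolding Pol_iff
  proof
    fix m assume "m \<in> Poly_Mapping.keys p"
    then have m: "Poly_Mapping.keys m \<subseteq> U \<union> V" "\<forall>v \<in> U. Poly_Mapping.lookup m v \<ge> 0"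
      using p unfolding Pol_iff by auto
    have "Poly_Mapping.lookup m v \<ge> 0" if v: "v \<in> U'" for v
    proof (cases "v \<in> Poly_Mapping.keys m")
      case True
      then show ?thesis using m v assms by blast
    next
      case False
      then show ?thesis by (simp add: in_keys_iff)
    qed
    then show "Poly_Mapping.keys m \<subseteq> U' \<union> V' \<and> (\<forall>v \<in> U'. Poly_Mapping.lookup m v \<ge> 0)"
      using m assms by blast
  qed
qed

lemma poly_ring_cring: "cring (poly_ring U V)"
proof (rule cringI)
  show "abelian_group (poly_ring U V)"
  proof (rule abelian_groupI)
    fix x assume "x \<in> Pol U V"
    then show "\<exists>y\<in>Pol U V. y \<oplus>\<^bsub>poly_ring U V\<^esub> x = \<zero>\<^bsub>poly_ring U V\<^esub>"
      by (intro bexI[of _ "- x"]) auto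
  qed (auto simp: algebra_simps)
  show "comm_monoid (poly_ring U V)"
    by (rule comm_monoidI) (auto simp: algebra_simps)
qed (auto simp: algebra_simps)

lemma sum_single_lookup:
  "p = (\<Sum>m\<in>Poly_Mapping.keys p. Poly_Mapping.single m (Poly_Mapping.lookup p m))"
  by (rule poly_mapping_eqI)
    (simp add: lookup_sum lookup_single when_def in_keys_iff)

lemma single_mono_prod:
  fixes m :: "var \<Rightarrow>\<^sub>0 int"
  shows "Poly_Mapping.single m (1::complex) =
     (\<Prod>v\<in>Poly_Mapping.keys m. Poly_Mapping.single (Poly_Mapping.single v (Poly_Mapping.lookup m v)) 1)"
proof -
  have *: "(\<Prod>v\<in>S. Poly_Mapping.single (g v) (1::complex)) = Poly_Mapping.single (sum g S) 1"
    for g :: "var \<Rightarrow> var \<Rightarrow>\<^sub>0 int" and S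
    by (induction S rule: infinite_finite_induct) (auto simp: mult_single)
  show ?thesis
    unfolding * by (rule arg_cong[OF sum_single_lookup, where f = "\<lambda>x. Poly_Mapping.single x 1"])
qed

lemma single_var_power: "Poly_Mapping.single (Poly_Mapping.single v (int n)) (1::complex) = Var v ^ n"
proof (induction n)
  case (Suc n)
  have "Poly_Mapping.single (Poly_Mapping.single v (int (Suc n))) (1::complex) =
      Var v * Poly_Mapping.single (Poly_Mapping.single v (int n)) 1"
    by (simp add: Var_def mult_single single_add)
  with Suc show ?case by simp
qed simp

lemma single_var_inv_power: "Poly_Mapping.single (Poly_Mapping.single v (- int n)) (1::complex) = Var_inv v ^ n"
proof (induction n)
  case (Suc n)
  have "Poly_Mapping.single (Poly_Mapping.single v (- int (Suc n))) (1::complex) =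
      Var_inv v * Poly_Mapping.single (Poly_Mapping.single v (- int n)) 1"
    by (simp add: Var_inv_def mult_single flip: single_add)
  with Suc show ?case by simp
qed simp

text \<open>A monomial is a product of powers of variables and of inverse variables, so these and
  the constants generate the ring. Division, Taylor expansion, pull-backs and specialization are all
  proved on generators by this rule, without touching exponents.\<close>

lemma Pol_induct [consumes 1, case_names const var inv add mult]:
  assumes p: "p \<in> Pol U V"
    and const: "\<And>c. Q (Const c)"
    and var: "\<And>v. v \<in> U \<union> V \<Longrightarrow> Q (Var v)"
    and inv: "\<And>v. v \<in> V \<Longrightarrow> v \<notin> U \<Longrightarrow> Q (Var_inv v)"
    and add: "\<And>p q. p \<in> Pol U V \<Longrightarrow> q \<in> Pol U V \<Longrightarrow> Q p \<Longrightarrow> Q q \<Longrightarrow> Q (p + q)"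
    and mult: "\<And>p q. p \<in> Pol U V \<Longrightarrow> q \<in> Pol U V \<Longrightarrow> Q p \<Longrightarrow> Q q \<Longrightarrow> Q (p * q)"
  shows "Q p"
proof -
  \<comment> \<open>\<open>R\<close> carries membership along, because the hypotheses
    \<open>add\<close> and \<open>mult\<close> speak of elements of the ring only.\<close>
  define R where "R p \<longleftrightarrow> p \<in> Pol U V \<and> Q p" for p
  have R1: "R 1" and R0: "R 0"
    using const[of 1] const[of 0] by (auto simp: R_def)
  have Rm: "R p \<Longrightarrow> R q \<Longrightarrow> R (p * q)" and Ra: "R p \<Longrightarrow> R q \<Longrightarrow> R (p + q)" for p q
    using add mult by (auto simp: R_def)
  have Rpow: "R p \<Longrightarrow> R (p ^ n)" for p n
    by (induction n) (auto intro: R1 Rm)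
  have Rprod: "(\<And>i. i \<in> S \<Longrightarrow> R (f i)) \<Longrightarrow> R (prod f S)" for S and f :: "'x \<Rightarrow> lpoly"
    by (induction S rule: infinite_finite_induct) (auto intro: R1 Rm)
  have Rsum: "(\<And>i. i \<in> S \<Longrightarrow> R (f i)) \<Longrightarrow> R (sum f S)" for S and f :: "'x \<Rightarrow> lpoly"
    by (induction S rule: infinite_finite_induct) (auto intro: R0 Ra)
  have Rmono: "R (Poly_Mapping.single m 1)" if m: "m \<in> Poly_Mapping.keys p" for m
  proof (subst single_mono_prod, rule Rprod)
    fix v assume v: "v \<in> Poly_Mapping.keys m"
    have mk: "Poly_Mapping.keys m \<subseteq> U \<union> V" "\<forall>v \<in> U. Poly_Mapping.lookup m v \<ge> 0"
      using p m unfolding Pol_iff by auto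
    show "R (Poly_Mapping.single (Poly_Mapping.single v (Poly_Mapping.lookup m v)) 1)"
    proof (cases "Poly_Mapping.lookup m v \<ge> 0")
      case True
      then obtain n where "Poly_Mapping.lookup m v = int n" using nonneg_eq_int by blast
      moreover have "R (Var v)" using v mk var by (auto simp: R_def)
      ultimately show ?thesis by (simp add: single_var_power Rpow)
    next
      case False
      then obtain n where n: "Poly_Mapping.lookup m v = - int n"
        by (metis int_cases4 minus_minus neg_0_le_iff_le nle_le of_nat_0_le_iff)
      have "v \<notin> U" "v \<in> V" using False mk v by auto
      then have "Var_inv v \<in> Pol U V"
        by (auto simp: Pol_iff Var_inv_def lookup_single when_def)
      then have "R (Var_inv v)" using inv \<open>v \<notin> U\<close> \<open>v \<in> V\<close> by (auto simp: R_def)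
      then show ?thesis by (simp add: n single_var_inv_power Rpow)
    qed
  qed
  have "R (Poly_Mapping.single m (Poly_Mapping.lookup p m))" if m: "m \<in> Poly_Mapping.keys p" for m
  proof -
    have "Poly_Mapping.single m (Poly_Mapping.lookup p m) =
        Const (Poly_Mapping.lookup p m) * Poly_Mapping.single m 1"
      by (simp add: Const_def mult_single)
    then show ?thesis using Rmono[OF m] const by (auto simp: R_def intro!: mult)
  qed
  then have "R p" by (subst sum_single_lookup) (rule Rsum)
  then show ?thesis by (simp add: R_def)
qed

subsection \<open>Evaluation\<close>

definition mono_eval :: "(var \<Rightarrow> complex) \<Rightarrow> (var \<Rightarrow>\<^sub>0 int) \<Rightarrow> complex" where
  "mono_eval t m = (\<Prod>v\<in>UNIV. t v powi Poly_Mapping.lookup m v)"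

lemma poly_eval_mono:
  "poly_eval t p = (\<Sum>m\<in>Poly_Mapping.keys p. Poly_Mapping.lookup p m * mono_eval t m)"
  unfolding poly_eval_def mono_eval_def
  by (intro sum.cong refl arg_cong2[where f = "(*)"] prod.mono_neutral_left)
    (auto simp: in_keys_iff)

lemma poly_eval_superset:
  assumes "finite S" "Poly_Mapping.keys p \<subseteq> S"
  shows "poly_eval t p = (\<Sum>m\<in>S. Poly_Mapping.lookup p m * mono_eval t m)"
  unfolding poly_eval_mono using assms
  by (intro sum.mono_neutral_left) (auto simp: in_keys_iff)

lemma poly_eval_add [simp]: "poly_eval t (p + q) = poly_eval t p + poly_eval t q"
proof -
  let ?S = "Poly_Mapping.keys p \<union> Poly_Mapping.keys q"
  show ?thesis
    by (subst (1 2 3) poly_eval_superset[of ?S])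
      (auto simp: lookup_add algebra_simps sum.distrib dest: subsetD[OF Poly_Mapping.keys_add])
qed

lemma poly_eval_0 [simp]: "poly_eval t 0 = 0"
  by (simp add: poly_eval_mono)

lemma poly_eval_sum: "poly_eval t (sum f S) = (\<Sum>i\<in>S. poly_eval t (f i))"
  by (induction S rule: infinite_finite_induct) auto

lemma poly_eval_uminus [simp]: "poly_eval t (- p) = - poly_eval t p"
  using poly_eval_add[of t p "- p"] by (simp add: eq_neg_iff_add_eq_0 add.commute)

lemma poly_eval_diff [simp]: "poly_eval t (p - q) = poly_eval t p - poly_eval t q"
  using poly_eval_add[of t p "- q"] by simp

lemma poly_eval_single: "poly_eval t (Poly_Mapping.single m c) = c * mono_eval t m"
  by (simp add: poly_eval_mono)

lemma poly_eval_Const [simp]: "poly_eval t (Const c) = c"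
  by (simp add: Const_def poly_eval_single mono_eval_def)

lemma poly_eval_1 [simp]: "poly_eval t 1 = 1"
  using poly_eval_Const[of t 1] by simp

lemma mono_eval_single: "mono_eval t (Poly_Mapping.single v k) = t v powi k"
proof -
  have "mono_eval t (Poly_Mapping.single v k) = (\<Prod>w\<in>UNIV. if w = v then t w powi k else 1)"
    unfolding mono_eval_def by (intro prod.cong) (auto simp: lookup_single)
  then show ?thesis by simp
qed

lemma poly_eval_Var [simp]: "poly_eval t (Var v) = t v"
  by (simp add: Var_def poly_eval_single mono_eval_single)

lemma poly_eval_Var_inv [simp]: "poly_eval t (Var_inv v) = inverse (t v)"
  by (simp add: Var_inv_def poly_eval_single mono_eval_single)

text \<open>At 0 the exponent law fails for mixed signs: \<open>0 powi 1 * 0 powi (-1)\<close> is 0,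
  while \<open>0 powi 0\<close> is 1. Hence evaluation is multiplicative only where the inverted
  variables are nonzero.\<close>

lemma power_int_add_nonneg:
  fixes x :: complex
  assumes "x \<noteq> 0 \<or> (a \<ge> 0 \<and> b \<ge> 0)" shows "x powi (a + b) = x powi a * x powi b"
proof (cases "x = 0")
  case False
  then show ?thesis by (simp add: power_int_add)
next
  case True
  then show ?thesis using assms by (auto simp: power_int_0_left_if)
qed

definition pts :: "var set \<Rightarrow> (var \<Rightarrow> complex) set" where
  "pts V = {t. \<forall>v\<in>V. t v \<noteq> 0}"

lemma poly_eval_mult [simp]:
  assumes "t \<in> pts V" "p \<in> Pol U V" "q \<in> Pol U V"
  shows "poly_eval t (p * q) = poly_eval t p * poly_eval t q"
proof -
  have mm: "mono_eval t (m + m') = mono_eval t m * mono_eval t m'"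
    if "m \<in> Poly_Mapping.keys p" "m' \<in> Poly_Mapping.keys q" for m m'
    unfolding mono_eval_def prod.distrib[symmetric] lookup_add
  proof (rule prod.cong[OF refl])
    fix v
    have m: "Poly_Mapping.keys m \<subseteq> U \<union> V" "\<forall>v \<in> U. Poly_Mapping.lookup m v \<ge> 0"
      "Poly_Mapping.keys m' \<subseteq> U \<union> V" "\<forall>v \<in> U. Poly_Mapping.lookup m' v \<ge> 0"
      using that assms unfolding Pol_iff by auto
    show "t v powi (Poly_Mapping.lookup m v + Poly_Mapping.lookup m' v)
        = t v powi Poly_Mapping.lookup m v * t v powi Poly_Mapping.lookup m' v"
    proof (cases "v \<in> V")
      case True
      then show ?thesis using assms by (intro power_int_add_nonneg) (auto simp: pts_def)
    next
      case False
      then have "Poly_Mapping.lookup m v \<ge> 0" "Poly_Mapping.lookup m' v \<ge> 0"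
        using m by (metis UnE in_keys_iff order_refl subsetD)+
      then show ?thesis by (intro power_int_add_nonneg) auto
    qed
  qed
  have "p * q = (\<Sum>m\<in>Poly_Mapping.keys p. \<Sum>m'\<in>Poly_Mapping.keys q.
       Poly_Mapping.single (m + m') (Poly_Mapping.lookup p m * Poly_Mapping.lookup q m'))"
    using arg_cong2[OF sum_single_lookup[of p] sum_single_lookup[of q], of "(*)"]
    by (simp add: sum_product mult_single)
  then have "poly_eval t (p * q) = (\<Sum>m\<in>Poly_Mapping.keys p. \<Sum>m'\<in>Poly_Mapping.keys q.
       Poly_Mapping.lookup p m * Poly_Mapping.lookup q m' * mono_eval t (m + m'))"
    by (simp add: poly_eval_sum poly_eval_single)
  also have "\<dots> = poly_eval t p * poly_eval t q"
    unfolding poly_eval_mono sum_product using mm by (intro sum.cong refl) simp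
  finally show ?thesis .
qed

lemma poly_eval_power [simp]:
  assumes "t \<in> pts V" "p \<in> Pol U V"
  shows "poly_eval t (p ^ n) = poly_eval t p ^ n"
proof (induction n)
  case (Suc n)
  have "poly_eval t (p * p ^ n) = poly_eval t p * poly_eval t (p ^ n)"
    using assms by (intro poly_eval_mult) auto
  with Suc show ?case by simp
qed simp

lemma poly_eval_cong:
  assumes "p \<in> Pol U V" "\<And>v. v \<in> U \<union> V \<Longrightarrow> t v = t' v"
  shows "poly_eval t p = poly_eval t' p"
  unfolding poly_eval_def
  using assms unfolding Pol_iff
  by (intro sum.cong refl arg_cong2[where f = "(*)"] prod.cong) (metis subsetD)

text \<open>Dedekind's argument: subtracting \<open>ch j y\<close> times the relation at x from the
  relation at \<open>tm y x\<close> removes the character j and multiplies the other coefficients by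
  \<open>ch i y - ch j y\<close>, where y is chosen to separate i from j. It is used for monomials
  as characters of the torus of all coordinates, and for the weights \<open>z powi n\<close> of the
  acting torus.\<close>

lemma characters_independent:
  fixes ch :: "'i \<Rightarrow> 'g \<Rightarrow> complex"
  assumes "finite S"
    and tm: "\<And>x y. x \<in> G \<Longrightarrow> y \<in> G \<Longrightarrow> tm x y \<in> G"
    and hom: "\<And>i x y. i \<in> S \<Longrightarrow> x \<in> G \<Longrightarrow> y \<in> G \<Longrightarrow> ch i (tm x y) = ch i x * ch i y"
    and nz: "\<And>i. i \<in> S \<Longrightarrow> \<exists>x\<in>G. ch i x \<noteq> 0"
    and sep: "\<And>i j. i \<in> S \<Longrightarrow> j \<in> S \<Longrightarrow> i \<noteq> j \<Longrightarrow> \<exists>x\<in>G. ch i x \<noteq> ch j x"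
    and zero: "\<And>x. x \<in> G \<Longrightarrow> (\<Sum>i\<in>S. a i * ch i x) = 0"
  shows "\<forall>i\<in>S. a i = 0"
  using assms(1) hom nz sep zero
proof (induction S arbitrary: a rule: finite_induct)
  case (insert j S)
  have a0: "a i = 0" if i: "i \<in> S" for i
  proof -
    obtain y where y: "y \<in> G" "ch i y \<noteq> ch j y"
      using insert.prems(3)[of i j] i insert.hyps by blast
    have "\<forall>i\<in>S. a i * (ch i y - ch j y) = 0"
    proof (rule insert.IH)
      fix x assume x: "x \<in> G"
      have "a j * ch j (tm y x) + (\<Sum>i\<in>S. a i * ch i (tm y x)) = 0"
        using insert.prems(4)[OF tm[OF y(1) x]] insert.hyps by simp
      then have 1: "a j * (ch j y * ch j x) + (\<Sum>i\<in>S. a i * (ch i y * ch i x)) = 0"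
        using insert.prems(1) x y by simp
      have "a j * ch j x + (\<Sum>i\<in>S. a i * ch i x) = 0"
        using insert.prems(4)[OF x] insert.hyps by simp
      then have 2: "ch j y * (a j * ch j x + (\<Sum>i\<in>S. a i * ch i x)) = 0" by simp
      have alg: "A - y' * B = 0" if "p * (y' * x') + A = 0" "y' * (p * x' + B) = 0"
        for A B p x' y' :: complex
      proof -
        have "A - y' * B = (p * (y' * x') + A) - y' * (p * x' + B)" by (simp add: algebra_simps)
        then show ?thesis using that by simp
      qed
      have "(\<Sum>i\<in>S. a i * (ch i y - ch j y) * ch i x) =
          (\<Sum>i\<in>S. a i * (ch i y * ch i x)) - ch j y * (\<Sum>i\<in>S. a i * ch i x)"
        by (simp add: algebra_simps sum_subtractf sum_distrib_left)
      also have "\<dots> = 0" by (rule alg[OF 1 2])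
      finally show "(\<Sum>i\<in>S. a i * (ch i y - ch j y) * ch i x) = 0" .
    qed (use insert.prems in auto)
    with i y show ?thesis by auto
  qed
  obtain x where "x \<in> G" "ch j x \<noteq> 0" using insert.prems(2) by blast
  then have "a j = 0" using insert.prems(4)[of x] insert.hyps a0 by simp
  with a0 show ?case by simp
qed simp

lemma two_powi_inject: "(2::complex) powi a = 2 powi b \<longleftrightarrow> a = b"
proof
  assume "(2::complex) powi a = 2 powi b"
  then have "norm ((2::complex) powi a) = norm ((2::complex) powi b)" by simp
  then have "(2::real) powi a = 2 powi b" by (simp add: norm_power_int)
  then show "a = b" using power_int_strict_increasing[of a b "2::real"]
      power_int_strict_increasing[of b a "2::real"] by (cases a b rule: linorder_cases) auto
qed simp

text \<open>Distinct monomials are distinct characters of the torus of points with nonzero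
  coordinates, so this torus already detects every Laurent polynomial.\<close>

lemma poly_eval_eq_0_imp:
  assumes "\<And>t. (\<forall>v. t v \<noteq> 0) \<Longrightarrow> poly_eval t p = 0"
  shows "p = 0"
proof -
  have "\<forall>m\<in>Poly_Mapping.keys p. Poly_Mapping.lookup p m = 0"
  proof (rule characters_independent[where G = "{t. \<forall>v. t v \<noteq> 0}" and tm = "\<lambda>t t' v. t v * t' v"
        and ch = "\<lambda>m t. mono_eval t m"])
    fix m m' :: "var \<Rightarrow>\<^sub>0 int"
    assume "m \<noteq> m'"
    then obtain v where v: "Poly_Mapping.lookup m v \<noteq> Poly_Mapping.lookup m' v"
      by (metis poly_mapping_eqI)
    \<comment> \<open>One coordinate 2 and the others 1 read off the exponent of v, since the
      integer powers of 2 are distinct.\<close>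
    define t :: "var \<Rightarrow> complex" where "t w = (if w = v then 2 else 1)" for w
    have t: "mono_eval t n = 2 powi Poly_Mapping.lookup n v" for n
    proof -
      have "mono_eval t n = (\<Prod>w\<in>UNIV. if w = v then 2 powi Poly_Mapping.lookup n w else 1)"
        unfolding mono_eval_def by (intro prod.cong) (auto simp: t_def)
      then show ?thesis by simp
    qed
    show "\<exists>x\<in>{t. \<forall>v. t v \<noteq> 0}. mono_eval x m \<noteq> mono_eval x m'"
      using v by (intro bexI[of _ t]) (simp_all add: t two_powi_inject, simp add: t_def)
  next
    fix m :: "var \<Rightarrow>\<^sub>0 int"
    show "\<exists>x\<in>{t. \<forall>v. t v \<noteq> 0}. mono_eval x m \<noteq> 0"
      by (intro bexI[of _ "\<lambda>_. 1"]) (auto simp: mono_eval_def)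
  next
    fix t :: "var \<Rightarrow> complex" assume "t \<in> {t. \<forall>v. t v \<noteq> 0}"
    then show "(\<Sum>m\<in>Poly_Mapping.keys p. Poly_Mapping.lookup p m * mono_eval t m) = 0"
      using assms by (simp add: poly_eval_mono)
  qed (simp_all add: mono_eval_def power_int_mult_distrib prod.distrib)
  then show ?thesis
    by (intro poly_mapping_eqI) (auto simp: in_keys_iff)
qed

section \<open>Polynomials vanishing on a hypersurface\<close>

text \<open>Only products need work: the \<open>Var x ^ 2\<close> that arises from two remainders is
  replaced by \<open>G - \<beta> * Var x - \<gamma>\<close>, which is possible because
  \<open>G\<close> is monic in x.\<close>

lemma divide_by_quadratic:
  assumes x: "x \<in> U" "x \<notin> V"
    and \<beta>: "\<beta> \<in> Pol (U - {x}) V" and \<gamma>: "\<gamma> \<in> Pol (U - {x}) V"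
    and G: "G = Var x ^ 2 + \<beta> * Var x + \<gamma>"
    and p: "p \<in> Pol U V"
  shows "\<exists>g r0 r1. g \<in> Pol U V \<and> r0 \<in> Pol (U - {x}) V \<and> r1 \<in> Pol (U - {x}) V \<and>
    p = G * g + r0 + r1 * Var x"
  using p
proof (induction p rule: Pol_induct)
  case (const c)
  show ?case by (intro exI[of _ 0] exI[of _ "Const c"]) auto
next
  case (var v)
  show ?case
  proof (cases "v = x")
    case True
    then show ?thesis by (intro exI[of _ 0] exI[of _ 1]) auto
  next
    case False
    then show ?thesis
      using var by (intro exI[of _ 0] exI[of _ "Var v"]) auto
  qed
next
  case (inv v)
  then have "Var_inv v \<in> Pol (U - {x}) V"
    by (auto simp: Pol_iff Var_inv_def lookup_single when_def)
  then show ?case by (intro exI[of _ 0] exI[of _ "Var_inv v"]) auto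
next
  case (add p q)
  then obtain g r0 r1 g' r0' r1' where
    "g \<in> Pol U V" "r0 \<in> Pol (U - {x}) V" "r1 \<in> Pol (U - {x}) V" "p = G * g + r0 + r1 * Var x"
    "g' \<in> Pol U V" "r0' \<in> Pol (U - {x}) V" "r1' \<in> Pol (U - {x}) V" "q = G * g' + r0' + r1' * Var x"
    by blast
  then show ?case
    by (intro exI[of _ "g + g'"] exI[of _ "r0 + r0'"] exI[of _ "r1 + r1'"])
      (auto simp: algebra_simps)
next
  case (mult p q)
  then obtain g r0 r1 g' r0' r1' where
    *: "g \<in> Pol U V" "r0 \<in> Pol (U - {x}) V" "r1 \<in> Pol (U - {x}) V"
    "g' \<in> Pol U V" "r0' \<in> Pol (U - {x}) V" "r1' \<in> Pol (U - {x}) V"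
    and p: "p = G * g + r0 + r1 * Var x" and q: "q = G * g' + r0' + r1' * Var x"
    by blast
  define h where "h = g * q + (r0 + r1 * Var x) * g' + r1 * r1'"
  have sub: "Pol (U - {x}) V \<subseteq> Pol U V"
    using x by (intro Pol_mono) auto
  have "h \<in> Pol U V"
    using * mult x sub by (auto simp: h_def intro!: Pol_add Pol_mult)
  moreover have "p * q = G * h + (r0 * r0' - r1 * r1' * \<gamma>) + (r0 * r1' + r1 * r0' - r1 * r1' * \<beta>) * Var x"
    unfolding h_def p q by (simp add: G algebra_simps power2_eq_square)
  ultimately show ?case
    using * \<beta> \<gamma>
    by (intro exI[of _ h] exI[of _ "r0 * r0' - r1 * r1' * \<gamma>"]
          exI[of _ "r0 * r1' + r1 * r0' - r1 * r1' * \<beta>"]) auto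
qed

text \<open>The elimination variable takes two values over a point where the discriminant does not
  vanish, which kills the remainder of the division.\<close>

lemma vanishing_imp_multiple:
  assumes x: "x \<in> U" "x \<notin> V"
    and \<beta>: "\<beta> \<in> Pol (U - {x}) V" and \<gamma>: "\<gamma> \<in> Pol (U - {x}) V"
    and G: "G = Var x ^ 2 + \<beta> * Var x + \<gamma>"
    and disc: "\<beta> ^ 2 - Const 4 * \<gamma> \<noteq> 0"
    and p: "p \<in> Pol U V"
    and van: "\<And>t. t \<in> pts V \<Longrightarrow> poly_eval t G = 0 \<Longrightarrow> poly_eval t p = 0"
  shows "\<exists>g\<in>Pol U V. p = G * g"
proof -
  obtain g r0 r1 where g: "g \<in> Pol U V" and r0: "r0 \<in> Pol (U - {x}) V"
    and r1: "r1 \<in> Pol (U - {x}) V" and peq: "p = G * g + r0 + r1 * Var x"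
    using divide_by_quadratic[OF x \<beta> \<gamma> G p] by blast
  have sub: "q \<in> Pol U V" if "q \<in> Pol (U - {x}) V" for q
    using that Pol_mono[of "U - {x}" U V V] x by auto
  have FU: "G \<in> Pol U V" using x sub[OF \<beta>] sub[OF \<gamma>] by (auto simp: G)
  have key: "poly_eval t r0 + poly_eval t r1 * z = 0"
    if t: "t \<in> pts V" and z: "z ^ 2 + poly_eval t \<beta> * z + poly_eval t \<gamma> = 0" for t z
  proof -
    let ?t = "t(x := z)"
    have t': "?t \<in> pts V" using t x by (auto simp: pts_def)
    have e: "poly_eval ?t q = poly_eval t q" if "q \<in> Pol (U - {x}) V" for q
      by (rule poly_eval_cong[OF that]) (use x in auto)
    have vx: "Var x \<in> Pol U V" using x by auto
    have F0: "poly_eval ?t G = 0"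
      using z \<beta> \<gamma> t' sub vx x unfolding G
      by (simp add: poly_eval_mult[OF t', of _ U] poly_eval_power[OF t', of _ U] e)
    then have "poly_eval ?t p = 0" using van t' by blast
    then show ?thesis
      using F0 r0 r1 t' sub vx g FU unfolding peq
      by (simp add: poly_eval_mult[OF t', of _ U] e)
  qed
  have r1_0: "r1 = 0"
  proof -
    \<comment> \<open>Multiplying by the discriminant avoids a choice of generic points: the
      relations at the two roots differ by \<open>r1 * r\<close>, where \<open>r ^ 2\<close> is the
      discriminant, so the product vanishes at all points of the torus and the discriminant can be
      cancelled in the integral domain.\<close>
    have "r1 * (\<beta> ^ 2 - Const 4 * \<gamma>) = 0"
    proof (rule poly_eval_eq_0_imp)
      fix t :: "var \<Rightarrow> complex" assume "\<forall>v. t v \<noteq> 0"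
      then have t: "t \<in> pts V" by (auto simp: pts_def)
      define b c where "b = poly_eval t \<beta>" and "c = poly_eval t \<gamma>"
      define r where "r = csqrt (b ^ 2 - 4 * c)"
      have r: "r ^ 2 = b ^ 2 - 4 * c" by (simp add: r_def)
      have "((- b + s) / 2) ^ 2 + b * ((- b + s) / 2) + c = 0" if "s ^ 2 = b ^ 2 - 4 * c" for s
      proof -
        have "((- b + s) / 2) ^ 2 + b * ((- b + s) / 2) + c = (s ^ 2 - (b ^ 2 - 4 * c)) / 4"
          by (simp add: field_simps power2_eq_square)
        then show ?thesis using that by simp
      qed
      from key[OF t, folded b_def c_def, OF this[of r]] key[OF t, folded b_def c_def, OF this[of "- r"]]
      have "poly_eval t r0 + poly_eval t r1 * ((- b + r) / 2) = 0"
        "poly_eval t r0 + poly_eval t r1 * ((- b + - r) / 2) = 0" using r by simp_all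
      moreover have "poly_eval t r1 * r = (poly_eval t r0 + poly_eval t r1 * ((- b + r) / 2))
          - (poly_eval t r0 + poly_eval t r1 * ((- b + - r) / 2))" by (simp add: field_simps)
      ultimately have "poly_eval t r1 * r = 0" by simp
      then have "poly_eval t r1 * r ^ 2 = 0" by (auto simp: power2_eq_square)
      then show "poly_eval t (r1 * (\<beta> ^ 2 - Const 4 * \<gamma>)) = 0"
        unfolding r b_def c_def using r1 \<beta> \<gamma>
        by (simp add: poly_eval_mult[OF t, of _ "U - {x}"] poly_eval_power[OF t, of _ "U - {x}"])
    qed
    with disc show ?thesis by simp
  qed
  have "r0 = 0"
  proof (rule poly_eval_eq_0_imp)
    fix t :: "var \<Rightarrow> complex" assume "\<forall>v. t v \<noteq> 0"
    then have t: "t \<in> pts V" by (auto simp: pts_def)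
    define b c where "b = poly_eval t \<beta>" and "c = poly_eval t \<gamma>"
    have "((- b + csqrt (b ^ 2 - 4 * c)) / 2) ^ 2 + b * ((- b + csqrt (b ^ 2 - 4 * c)) / 2) + c = 0"
    proof -
      have "((- b + s) / 2) ^ 2 + b * ((- b + s) / 2) + c = (s ^ 2 - (b ^ 2 - 4 * c)) / 4" for s
        by (simp add: field_simps power2_eq_square)
      then show ?thesis by (simp only: power2_csqrt diff_self div_0)
    qed
    from key[OF t, folded b_def c_def, OF this] show "poly_eval t r0 = 0"
      by (simp add: r1_0)
  qed
  with r1_0 peq g show ?thesis by auto
qed

section \<open>Algebraic dependence\<close>

text \<open>Gaussian elimination, by induction on the equations: a pivot unknown k of equation j is
  eliminated from the others, which leaves one equation and one unknown fewer.\<close>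

lemma homogeneous_system_solvable:
  fixes a :: "'j \<Rightarrow> 'i \<Rightarrow> complex"
  assumes "finite J" "finite I" "card J < card I"
  shows "\<exists>x. (\<exists>i\<in>I. x i \<noteq> 0) \<and> (\<forall>j\<in>J. (\<Sum>i\<in>I. a j i * x i) = 0)"
  using assms
proof (induction J arbitrary: I a rule: finite_induct)
  case empty
  then obtain i where "i \<in> I" by fastforce
  then show ?case by (intro exI[of _ "\<lambda>_. 1"]) auto
next
  case (insert j J)
  show ?case
  proof (cases "\<forall>i\<in>I. a j i = 0")
    case True
    have "card J < card I" using insert by simp
    with insert.IH[of I a] insert.prems obtain x where
      "\<exists>i\<in>I. x i \<noteq> 0" "\<forall>j\<in>J. (\<Sum>i\<in>I. a j i * x i) = 0" by blast
    with True show ?thesis by (intro exI[of _ x]) auto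
  next
    case False
    then obtain k where k: "k \<in> I" "a j k \<noteq> 0" by blast
    define I' where "I' = I - {k}"
    have I': "finite I'" "card J < card I'" "I = insert k I'" "k \<notin> I'"
      using insert k by (auto simp: I'_def)
    obtain x where x: "\<exists>i\<in>I'. x i \<noteq> 0"
      "\<And>l. l \<in> J \<Longrightarrow> (\<Sum>i\<in>I'. (a l i - a l k * a j i / a j k) * x i) = 0"
      using insert.IH[of I' "\<lambda>l i. a l i - a l k * a j i / a j k"] I' by blast
    define s where "s = (\<Sum>i\<in>I'. a j i * x i)"
    define y where "y = x(k := - s / a j k)"
    have y: "(\<Sum>i\<in>I. a l i * y i) = a l k * (- s / a j k) + (\<Sum>i\<in>I'. a l i * x i)" for l
    proof -
      have "(\<Sum>i\<in>I'. a l i * y i) = (\<Sum>i\<in>I'. a l i * x i)"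
        using I' by (intro sum.cong) (auto simp: y_def)
      then show ?thesis using I' by (simp add: y_def)
    qed
    have "(\<Sum>i\<in>I. a j i * y i) = 0"
      using k by (simp add: y s_def)
    moreover have "(\<Sum>i\<in>I. a l i * y i) = 0" if "l \<in> J" for l
    proof -
      have "(\<Sum>i\<in>I'. (a l i - a l k * a j i / a j k) * x i)
          = (\<Sum>i\<in>I'. a l i * x i) - a l k / a j k * s"
        unfolding s_def sum_distrib_left sum_subtractf[symmetric]
        by (intro sum.cong) (auto simp: algebra_simps)
      then show ?thesis using x(2)[OF that] by (simp add: y)
    qed
    moreover have "\<exists>i\<in>I. y i \<noteq> 0"
      using x(1) I' by (auto simp: y_def)
    ultimately show ?thesis by (intro exI[of _ y]) auto
  qed
qed

section \<open>Exponent bounds and algebraic dependence by counting\<close>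

definition bounded_exps :: "nat \<Rightarrow> lpoly set" where
  "bounded_exps M = {p. \<forall>m\<in>Poly_Mapping.keys p. \<forall>v. \<bar>Poly_Mapping.lookup m v\<bar> \<le> int M}"

lemma bounded_exps_mult:
  assumes "p \<in> bounded_exps A" "q \<in> bounded_exps B" shows "p * q \<in> bounded_exps (A + B)"
  unfolding bounded_exps_def
proof (intro CollectI ballI allI)
  fix m v assume "m \<in> Poly_Mapping.keys (p * q)"
  then obtain a b where ab: "a \<in> Poly_Mapping.keys p" "b \<in> Poly_Mapping.keys q" "m = a + b"
    using Poly_Mapping.keys_mult[of p q] by blast
  then have "\<bar>Poly_Mapping.lookup a v\<bar> \<le> int A" "\<bar>Poly_Mapping.lookup b v\<bar> \<le> int B"
    using assms by (auto simp: bounded_exps_def)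
  then show "\<bar>Poly_Mapping.lookup m v\<bar> \<le> int (A + B)"
    by (simp add: ab lookup_add)
qed

lemma bounded_exps_1: "1 \<in> bounded_exps 0"
  by (auto simp: bounded_exps_def)

lemma bounded_exps_mono: "A \<le> B \<Longrightarrow> bounded_exps A \<subseteq> bounded_exps B"
  unfolding bounded_exps_def by clarify (meson of_nat_mono order_trans)

lemma bounded_exps_power: "p \<in> bounded_exps A \<Longrightarrow> p ^ n \<in> bounded_exps (n * A)"
  by (induction n) (auto intro: bounded_exps_1 bounded_exps_mult)

lemma bounded_exps_exists: "\<exists>M. p \<in> bounded_exps M"
proof -
  define X where "X = (\<lambda>(m, v). nat \<bar>Poly_Mapping.lookup m v\<bar>) ` (Poly_Mapping.keys p \<times> (UNIV :: var set))"
  have fin: "finite X" by (auto simp: X_def)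
  have "\<bar>Poly_Mapping.lookup m v\<bar> \<le> int (Max X)" if "m \<in> Poly_Mapping.keys p" for m v
  proof -
    have "nat \<bar>Poly_Mapping.lookup m v\<bar> \<in> X" using that by (force simp: X_def)
    then have "nat \<bar>Poly_Mapping.lookup m v\<bar> \<le> Max X" using fin by simp
    then show ?thesis by linarith
  qed
  then show ?thesis by (auto simp: bounded_exps_def)
qed

definition list_mono :: "lpoly list \<Rightarrow> nat list \<Rightarrow> lpoly" where
  "list_mono ys es = prod_list (map2 (^) ys es)"

lemma list_mono_simps [simp]:
  "list_mono [] [] = 1" "list_mono (y # ys) (e # es) = y ^ e * list_mono ys es"
  by (simp_all add: list_mono_def)

lemma list_mono_Pol:
  "length ys = length es \<Longrightarrow> set ys \<subseteq> Pol U V \<Longrightarrow> list_mono ys es \<in> Pol U V"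
  by (induction ys es rule: list_induct2) auto

lemma list_mono_bounded:
  "length ys = length es \<Longrightarrow> set ys \<subseteq> bounded_exps D \<Longrightarrow> set es \<subseteq> {..k} \<Longrightarrow>
    list_mono ys es \<in> bounded_exps (length ys * (k * D))"
proof (induction ys es rule: list_induct2)
  case (Cons y ys e es)
  then have "y ^ e \<in> bounded_exps (k * D)"
    using bounded_exps_power[of y D e] bounded_exps_mono[of "e * D" "k * D"] by auto
  then show ?case
    using Cons by (auto intro: bounded_exps_mult)
qed (simp add: bounded_exps_1)

text \<open>There are more products of the \<open>ys\<close> than monomials in which to expand them:
  exponents at most k give \<open>(k + 1) ^ n\<close> products, and all their monomials lie in a box
  with \<open>2 * B + 1\<close> exponents for each of the N variables. A dependence is a nonzero
  solution of a linear system with one equation per monomial. The box is symmetric about 0 because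
  exponents may be negative.\<close>

lemma algebraically_dependent:
  assumes "set ys \<subseteq> Pol U V" "card (U \<union> V) < length ys"
  shows "\<exists>S c. finite S \<and> S \<noteq> {} \<and> (\<forall>e\<in>S. length e = length ys \<and> c e \<noteq> 0) \<and>
    (\<Sum>e\<in>S. Const (c e) * list_mono ys e) = 0"
proof -
  define n where "n = length ys"
  define N where "N = card (U \<union> V)"
  have "\<forall>y. \<exists>M. y \<in> bounded_exps M" using bounded_exps_exists by blast
  then obtain M where M: "\<And>y. y \<in> bounded_exps (M y)" by metis
  define D where "D = sum_list (map M ys)"
  have "M y \<le> D" if "y \<in> set ys" for y
    using that by (auto simp: D_def intro: member_le_sum_list)
  then have D: "set ys \<subseteq> bounded_exps D"
    using M bounded_exps_mono by blast
  \<comment> \<open>With \<open>B = n * (k * D)\<close> one has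
    \<open>2 * B + 1 \<le> C * (k + 1)\<close>, and the choice \<open>k = C ^ N\<close> bounds the
    number of monomials by \<open>k * (k + 1) ^ N\<close>, which is less than
    \<open>(k + 1) ^ (N + 1)\<close>.\<close>
  define C where "C = 2 * (n * D) + 1"
  define k where "k = C ^ N"
  define B where "B = n * (k * D)"
  define I where "I = {es :: nat list. set es \<subseteq> {..k} \<and> length es = n}"
  define J where "J = {m :: var \<Rightarrow>\<^sub>0 int. Poly_Mapping.keys m \<subseteq> U \<union> V \<and> (\<forall>v. \<bar>Poly_Mapping.lookup m v\<bar> \<le> int B)}"
  have cardI: "card I = (k + 1) ^ n" and finI: "finite I"
    by (simp_all add: I_def card_lists_length_eq finite_lists_length_eq)
  define enc where "enc m = restrict (Poly_Mapping.lookup m) (U \<union> V)" for m :: "var \<Rightarrow>\<^sub>0 int"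
  have inj: "inj_on enc J"
  proof (rule inj_onI)
    fix m m' assume mm: "m \<in> J" "m' \<in> J" "enc m = enc m'"
    show "m = m'"
    proof (rule poly_mapping_eqI)
      fix v show "Poly_Mapping.lookup m v = Poly_Mapping.lookup m' v"
      proof (cases "v \<in> U \<union> V")
        case True
        then show ?thesis using fun_cong[OF mm(3), of v] by (auto simp: enc_def)
      next
        case False
        then have "v \<notin> Poly_Mapping.keys m" "v \<notin> Poly_Mapping.keys m'"
          using mm by (auto simp: J_def)
        then show ?thesis by (simp add: in_keys_iff)
      qed
    qed
  qed
  have encJ: "enc ` J \<subseteq> (U \<union> V) \<rightarrow>\<^sub>E {- int B..int B}"
    unfolding enc_def J_def by (intro image_subsetI restrict_PiE_iff[THEN iffD2] ballI) (auto simp: abs_le_iff minus_le_iff)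
  have finE: "finite ((U \<union> V) \<rightarrow>\<^sub>E {- int B..int B})" by (intro finite_PiE) auto
  have finJ: "finite J"
    using finite_imageD[OF finite_subset[OF encJ finE] inj] .
  have "card J \<le> card ((U \<union> V) \<rightarrow>\<^sub>E {- int B..int B})"
    using card_image[OF inj] card_mono[OF finE encJ] by simp
  also have "\<dots> = (2 * B + 1) ^ N"
    by (simp add: card_PiE N_def nat_add_distrib nat_mult_distrib)
  also have "\<dots> \<le> (C * (k + 1)) ^ N"
    by (intro power_mono) (auto simp: B_def C_def algebra_simps)
  also have "\<dots> = k * (k + 1) ^ N" by (simp only: power_mult_distrib k_def[symmetric])
  also have "\<dots> < (k + 1) * (k + 1) ^ N" by simp
  also have "\<dots> = (k + 1) ^ (Suc N)" by simp
  also have "\<dots> \<le> (k + 1) ^ n" using assms by (intro power_increasing) (auto simp: N_def n_def)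
  finally have "card J < card I" by (simp add: cardI)
  from homogeneous_system_solvable[OF finJ finI this, of "\<lambda>m es. Poly_Mapping.lookup (list_mono ys es) m"]
  obtain c where c: "\<exists>es\<in>I. c es \<noteq> 0"
    "\<And>m. m \<in> J \<Longrightarrow> (\<Sum>es\<in>I. Poly_Mapping.lookup (list_mono ys es) m * c es) = 0" by blast
  define S where "S = {es\<in>I. c es \<noteq> 0}"
  have "(\<Sum>e\<in>I. Const (c e) * list_mono ys e) = 0"
  proof (rule poly_mapping_eqI)
    fix m
    have lk: "Poly_Mapping.lookup (Const a * p) m = a * Poly_Mapping.lookup p m" for a p
      by (simp add: Const_def map.rep_eq when_def flip: mult_map_scale_conv_mult)
    have "(\<Sum>es\<in>I. c es * Poly_Mapping.lookup (list_mono ys es) m) = 0"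
    proof (cases "m \<in> J")
      case True
      then show ?thesis using c(2) by (simp add: mult.commute)
    next
      case False
      have "Poly_Mapping.lookup (list_mono ys es) m = 0" if es: "es \<in> I" for es
      proof (rule ccontr)
        assume "Poly_Mapping.lookup (list_mono ys es) m \<noteq> 0"
        then have m: "m \<in> Poly_Mapping.keys (list_mono ys es)" by (simp add: in_keys_iff)
        have "list_mono ys es \<in> Pol U V" "list_mono ys es \<in> bounded_exps B"
          using es assms D list_mono_bounded[of ys es D k]
          by (auto simp: I_def n_def B_def intro: list_mono_Pol)
        with m have "m \<in> J" by (auto simp: J_def Pol_iff bounded_exps_def)
        with False show False by simp
      qed
      then show ?thesis by (intro sum.neutral ballI) simp
    qed
    then show "Poly_Mapping.lookup (\<Sum>e\<in>I. Const (c e) * list_mono ys e) m = Poly_Mapping.lookup 0 m"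
      by (simp add: lookup_sum lk)
  qed
  also have "(\<Sum>e\<in>I. Const (c e) * list_mono ys e) = (\<Sum>e\<in>S. Const (c e) * list_mono ys e)"
    unfolding S_def using finI by (intro sum.mono_neutral_right) auto
  finally have "(\<Sum>e\<in>S. Const (c e) * list_mono ys e) = 0" .
  moreover have "finite S" using finI by (simp add: S_def)
  moreover have "S \<noteq> {}" "\<forall>e\<in>S. length e = length ys \<and> c e \<noteq> 0"
    using c(1) by (auto simp: S_def I_def n_def)
  ultimately show ?thesis by blast
qed

text \<open>In a relation with values in \<open>P 0\<close>, a power of the first element can be cancelled because
  \<open>P 0\<close> is prime. Modulo \<open>P 1\<close> only the terms of lowest degree in that element remain.\<close>

lemma primeideal_chain_independent:
  fixes P :: "nat \<Rightarrow> lpoly set"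
  assumes "length ys = n"
    and "\<And>i. i \<le> n \<Longrightarrow> primeideal (P i) (poly_ring U V)"
    and "\<And>i. i < n \<Longrightarrow> P i \<subseteq> P (Suc i) \<and> ys ! i \<in> P (Suc i) - P i"
    and "finite S" "S \<noteq> {}" "\<And>e. e \<in> S \<Longrightarrow> length e = n \<and> c e \<noteq> 0"
    and "(\<Sum>e\<in>S. Const (c e) * list_mono ys e) \<in> P 0"
  shows False
  using assms
proof (induction n arbitrary: ys P S c)
  case 0
  interpret primeideal "P 0" "poly_ring U V" using 0(2) by simp
  have S: "S = {[]}" using "0.prems" by auto
  have "Const (inverse (c [])) * Const (c []) \<in> P 0"
    using I_l_closed[of "Const (c [])" "Const (inverse (c []))"] "0.prems" by (simp add: S)
  then have "1 \<in> P 0" using "0.prems"(6) S by (simp flip: Const_mult)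
  then show False using I_notcarr one_imp_carrier by simp
next
  case (Suc n)
  obtain y zs where ys: "ys = y # zs" "length zs = n" using Suc.prems(1) by (metis length_Suc_conv)
  interpret P0: primeideal "P 0" "poly_ring U V" using Suc.prems(2) by simp
  interpret P1: primeideal "P 1" "poly_ring U V" using Suc.prems(2)[of 1] by simp
  have P01: "P 0 \<subseteq> P 1" "y \<in> P 1" "y \<notin> P 0" using Suc.prems(3)[of 0] by (auto simp: ys)
  have yP: "y \<in> Pol U V" using P01 P1.a_subset by blast
  have zP: "set zs \<subseteq> Pol U V"
  proof
    fix z assume "z \<in> set zs"
    then obtain i where i: "i < n" "zs ! i = z" using ys by (metis in_set_conv_nth)
    then have "z \<in> P (Suc (Suc i))" using Suc.prems(3)[of "Suc i"] by (auto simp: ys)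
    moreover have "primeideal (P (Suc (Suc i))) (poly_ring U V)" using Suc.prems(2) i by simp
    ultimately show "z \<in> Pol U V"
      by (meson additive_subgroup.a_subset ideal.axioms(1) primeideal.axioms(1) subsetD)
  qed
  define m where "m = Min (hd ` S)"
  have m: "m \<in> hd ` S" "\<And>e. e \<in> S \<Longrightarrow> m \<le> hd e"
    using Suc.prems(4,5) by (auto simp: m_def)
  have eS: "e = hd e # tl e" "length (tl e) = n" "c e \<noteq> 0" if "e \<in> S" for e
    using Suc.prems(6)[OF that] by (auto simp: length_Suc_conv)
  define T where "T e = Const (c e) * list_mono zs (tl e)" for e
  have TP: "T e \<in> Pol U V" if "e \<in> S" for e
    using eS[OF that] ys zP by (auto simp: T_def intro!: list_mono_Pol Pol_mult)
  have "Const (c e) * list_mono ys e = y ^ m * (y ^ (hd e - m) * T e)" if "e \<in> S" for e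
  proof -
    have "list_mono ys e = y ^ hd e * list_mono zs (tl e)"
      using eS[OF that] ys by (metis list_mono_simps(2))
    also have "y ^ hd e = y ^ m * y ^ (hd e - m)" using m(2)[OF that] by (simp flip: power_add)
    finally show ?thesis by (simp add: T_def algebra_simps)
  qed
  then have "(\<Sum>e\<in>S. Const (c e) * list_mono ys e) = y ^ m * (\<Sum>e\<in>S. y ^ (hd e - m) * T e)"
    by (simp add: sum_distrib_left)
  then have 1: "y ^ m * (\<Sum>e\<in>S. y ^ (hd e - m) * T e) \<in> P 0"
    using Suc.prems(7) by simp
  have ym: "y ^ k \<notin> P 0" for k
  proof (induction k)
    case 0
    then show ?case using P0.I_notcarr P0.one_imp_carrier by auto
  next
    case (Suc k)
    then show ?case using P0.I_prime[of y "y ^ k"] yP P01 by auto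
  qed
  have "(\<Sum>e\<in>S. y ^ (hd e - m) * T e) \<in> Pol U V" using yP TP by (auto intro!: Pol_sum Pol_mult)
  then have "(\<Sum>e\<in>S. y ^ (hd e - m) * T e) \<in> P 0"
    using 1 ym[of m] P0.I_prime[of "y ^ m" "\<Sum>e\<in>S. y ^ (hd e - m) * T e"] yP
    by auto
  then have 2: "(\<Sum>e\<in>S. y ^ (hd e - m) * T e) \<in> P 1" using P01 by blast
  define A where "A = {e \<in> S. hd e = m}"
  have P1sum: "sum f X \<in> P 1" if "\<And>x. x \<in> X \<Longrightarrow> f x \<in> P 1" for f and X :: "nat list set"
    using that
  proof (induction X rule: infinite_finite_induct)
    case (insert x X)
    then show ?case using P1.a_closed[of "f x" "sum f X"] by simp
  qed (use P1.zero_closed in auto)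
  have rest: "(\<Sum>e\<in>S - A. y ^ (hd e - m) * T e) \<in> P 1"
  proof (rule P1sum)
    fix e assume e: "e \<in> S - A"
    then have "hd e - m \<noteq> 0" using m(2)[of e] by (simp add: A_def)
    then obtain k where k: "hd e - m = Suc k" using not0_implies_Suc by blast
    have "(y ^ k * T e) * y \<in> P 1"
      using P1.I_l_closed[of y "y ^ k * T e"] P01 yP TP e by auto
    then show "y ^ (hd e - m) * T e \<in> P 1" by (simp add: k algebra_simps)
  qed
  have split: "(\<Sum>e\<in>S. y ^ (hd e - m) * T e)
      = (\<Sum>e\<in>S - A. y ^ (hd e - m) * T e) + (\<Sum>e\<in>A. T e)"
    using sum.subset_diff[of A S "\<lambda>e. y ^ (hd e - m) * T e"] Suc.prems(4) by (simp add: A_def)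
  have "b \<in> P 1" if "a \<in> P 1" "a + b \<in> P 1" for a b
  proof -
    have "Const (-1) * a \<in> P 1" using P1.I_l_closed[OF that(1), of "Const (-1)"] by simp
    then have "(a + b) + Const (-1) * a \<in> P 1" using P1.a_closed[OF that(2)] by simp
    then show ?thesis by (simp add: Const_uminus)
  qed
  note cancel = this
  have A1: "(\<Sum>e\<in>A. T e) \<in> P 1"
    using cancel[OF rest] 2 split by simp
  \<comment> \<open>All vectors in \<open>A\<close> begin with the same m, so dropping the head
    loses nothing and keeps the coefficients.\<close>
  have inj: "inj_on tl A"
  proof (rule inj_onI)
    fix a b assume "a \<in> A" "b \<in> A" "tl a = tl b"
    then show "a = b" using eS(1)[of a] eS(1)[of b] by (simp add: A_def)
  qed
  define c' where "c' e = c (m # e)" for e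
  have cA: "c' (tl e) = c e" if "e \<in> A" for e
    using eS(1)[of e] that by (simp add: A_def c'_def)
  have "(\<Sum>e\<in>tl ` A. Const (c' e) * list_mono zs e) \<in> P 1"
    using A1 by (simp add: sum.reindex[OF inj] cA T_def)
  then show False
  proof (intro Suc.IH[of zs "\<lambda>i. P (Suc i)" "tl ` A" c'])
    show "P (Suc i) \<subseteq> P (Suc (Suc i)) \<and> zs ! i \<in> P (Suc (Suc i)) - P (Suc i)" if "i < n" for i
      using Suc.prems(3)[of "Suc i"] that by (simp add: ys)
    show "tl ` A \<noteq> {}" using m(1) by (auto simp: A_def)
    show "length e = n \<and> c' e \<noteq> 0" if "e \<in> tl ` A" for e
      using that eS cA by (auto simp: A_def)
  qed (use Suc.prems ys in \<open>auto simp: A_def\<close>)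
qed

section \<open>Points of a hypersurface\<close>

definition van_ideal :: "var set \<Rightarrow> var set \<Rightarrow> (var \<Rightarrow> complex) set \<Rightarrow> lpoly set" where
  "van_ideal U V Z = {p \<in> Pol U V. \<forall>t\<in>Z. poly_eval t p = 0}"

lemma van_ideal_ideal:
  assumes "Z \<subseteq> pts V" shows "ideal (van_ideal U V Z) (poly_ring U V)"
proof -
  interpret cring "poly_ring U V" by (rule poly_ring_cring)
  have m: "poly_eval t (p * q) = poly_eval t p * poly_eval t q"
    if "t \<in> Z" "p \<in> Pol U V" "q \<in> Pol U V" for t p q
    using that assms by (intro poly_eval_mult) auto
  show ?thesis
  proof (rule idealI)
    show "subgroup (van_ideal U V Z) (add_monoid (poly_ring U V))"
    proof (rule add.subgroupI)
      fix p assume p: "p \<in> van_ideal U V Z"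
      then have "p \<in> Pol U V" by (simp add: van_ideal_def)
      then have "\<ominus>\<^bsub>poly_ring U V\<^esub> p = - p"
        by (intro minus_equality) auto
      then show "\<ominus>\<^bsub>poly_ring U V\<^esub> p \<in> van_ideal U V Z" using p by (simp add: van_ideal_def)
    qed (auto simp: van_ideal_def intro: exI[of _ 0])
  qed (use ring_axioms m in \<open>auto simp: van_ideal_def\<close>)
qed

abbreviation pt_ideal :: "var set \<Rightarrow> var set \<Rightarrow> (var \<Rightarrow> complex) \<Rightarrow> lpoly set" where
  "pt_ideal U V t \<equiv> van_ideal U V {t}"

definition pt_ideal_sq :: "var set \<Rightarrow> var set \<Rightarrow> (var \<Rightarrow> complex) \<Rightarrow> lpoly set" where
  "pt_ideal_sq U V t = ideal_prod (poly_ring U V) (pt_ideal U V t) (pt_ideal U V t)"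

subsection \<open>Partial derivatives\<close>

text \<open>The derivative is the analytic one along a coordinate line, so that the product rule,
  the derivative of an inverse variable and the gradient of the cubic all come from
  calculus.\<close>

definition has_pd :: "(var \<Rightarrow> complex) \<Rightarrow> var \<Rightarrow> lpoly \<Rightarrow> complex \<Rightarrow> bool" where
  "has_pd t v f D \<longleftrightarrow> ((\<lambda>z. poly_eval (t(v := z)) f) has_field_derivative D) (at (t v))"

definition pd :: "(var \<Rightarrow> complex) \<Rightarrow> var \<Rightarrow> lpoly \<Rightarrow> complex" where
  "pd t v f = deriv (\<lambda>z. poly_eval (t(v := z)) f) (t v)"

lemma has_pd_imp_pd: "has_pd t v f D \<Longrightarrow> pd t v f = D"
  unfolding has_pd_def pd_def by (rule DERIV_imp_deriv)

lemma has_pd_add: "has_pd t v f D \<Longrightarrow> has_pd t v g E \<Longrightarrow> has_pd t v (f + g) (D + E)"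
  unfolding has_pd_def by (auto intro: DERIV_add)

lemma has_pd_Const: "has_pd t v (Const c) 0"
  unfolding has_pd_def by simp

lemma has_pd_Var: "has_pd t v (Var w) (if v = w then 1 else 0)"
  unfolding has_pd_def by (auto simp: fun_upd_def)

text \<open>Evaluation is multiplicative only on \<open>pts V\<close>. Openness along each
  coordinate line lets identities valid there be differentiated.\<close>

lemma eventually_upd_pts:
  assumes "t \<in> pts V" shows "\<forall>\<^sub>F z in nhds (t v). t(v := z) \<in> pts V"
proof (cases "v \<in> V")
  case True
  then have "\<forall>\<^sub>F z in nhds (t v). z \<noteq> 0" using assms by (intro t1_space_nhds) (auto simp: pts_def)
  then show ?thesis by (rule eventually_mono) (use assms in \<open>auto simp: pts_def\<close>)
next
  case False
  then show ?thesis using assms by (intro always_eventually) (auto simp: pts_def)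
qed

lemma has_pd_mult:
  assumes t: "t \<in> pts V" and f: "f \<in> Pol U V" "has_pd t v f D" and g: "g \<in> Pol U V" "has_pd t v g E"
  shows "has_pd t v (f * g) (D * poly_eval t g + E * poly_eval t f)"
proof -
  have "((\<lambda>z. poly_eval (t(v := z)) f * poly_eval (t(v := z)) g) has_field_derivative
      (D * poly_eval t g + E * poly_eval t f)) (at (t v))"
    using DERIV_mult[OF f(2)[unfolded has_pd_def] g(2)[unfolded has_pd_def]] by simp
  moreover have "\<forall>\<^sub>F z in nhds (t v). poly_eval (t(v := z)) (f * g)
      = poly_eval (t(v := z)) f * poly_eval (t(v := z)) g"
    using eventually_upd_pts[OF t, of v] by (rule eventually_mono) (use f g in auto)
  ultimately show ?thesis
    unfolding has_pd_def by (subst DERIV_cong_ev[OF refl _ refl])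
qed

text \<open>The first-order Taylor formula modulo the square of the maximal ideal. Existence of the
  derivatives and the expansion are proved together, so that the linear coefficients are known to be
  the derivatives.\<close>

lemma taylor_expansion:
  assumes t: "t \<in> pts V" and disj: "U \<inter> V = {}" and f: "f \<in> Pol U V"
  shows "\<exists>D. (\<forall>v. has_pd t v f (D v)) \<and>
    f - Const (poly_eval t f) - (\<Sum>v\<in>U \<union> V. Const (D v) * (Var v - Const (t v))) \<in> pt_ideal_sq U V t"
proof -
  interpret L: cring "poly_ring U V" by (rule poly_ring_cring)
  have id: "ideal (pt_ideal U V t) (poly_ring U V)" using t by (intro van_ideal_ideal) auto
  interpret M: ideal "pt_ideal_sq U V t" "poly_ring U V"
    unfolding pt_ideal_sq_def by (rule L.ideal_prod_is_ideal[OF id id])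
  have M0: "0 \<in> pt_ideal_sq U V t" using M.zero_closed by simp
  have Ma: "a + b \<in> pt_ideal_sq U V t" if "a \<in> pt_ideal_sq U V t" "b \<in> pt_ideal_sq U V t" for a b
    using M.a_closed[OF that] by simp
  have Mm: "a * b \<in> pt_ideal_sq U V t" if "a \<in> Pol U V" "b \<in> pt_ideal_sq U V t" for a b
    using M.I_l_closed[OF that(2,1)] by simp
  have mm: "a * b \<in> pt_ideal_sq U V t" if "a \<in> pt_ideal U V t" "b \<in> pt_ideal U V t" for a b
    using ideal_prod.prod[OF that, of "poly_ring U V"] by (simp add: pt_ideal_sq_def)
  have Vm: "Var v - Const (t v) \<in> pt_ideal U V t" if "v \<in> U \<union> V" for v
    using that by (auto simp: van_ideal_def)
  show ?thesis
    using f
  proof (induction f rule: Pol_induct)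
    case (const c)
    show ?case by (intro exI[of _ "\<lambda>_. 0"]) (auto simp: has_pd_Const M0)
  next
    case (var w)
    have "(\<Sum>v\<in>U \<union> V. Const (if v = w then 1 else 0) * (Var v - Const (t v)))
        = (\<Sum>v\<in>U \<union> V. if v = w then Var v - Const (t v) else 0)"
      by (intro sum.cong) auto
    also have "\<dots> = Var w - Const (t w)" using var by simp
    finally show ?case
      by (intro exI[of _ "\<lambda>v. if v = w then 1 else 0"]) (auto simp: has_pd_Var M0)
  next
    case (inv w)
    define d where "d = - (inverse (t w) * inverse (t w))"
    have tw: "t w \<noteq> 0" using inv t by (auto simp: pts_def)
    have "(\<Sum>v\<in>U \<union> V. Const (if v = w then d else 0) * (Var v - Const (t v)))
        = (\<Sum>v\<in>U \<union> V. if v = w then Const d * (Var v - Const (t v)) else 0)"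
      by (intro sum.cong) auto
    also have "\<dots> = Const d * (Var w - Const (t w))" using inv by simp
    finally have 1: "(\<Sum>v\<in>U \<union> V. Const (if v = w then d else 0) * (Var v - Const (t v)))
      = Const d * (Var w - Const (t w))" .
    have c: "Const (inverse (t w)) * Const (t w) = 1" using tw by (simp flip: Const_mult)
    \<comment> \<open>This is 1/x - 1/a + (x - a)/a^2 = (x - a)^2/(a^2 x), with x the variable and a
      its value at t.\<close>
    have "Var_inv w - Const (inverse (t w)) - Const d * (Var w - Const (t w))
        = (Const (- d) * Var_inv w) * ((Var w - Const (t w)) * (Var w - Const (t w)))"
    proof -
      have *: "y - i - (- (i * i)) * (x - a) = (i * i * y) * ((x - a) * (x - a))"
        if "y * x = 1" "i * a = 1" for x y i a :: lpoly
      proof -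
        have "(i * i * y) * ((x - a) * (x - a)) - (y - i - (- (i * i)) * (x - a))
            = (i * i * x - 2 * i * i * a) * (y * x - 1) + (i * a + 1) * y * (i * a - 1)
              + (- i) * (i * a - 1)"
          by (simp add: algebra_simps)
        then show ?thesis using that by simp
      qed
      show ?thesis using *[OF Var_inv_mult(1) c] by (simp add: d_def Const_uminus Const_mult)
    qed
    moreover have "\<dots> \<in> pt_ideal_sq U V t"
      using inv Vm disj by (intro Mm mm Pol_mult) auto
    moreover have "has_pd t v (Var_inv w) (if v = w then d else 0)" for v
    proof (cases "v = w")
      case True
      have "((\<lambda>z. inverse z) has_field_derivative - (inverse (t w) * 1 * inverse (t w))) (at (t w))"
        using DERIV_inverse'[OF DERIV_ident tw] by simp
      then show ?thesis using True by (simp add: has_pd_def d_def)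
    qed (simp add: has_pd_def)
    ultimately show ?case
      by (intro exI[of _ "\<lambda>v. if v = w then d else 0"]) (simp add: 1)
  next
    case (add f g)
    then obtain D E where D: "\<forall>v. has_pd t v f (D v)"
      "f - Const (poly_eval t f) - (\<Sum>v\<in>U \<union> V. Const (D v) * (Var v - Const (t v))) \<in> pt_ideal_sq U V t"
      and E: "\<forall>v. has_pd t v g (E v)"
      "g - Const (poly_eval t g) - (\<Sum>v\<in>U \<union> V. Const (E v) * (Var v - Const (t v))) \<in> pt_ideal_sq U V t"
      by blast
    show ?case
      using D(1) E(1) Ma[OF D(2) E(2)]
      by (intro exI[of _ "\<lambda>v. D v + E v"])
        (auto simp: has_pd_add Const_add algebra_simps sum.distrib sum_subtractf)
  next
    case (mult f g)
    then obtain D E where D: "\<forall>v. has_pd t v f (D v)"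
      "f - Const (poly_eval t f) - (\<Sum>v\<in>U \<union> V. Const (D v) * (Var v - Const (t v))) \<in> pt_ideal_sq U V t"
      and E: "\<forall>v. has_pd t v g (E v)"
      "g - Const (poly_eval t g) - (\<Sum>v\<in>U \<union> V. Const (E v) * (Var v - Const (t v))) \<in> pt_ideal_sq U V t"
      by blast
    define f0 g0 where "f0 = Const (poly_eval t f)" and "g0 = Const (poly_eval t g)"
    define f1 g1 where "f1 = (\<Sum>v\<in>U \<union> V. Const (D v) * (Var v - Const (t v)))"
      and "g1 = (\<Sum>v\<in>U \<union> V. Const (E v) * (Var v - Const (t v)))"
    define C where "C v = D v * poly_eval t g + E v * poly_eval t f" for v
    have C: "(\<Sum>v\<in>U \<union> V. Const (C v) * (Var v - Const (t v))) = g0 * f1 + f0 * g1"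
      unfolding f1_def g1_def sum_distrib_left sum.distrib[symmetric]
      by (intro sum.cong) (auto simp: C_def f0_def g0_def Const_add Const_mult algebra_simps)
    have fg: "f * g - f0 * g0 - (g0 * f1 + f0 * g1)
        = (f - f0) * (g - g0) + (f0 * (g - g0 - g1) + g0 * (f - f0 - f1))"
      by (simp add: algebra_simps)
    have "(f - f0) * (g - g0) \<in> pt_ideal_sq U V t"
      using mult by (intro mm) (auto simp: van_ideal_def f0_def g0_def)
    moreover have "f0 * (g - g0 - g1) \<in> pt_ideal_sq U V t" "g0 * (f - f0 - f1) \<in> pt_ideal_sq U V t"
      using D E by (auto simp: f0_def g0_def f1_def g1_def intro!: Mm)
    ultimately have "f * g - f0 * g0 - (g0 * f1 + f0 * g1) \<in> pt_ideal_sq U V t"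
      unfolding fg by (intro Ma)
    moreover have "has_pd t v (f * g) (C v)" for v
      unfolding C_def using D E mult t by (intro has_pd_mult) auto
    ultimately show ?case
      using mult t by (intro exI[of _ C]) (simp add: C f0_def g0_def Const_mult)
  qed
qed

lemma has_pd_pd:
  assumes "t \<in> pts V" "U \<inter> V = {}" "f \<in> Pol U V" shows "has_pd t v f (pd t v f)"
  using taylor_expansion[OF assms] has_pd_imp_pd by metis

lemma taylor_pd:
  assumes "t \<in> pts V" "U \<inter> V = {}" "f \<in> Pol U V"
  shows "f - Const (poly_eval t f) - (\<Sum>v\<in>U \<union> V. Const (pd t v f) * (Var v - Const (t v))) \<in> pt_ideal_sq U V t"
proof -
  obtain D where D: "\<And>v. has_pd t v f (D v)" and
   *: "f - Const (poly_eval t f) - (\<Sum>v\<in>U \<union> V. Const (D v) * (Var v - Const (t v))) \<in> pt_ideal_sq U V t"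
    using taylor_expansion[OF assms] by blast
  have "D = (\<lambda>v. pd t v f)" using has_pd_imp_pd[OF D] by auto
  with * show ?thesis by simp
qed

lemma pd_add:
  assumes "t \<in> pts V" "U \<inter> V = {}" "f \<in> Pol U V" "g \<in> Pol U V"
  shows "pd t v (f + g) = pd t v f + pd t v g"
  using assms by (intro has_pd_imp_pd has_pd_add has_pd_pd)

lemma pd_mult:
  assumes "t \<in> pts V" "U \<inter> V = {}" "f \<in> Pol U V" "g \<in> Pol U V"
  shows "pd t v (f * g) = pd t v f * poly_eval t g + pd t v g * poly_eval t f"
  using assms by (intro has_pd_imp_pd has_pd_mult has_pd_pd)

lemma pd_Const: "pd t v (Const c) = 0"
  by (rule has_pd_imp_pd[OF has_pd_Const])

lemma pd_Var: "pd t v (Var w) = (if v = w then 1 else 0)"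
  by (rule has_pd_imp_pd[OF has_pd_Var])

lemma pd_Const_mult:
  assumes "t \<in> pts V" "U \<inter> V = {}" "f \<in> Pol U V"
  shows "pd t v (Const c * f) = c * pd t v f"
  using pd_mult[OF assms(1,2) Pol_Const assms(3), of v c] by (simp add: pd_Const)

lemma pd_diff:
  assumes "t \<in> pts V" "U \<inter> V = {}" "f \<in> Pol U V" "g \<in> Pol U V"
  shows "pd t v (f - g) = pd t v f - pd t v g"
  using pd_add[OF assms(1-3) Pol_uminus[OF assms(4)], of v]
    pd_Const_mult[OF assms(1,2,4), of v "-1"] by (simp add: Const_uminus)

lemma pd_sum:
  assumes "t \<in> pts V" "U \<inter> V = {}" "\<And>i. i \<in> S \<Longrightarrow> f i \<in> Pol U V"
  shows "pd t v (sum f S) = (\<Sum>i\<in>S. pd t v (f i))"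
  using assms(3)
proof (induction S rule: infinite_finite_induct)
  case (insert i S)
  then show ?case
    using pd_add[OF assms(1,2), of "f i" "sum f S" v] by (auto intro: Pol_sum)
qed (use pd_Const[of t v 0] in auto)

lemma pd_pt_ideal_sq:
  assumes t: "t \<in> pts V" and disj: "U \<inter> V = {}" and f: "f \<in> pt_ideal_sq U V t"
  shows "f \<in> Pol U V \<and> poly_eval t f = 0 \<and> (\<forall>v. pd t v f = 0)"
  using f unfolding pt_ideal_sq_def
proof (induction f rule: ideal_prod.induct)
  case (prod f g)
  then have fg: "f \<in> Pol U V" "g \<in> Pol U V" "poly_eval t f = 0" "poly_eval t g = 0"
    by (auto simp: van_ideal_def)
  then show ?case using pd_mult[OF t disj fg(1,2)] poly_eval_mult[OF t fg(1,2)] by simp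
next
  case (sum f g)
  then show ?case using pd_add[OF t disj] by simp
qed

subsection \<open>Presentations of algebras with one relation\<close>

text \<open>The algebra \<open>A\<close> is the polynomial ring modulo \<open>F\<close>, but by way
  of an explicit map \<open>h\<close>, so that its elements keep their own representation: invariant
  functions for the quotient, cosets for a fibre.\<close>

locale hypersurface =
  fixes U V :: "var set" and F :: lpoly and A :: "('a, 'm) ring_scheme"
    and k :: "complex \<Rightarrow> 'a" and h :: "lpoly \<Rightarrow> 'a"
  assumes disj: "U \<inter> V = {}"
    and A_cring: "cring A"
    and F_Pol: "F \<in> Pol U V"
    and F_nonzero: "F \<noteq> 0"
    and h_hom: "h \<in> ring_hom (poly_ring U V) A"
    and h_surj: "h ` Pol U V = carrier A"
    and h_ker: "\<And>p. p \<in> Pol U V \<Longrightarrow> h p = \<zero>\<^bsub>A\<^esub> \<longleftrightarrow> (\<exists>g\<in>Pol U V. p = F * g)"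
    and h_Const: "\<And>c. h (Const c) = k c"
begin

interpretation A: cring A by (rule A_cring)

definition zeros :: "(var \<Rightarrow> complex) set" where
  "zeros = {t \<in> pts V. poly_eval t F = 0}"

text \<open>Evaluation at t, transported to \<open>A\<close> by an arbitrary preimage under
  \<open>h\<close>. For t in \<open>zeros\<close> the choice is immaterial, as two preimages differ
  by a multiple of \<open>F\<close>.\<close>

definition point :: "(var \<Rightarrow> complex) \<Rightarrow> 'a \<Rightarrow> complex" where
  "point t = (\<lambda>a\<in>carrier A. poly_eval t (SOME p. p \<in> Pol U V \<and> h p = a))"

lemma zeros_pts: "t \<in> zeros \<Longrightarrow> t \<in> pts V"
  by (simp add: zeros_def)

lemma h_closed [intro, simp]: "p \<in> Pol U V \<Longrightarrow> h p \<in> carrier A"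
  unfolding h_surj[symmetric] by (rule imageI)

lemma h_add: "p \<in> Pol U V \<Longrightarrow> q \<in> Pol U V \<Longrightarrow> h (p + q) = h p \<oplus>\<^bsub>A\<^esub> h q"
  using ring_hom_add[OF h_hom] by simp

lemma h_mult: "p \<in> Pol U V \<Longrightarrow> q \<in> Pol U V \<Longrightarrow> h (p * q) = h p \<otimes>\<^bsub>A\<^esub> h q"
  using ring_hom_mult[OF h_hom] by simp

lemma h_1: "h 1 = \<one>\<^bsub>A\<^esub>"
  using ring_hom_one[OF h_hom] by simp

lemma h_0: "h 0 = \<zero>\<^bsub>A\<^esub>"
  using h_ker[of 0] by (auto intro: bexI[of _ 0])

lemma h_diff: "p \<in> Pol U V \<Longrightarrow> q \<in> Pol U V \<Longrightarrow> h (p - q) = h p \<ominus>\<^bsub>A\<^esub> h q"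
proof -
  assume pq: "p \<in> Pol U V" "q \<in> Pol U V"
  then have "h p = h (p - q) \<oplus>\<^bsub>A\<^esub> h q" using h_add[of "p - q" q] by simp
  then show ?thesis using pq
    by (simp add: A.minus_eq A.a_assoc A.r_neg)
qed

lemma h_eq_iff:
  assumes "p \<in> Pol U V" "q \<in> Pol U V"
  shows "h p = h q \<longleftrightarrow> (\<exists>g\<in>Pol U V. p - q = F * g)"
proof -
  have "h p = h q \<longleftrightarrow> h (p - q) = \<zero>\<^bsub>A\<^esub>" using assms A.add.inv_solve_right'[of "\<zero>\<^bsub>A\<^esub>" "h p" "h q"]
    by (auto simp: h_diff A.r_neg A.minus_eq)
  also have "\<dots> \<longleftrightarrow> (\<exists>g\<in>Pol U V. p - q = F * g)" using assms by (intro h_ker) auto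
  finally show ?thesis .
qed

lemma h_cases:
  assumes "a \<in> carrier A" obtains p where "p \<in> Pol U V" "h p = a"
proof -
  have "a \<in> h ` Pol U V" using assms by (simp only: h_surj)
  then show ?thesis using that by (elim imageE) simp
qed

lemma k_closed [intro, simp]: "k c \<in> carrier A"
  using h_closed[of "Const c"] by (simp add: h_Const)

lemma point_h:
  assumes t: "t \<in> zeros" and p: "p \<in> Pol U V"
  shows "point t (h p) = poly_eval t p"
proof -
  define q where "q = (SOME q. q \<in> Pol U V \<and> h q = h p)"
  have q: "q \<in> Pol U V" "h q = h p"
    using someI[of "\<lambda>q. q \<in> Pol U V \<and> h q = h p" p] p by (auto simp: q_def)
  then obtain g where g: "g \<in> Pol U V" "q - p = F * g" using p h_eq_iff by blast
  have "poly_eval t (q - p) = 0"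
    unfolding g(2) using t g F_Pol by (subst poly_eval_mult[of _ V _ U]) (auto simp: zeros_def)
  then show ?thesis using p by (simp add: point_def q_def)
qed

lemma point_mem: "t \<in> zeros \<Longrightarrow> point t \<in> alg_points A k"
proof -
  assume t: "t \<in> zeros"
  have "point t \<in> ring_hom A (type_ring UNIV)"
  proof (rule ring_hom_memI)
    fix a b assume ab: "a \<in> carrier A" "b \<in> carrier A"
    then obtain p q where pq: "p \<in> Pol U V" "q \<in> Pol U V" "a = h p" "b = h q" by (metis h_cases)
    have "point t (h (p * q)) = point t (h p) * point t (h q)"
      using pq t by (simp add: point_h poly_eval_mult[of _ V _ U] zeros_pts del: poly_eval_mult)
    then show "point t (a \<otimes>\<^bsub>A\<^esub> b) = point t a \<otimes>\<^bsub>type_ring UNIV\<^esub> point t b"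
      using pq by (simp add: h_mult)
    have "point t (h (p + q)) = point t (h p) + point t (h q)"
      using pq t by (simp add: point_h)
    then show "point t (a \<oplus>\<^bsub>A\<^esub> b) = point t a \<oplus>\<^bsub>type_ring UNIV\<^esub> point t b"
      using pq by (simp add: h_add)
  next
    show "point t \<one>\<^bsub>A\<^esub> = \<one>\<^bsub>type_ring UNIV\<^esub>"
      using point_h[OF t, of 1] by (simp add: h_1)
  qed auto
  moreover have "point t (k c) = c" for c
    using point_h[OF t, of "Const c"] by (simp add: h_Const)
  ultimately show ?thesis by (auto simp: alg_points_def point_def)
qed

lemma alg_points_eqI:
  assumes "\<xi> \<in> alg_points A k" "\<xi>' \<in> alg_points A k" "\<And>v. v \<in> U \<union> V \<Longrightarrow> \<xi> (h (Var v)) = \<xi>' (h (Var v))"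
  shows "\<xi> = \<xi>'"
proof -
  have hom: "\<zeta> (h (p + q)) = \<zeta> (h p) + \<zeta> (h q)" "\<zeta> (h (p * q)) = \<zeta> (h p) * \<zeta> (h q)" "\<zeta> (h 1) = 1"
    if "\<zeta> \<in> alg_points A k" "p \<in> Pol U V" "q \<in> Pol U V" for \<zeta> p q
    using that ring_hom_add[of \<zeta> A "type_ring UNIV" "h p" "h q"]
      ring_hom_mult[of \<zeta> A "type_ring UNIV" "h p" "h q"] ring_hom_one[of \<zeta> A "type_ring UNIV"]
    by (auto simp: alg_points_def h_add h_mult h_1)
  have homC: "\<xi> (h (Const c)) = c" "\<xi>' (h (Const c)) = c" for c
    using assms by (auto simp: alg_points_def h_Const)
  have "\<xi> (h p) = \<xi>' (h p)" if "p \<in> Pol U V" for p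
    using that
  proof (induction p rule: Pol_induct)
    case (inv v)
    have vi: "Var_inv v \<in> Pol U V" "Var v \<in> Pol U V" using inv disj by auto
    have 1: "\<zeta> (h (Var_inv v)) * \<zeta> (h (Var v)) = 1" if "\<zeta> \<in> alg_points A k" for \<zeta>
      using hom(2)[OF that vi] hom(3)[OF that vi] by simp
    show ?case using 1[OF assms(1)] 1[OF assms(2)] assms(3)[of v] inv
      by (metis UnI2 mult.commute mult.left_commute mult.right_neutral)
  qed (use assms(3) in \<open>auto simp: homC hom[OF assms(1)] hom[OF assms(2)]\<close>)
  then have "\<xi> a = \<xi>' a" if "a \<in> carrier A" for a using that by (metis h_cases)
  moreover have "\<xi> \<in> extensional (carrier A)" "\<xi>' \<in> extensional (carrier A)"
    using assms by (auto simp: alg_points_def)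
  ultimately show ?thesis by (metis extensionalityI)
qed

text \<open>A homomorphism is evaluation at the images of the variables. Points carry all six
  coordinates, and d prescribes those outside \<open>U \<union> V\<close>; for a fibre these are set
  to the parameters.\<close>

lemma alg_points_cases:
  assumes \<xi>: "\<xi> \<in> alg_points A k"
  obtains t where "t \<in> zeros" "\<xi> = point t" "\<And>v. v \<notin> U \<union> V \<Longrightarrow> t v = d v"
proof -
  define t where "t v = (if v \<in> U \<union> V then \<xi> (h (Var v)) else d v)" for v
  have hom: "\<xi> (h (p + q)) = \<xi> (h p) + \<xi> (h q)" "\<xi> (h (p * q)) = \<xi> (h p) * \<xi> (h q)" "\<xi> (h 1) = 1"
    if "p \<in> Pol U V" "q \<in> Pol U V" for p q
    using \<xi> that ring_hom_add[of \<xi> A "type_ring UNIV" "h p" "h q"]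
      ring_hom_mult[of \<xi> A "type_ring UNIV" "h p" "h q"] ring_hom_one[of \<xi> A "type_ring UNIV"]
    by (auto simp: alg_points_def h_add h_mult h_1)
  have homC: "\<xi> (h (Const c)) = c" for c
    using \<xi> by (auto simp: alg_points_def h_Const)
  have inv1: "\<xi> (h (Var_inv v)) * t v = 1" if "v \<in> V" for v
    using hom(2)[of "Var_inv v" "Var v"] hom(3)[OF Pol_1 Pol_1] that disj by (simp add: t_def)
  have t: "t \<in> pts V" using inv1 by (force simp: pts_def)
  have ev: "\<xi> (h p) = poly_eval t p" if "p \<in> Pol U V" for p
    using that
  proof (induction p rule: Pol_induct)
    case (inv v)
    then show ?case using inv1[of v] inverse_unique[of "t v" "\<xi> (h (Var_inv v))"] by (simp add: mult.commute)
  next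
    case (var v)
    then show ?case by (simp add: t_def)
  qed (simp_all add: hom homC poly_eval_mult[OF t])
  have "h F = h 0" using h_ker[of F] F_Pol by (auto simp: h_0 intro: bexI[of _ 1])
  then have "poly_eval t F = 0" using ev[of F] ev[of 0] F_Pol by simp
  then have tz: "t \<in> zeros" using t by (simp add: zeros_def)
  have "\<xi> = point t"
    using \<xi> point_mem[OF tz] by (rule alg_points_eqI) (use tz in \<open>auto simp: point_h ev\<close>)
  then show ?thesis using that tz by (simp add: t_def)
qed

subsection \<open>Height\<close>

text \<open>The preimages of the primes in the polynomial ring contain \<open>F\<close>, so that the zero ideal can be
  added at the bottom of the chain.\<close>

lemma chain_length_bound:
  assumes pr: "\<And>i. i \<le> n \<Longrightarrow> primeideal (p i) A" and inc: "\<And>i. i < n \<Longrightarrow> p i \<subset> p (Suc i)"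
  shows "n < card (U \<union> V)"
proof (rule ccontr)
  assume "\<not> n < card (U \<union> V)"
  then have N: "card (U \<union> V) < Suc n" by simp
  define Q where "Q i = {f \<in> Pol U V. h f \<in> p i}" for i
  define P where "P i = (case i of 0 \<Rightarrow> {0} | Suc j \<Rightarrow> Q j)" for i
  interpret L: cring "poly_ring U V" by (rule poly_ring_cring)
  have Q: "primeideal (Q i) (poly_ring U V)" if "i \<le> n" for i
  proof -
    interpret pi: primeideal "p i" A using pr that by simp
    have hr: "ring_hom_ring (poly_ring U V) A h"
      by (intro ring_hom_ringI2 L.ring_axioms A.ring_axioms h_hom)
    show ?thesis
    proof (rule primeidealI)
      show "ideal (Q i) (poly_ring U V)"
        using ring_hom_ring.ideal_vimage[OF hr pi.ideal_axioms] by (simp add: Q_def)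
      show "carrier (poly_ring U V) \<noteq> Q i"
      proof
        assume "carrier (poly_ring U V) = Q i"
        then have "1 \<in> Q i" by (metis Pol_1)
        then show False using pi.I_notcarr pi.one_imp_carrier by (simp add: Q_def h_1)
      qed
    qed (use pi.I_prime L.cring_axioms in \<open>auto simp: Q_def h_mult\<close>)
  qed
  have P0: "primeideal {0} (poly_ring U V)"
  proof (rule primeidealI)
    show "ideal {0} (poly_ring U V)" using L.zeroideal by simp
    show "carrier (poly_ring U V) \<noteq> {0}" using Pol_1[of U V] by force
  qed (use L.cring_axioms in auto)
  have P: "primeideal (P i) (poly_ring U V)" if "i \<le> Suc n" for i
    using that P0 Q by (auto simp: P_def split: nat.split)
  have FQ: "F \<in> Q 0"
  proof -
    interpret p0: primeideal "p 0" A using pr by simp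
    have "h F = \<zero>\<^bsub>A\<^esub>" using h_ker[of F] F_Pol by (auto intro: bexI[of _ 1])
    then show ?thesis using F_Pol p0.zero_closed by (simp add: Q_def)
  qed
  have ex: "\<exists>y. y \<in> Q (Suc i) - Q i" and sub: "Q i \<subseteq> Q (Suc i)" if i: "i < n" for i
  proof -
    obtain a where a: "a \<in> p (Suc i)" "a \<notin> p i" using inc[OF i] by blast
    interpret pi: primeideal "p (Suc i)" A using pr i by simp
    from a obtain f where "f \<in> Pol U V" "h f = a" using pi.Icarr h_cases by metis
    with a show "\<exists>y. y \<in> Q (Suc i) - Q i" by (auto simp: Q_def)
    show "Q i \<subseteq> Q (Suc i)" using inc[OF i] by (auto simp: Q_def)
  qed
  then obtain y where y: "\<And>i. i < n \<Longrightarrow> y i \<in> Q (Suc i) - Q i" by metis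
  \<comment> \<open>\<open>F\<close> shows that \<open>{0}\<close> is strictly below
    \<open>Q 0\<close>. The list has one element for each of the n + 1 inclusions, and thus more
    elements than there are variables.\<close>
  define ys where "ys = F # map y [0..<n]"
  have len: "length ys = Suc n" by (simp add: ys_def)
  have ysP: "P i \<subseteq> P (Suc i) \<and> ys ! i \<in> P (Suc i) - P i" if i: "i < Suc n" for i
  proof (cases i)
    case 0
    have "0 \<in> Q 0"
      using Q[of 0] additive_subgroup.zero_closed ideal.axioms(1) primeideal.axioms(1) by fastforce
    with 0 show ?thesis using FQ F_nonzero by (simp add: P_def ys_def)
  next
    case (Suc j)
    then show ?thesis using i y[of j] sub[of j] by (simp add: P_def ys_def)
  qed
  have "set ys \<subseteq> Pol U V" using y F_Pol by (auto simp: ys_def Q_def)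
  then obtain S c where S: "finite S" "S \<noteq> {}" "\<forall>e\<in>S. length e = length ys \<and> c e \<noteq> 0"
    "(\<Sum>e\<in>S. Const (c e) * list_mono ys e) = 0"
    using algebraically_dependent[of ys U V] N len by auto
  show False
    by (rule primeideal_chain_independent[OF len P ysP S(1,2), where c = c]) (use S len in \<open>auto simp: P_def\<close>)
qed

text \<open>For \<open>Z\<close> inside \<open>pts V\<close> this says that the vanishing ideal of
  \<open>Z\<close> is prime. The form with values can be checked on a parametrization of
  \<open>Z\<close>.\<close>

definition irred :: "(var \<Rightarrow> complex) set \<Rightarrow> bool" where
  "irred Z \<longleftrightarrow> Z \<noteq> {} \<and> (\<forall>f\<in>Pol U V. \<forall>g\<in>Pol U V.
     (\<forall>t\<in>Z. poly_eval t f * poly_eval t g = 0) \<longrightarrow>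
       (\<forall>t\<in>Z. poly_eval t f = 0) \<or> (\<forall>t\<in>Z. poly_eval t g = 0))"

lemma irred_singleton: "irred {t}"
  by (auto simp: irred_def)

text \<open>The bound on chains gives one inequality and an explicit chain the other. Vanishing
  ideals of subsets of the hypersurface contain the kernel of \<open>h\<close>, so their images in
  \<open>A\<close> are still prime and still distinct.\<close>

lemma ideal_height_eq:
  assumes t: "t \<in> zeros" and n: "Suc n = card (U \<union> V)"
    and Z: "\<And>i. i \<le> n \<Longrightarrow> Z i \<subseteq> zeros" "\<And>i. i \<le> n \<Longrightarrow> irred (Z i)"
    and last: "Z n = {t}"
    and inc: "\<And>i. i < n \<Longrightarrow> van_ideal U V (Z i) \<subset> van_ideal U V (Z (Suc i))"
  shows "ideal_height A (point_ideal A (point t)) = enat n"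
proof -
  define p where "p i = h ` van_ideal U V (Z i)" for i
  have memp: "h f \<in> p i \<longleftrightarrow> f \<in> van_ideal U V (Z i)" if "f \<in> Pol U V" "i \<le> n" for f i
  proof
    assume "h f \<in> p i"
    then obtain g where g: "g \<in> van_ideal U V (Z i)" "h f = h g" by (auto simp: p_def)
    have "poly_eval s f = 0" if s: "s \<in> Z i" for s
    proof -
      have sz: "s \<in> zeros" using Z s \<open>i \<le> n\<close> by blast
      have "poly_eval s f = point s (h f)" using \<open>f \<in> Pol U V\<close> sz by (simp add: point_h)
      also have "\<dots> = poly_eval s g" unfolding g(2) using g sz by (simp add: point_h van_ideal_def)
      finally show ?thesis using g s by (simp add: van_ideal_def)
    qed
    then show "f \<in> van_ideal U V (Z i)" using that by (simp add: van_ideal_def)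
  qed (simp add: p_def)
  have pc: "p i \<subseteq> carrier A" for i by (auto simp: p_def van_ideal_def)
  have prime: "primeideal (p i) A" if i: "i \<le> n" for i
  proof -
    have I: "ideal (van_ideal U V (Z i)) (poly_ring U V)"
      using Z(1)[OF i] by (intro van_ideal_ideal) (auto simp: zeros_def)
    have sg: "subgroup (p i) (add_monoid A)"
    proof (rule A.add.subgroupI)
      have "0 \<in> van_ideal U V (Z i)" by (simp add: van_ideal_def)
      then show "p i \<noteq> {}" unfolding p_def by blast
      show "p i \<subseteq> carrier A" by (rule pc)
      show "\<ominus>\<^bsub>A\<^esub> a \<in> p i" if "a \<in> p i" for a
      proof -
        obtain f where f: "f \<in> van_ideal U V (Z i)" "a = h f" using \<open>a \<in> p i\<close> unfolding p_def by blast
        then have fP: "f \<in> Pol U V" by (simp add: van_ideal_def)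
        have "h (0 - f) = \<ominus>\<^bsub>A\<^esub> a" using fP f by (subst h_diff) (auto simp: h_0 A.minus_eq)
        moreover have "0 - f \<in> van_ideal U V (Z i)" using f by (simp add: van_ideal_def)
        ultimately show ?thesis unfolding p_def by (metis image_eqI)
      qed
      show "a \<oplus>\<^bsub>A\<^esub> b \<in> p i" if "a \<in> p i" "b \<in> p i" for a b
      proof -
        obtain f g where f: "f \<in> van_ideal U V (Z i)" "a = h f" "g \<in> van_ideal U V (Z i)" "b = h g"
          using \<open>a \<in> p i\<close> \<open>b \<in> p i\<close> unfolding p_def by blast
        then have "h (f + g) = a \<oplus>\<^bsub>A\<^esub> b" by (simp add: h_add van_ideal_def)
        moreover have "f + g \<in> van_ideal U V (Z i)" using f by (simp add: van_ideal_def)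
        ultimately show ?thesis unfolding p_def by (metis image_eqI)
      qed
    qed
    have lm: "x \<otimes>\<^bsub>A\<^esub> a \<in> p i" if ax: "a \<in> p i" "x \<in> carrier A" for a x
    proof -
      obtain f g where f: "f \<in> van_ideal U V (Z i)" "a = h f" "g \<in> Pol U V" "x = h g"
        using ax h_cases by (metis imageE p_def)
      then have "h (g * f) = x \<otimes>\<^bsub>A\<^esub> a" by (simp add: h_mult van_ideal_def)
      moreover have "g * f \<in> van_ideal U V (Z i)" using ideal.I_l_closed[OF I, of f g] f by simp
      ultimately show ?thesis unfolding p_def by (metis image_eqI)
    qed
    show ?thesis
    proof (rule primeidealI)
      show "ideal (p i) A"
      proof (rule idealI)
        show "a \<otimes>\<^bsub>A\<^esub> x \<in> p i" if "a \<in> p i" "x \<in> carrier A" for a x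
          using lm[OF that] pc that A.m_comm[of a x] by (metis subsetD)
      qed (use sg lm A.ring_axioms in auto)
      show "carrier A \<noteq> p i"
      proof
        assume "carrier A = p i"
        then have "h 1 \<in> p i" by (metis h_closed Pol_1)
        then have "1 \<in> van_ideal U V (Z i)" using memp[of 1 i] i by simp
        then show False using Z(2)[OF i] by (auto simp: van_ideal_def irred_def)
      qed
      fix a b assume ab: "a \<in> carrier A" "b \<in> carrier A" "a \<otimes>\<^bsub>A\<^esub> b \<in> p i"
      then obtain f g where fg: "f \<in> Pol U V" "a = h f" "g \<in> Pol U V" "b = h g"
        using h_cases by metis
      then have "f * g \<in> van_ideal U V (Z i)" using ab memp[of "f * g" i] i by (simp add: h_mult)
      have "poly_eval s f * poly_eval s g = 0" if s: "s \<in> Z i" for s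
      proof -
        have "s \<in> pts V" using s Z(1)[OF i] zeros_pts by blast
        then show ?thesis
          using \<open>f * g \<in> van_ideal U V (Z i)\<close> s poly_eval_mult[of s V f U g] fg
          unfolding van_ideal_def by force
      qed
      then have "f \<in> van_ideal U V (Z i) \<or> g \<in> van_ideal U V (Z i)"
        using Z(2)[OF i] fg by (auto simp: irred_def van_ideal_def)
      then show "a \<in> p i \<or> b \<in> p i" using fg by (auto simp: p_def)
    qed (rule A.cring_axioms)
  qed
  have strict: "p i \<subset> p (Suc i)" if i: "i < n" for i
  proof -
    obtain f where f: "f \<in> van_ideal U V (Z (Suc i))" "f \<notin> van_ideal U V (Z i)"
      using inc[OF i] by blast
    then have "h f \<in> p (Suc i)" "h f \<notin> p i"
      using memp[of f i] memp[of f "Suc i"] i by (auto simp: van_ideal_def)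
    moreover have "p i \<subseteq> p (Suc i)" using inc[OF i] by (auto simp: p_def)
    ultimately show ?thesis by blast
  qed
  have pn: "p n = point_ideal A (point t)"
  proof (rule Set.set_eqI)
    fix a show "a \<in> p n \<longleftrightarrow> a \<in> point_ideal A (point t)"
    proof (cases "a \<in> carrier A")
      case True
      then obtain f where f: "f \<in> Pol U V" "h f = a" using h_cases by metis
      then show ?thesis using memp[of f n] t by (auto simp: last point_ideal_def point_h van_ideal_def)
    next
      case False
      then show ?thesis using pc by (auto simp: point_ideal_def)
    qed
  qed
  show ?thesis
    unfolding ideal_height_def
  proof (rule antisym)
    show "Sup {enat m |m. \<exists>q. (\<forall>i\<le>m. primeideal (q i) A) \<and> (\<forall>i<m. q i \<subset> q (Suc i)) \<and>
        q m = point_ideal A (point t)} \<le> enat n"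
    proof (rule Sup_least)
      fix x assume "x \<in> {enat m |m. \<exists>q. (\<forall>i\<le>m. primeideal (q i) A) \<and> (\<forall>i<m. q i \<subset> q (Suc i)) \<and>
        q m = point_ideal A (point t)}"
      then obtain m q where "x = enat m" "\<forall>i\<le>m. primeideal (q i) A" "\<forall>i<m. q i \<subset> q (Suc i)" by blast
      then show "x \<le> enat n" using chain_length_bound[of m q] n by simp
    qed
    show "enat n \<le> Sup {enat m |m. \<exists>q. (\<forall>i\<le>m. primeideal (q i) A) \<and> (\<forall>i<m. q i \<subset> q (Suc i)) \<and>
        q m = point_ideal A (point t)}"
      by (rule Sup_upper) (use prime strict pn in blast)
  qed
qed

subsection \<open>Cotangent spaces\<close>

text \<open>The cotangent space of \<open>A\<close> is that of the polynomial ring modulo the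
  differential of \<open>F\<close>. In one direction f differs from an element of the square by
  \<open>F * w\<close>, and since \<open>F\<close> vanishes at t, the factor \<mu> is the value of
  w. In the other, f minus \<mu> times \<open>F\<close> has zero differential, and Taylor's formula
  puts it into the square.\<close>

lemma h_cotangent_iff:
  assumes t: "t \<in> zeros" and f: "f \<in> Pol U V" "poly_eval t f = 0"
  shows "h f \<in> ideal_prod A (point_ideal A (point t)) (point_ideal A (point t)) \<longleftrightarrow>
    (\<exists>\<mu>. \<forall>v\<in>U \<union> V. pd t v f = \<mu> * pd t v F)"
proof -
  let ?M = "ideal_prod A (point_ideal A (point t)) (point_ideal A (point t))"
  have tp: "t \<in> pts V" using t by (rule zeros_pts)
  have F0: "poly_eval t F = 0" using t by (simp add: zeros_def)
  have mh: "h g \<in> point_ideal A (point t)" if "g \<in> pt_ideal U V t" for g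
    using that t by (auto simp: point_ideal_def point_h van_ideal_def)
  have sqP: "g \<in> Pol U V" if "g \<in> pt_ideal_sq U V t" for g
    using pd_pt_ideal_sq[OF tp disj that] by simp
  have up: "h g \<in> ?M" if "g \<in> pt_ideal_sq U V t" for g
  proof -
    have "g \<in> Pol U V \<and> h g \<in> ?M"
      using that unfolding pt_ideal_sq_def
    proof (induction g rule: ideal_prod.induct)
      case (prod f g)
      then show ?case using ideal_prod.prod[OF mh mh, of f g A]
        by (auto simp: van_ideal_def h_mult)
    next
      case (sum f g)
      then show ?case using ideal_prod.sum[of "h f" A _ _ "h g"] by (simp add: h_add)
    qed
    then show ?thesis by simp
  qed
  have down: "\<exists>g\<in>pt_ideal_sq U V t. h g = a" if "a \<in> ?M" for a
    using that
  proof (induction a rule: ideal_prod.induct)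
    case (prod a b)
    then have "a \<in> carrier A" "b \<in> carrier A" by (auto simp: point_ideal_def)
    then obtain f g where fg: "f \<in> Pol U V" "h f = a" "g \<in> Pol U V" "h g = b" by (metis h_cases)
    then have "f \<in> pt_ideal U V t" "g \<in> pt_ideal U V t"
      using prod t by (auto simp: van_ideal_def point_ideal_def point_h)
    then have "f * g \<in> pt_ideal_sq U V t"
      using ideal_prod.prod[of f _ g _ "poly_ring U V"] by (simp add: pt_ideal_sq_def)
    then show ?case using fg by (intro bexI[of _ "f * g"]) (auto simp: h_mult)
  next
    case (sum a b)
    then obtain f g where fg: "f \<in> pt_ideal_sq U V t" "h f = a" "g \<in> pt_ideal_sq U V t" "h g = b" by metis
    then have "f + g \<in> pt_ideal_sq U V t"
      using ideal_prod.sum[of f "poly_ring U V" _ _ g] by (simp add: pt_ideal_sq_def)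
    then show ?case using fg sqP by (intro bexI[of _ "f + g"]) (auto simp: h_add)
  qed
  show ?thesis
  proof
    assume "h f \<in> ?M"
    then obtain g where g: "g \<in> pt_ideal_sq U V t" "h f = h g" using down by metis
    then obtain w where w: "w \<in> Pol U V" "f - g = F * w" using h_eq_iff f sqP by metis
    have "pd t v f = poly_eval t w * pd t v F" for v
    proof -
      have "pd t v f - pd t v g = pd t v F * poly_eval t w + pd t v w * poly_eval t F"
        using pd_diff[OF tp disj f(1) sqP[OF g(1)], of v] pd_mult[OF tp disj F_Pol w(1), of v] w by simp
      then show ?thesis using pd_pt_ideal_sq[OF tp disj g(1)] F0 by simp
    qed
    then show "\<exists>\<mu>. \<forall>v\<in>U \<union> V. pd t v f = \<mu> * pd t v F" by blast
  next
    assume "\<exists>\<mu>. \<forall>v\<in>U \<union> V. pd t v f = \<mu> * pd t v F"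
    then obtain l where l: "\<And>v. v \<in> U \<union> V \<Longrightarrow> pd t v f = l * pd t v F" by blast
    define e where "e = f - Const l * F"
    have eP: "e \<in> Pol U V" using f F_Pol by (simp add: e_def)
    have "pd t v e = 0" if "v \<in> U \<union> V" for v
      unfolding e_def using l[OF that] f F_Pol
      by (simp add: pd_diff[OF tp disj] pd_Const_mult[OF tp disj])
    moreover have "poly_eval t e = 0"
      using f F0 F_Pol tp by (simp add: e_def poly_eval_mult[OF tp Pol_Const F_Pol])
    ultimately have "e \<in> pt_ideal_sq U V t" using taylor_pd[OF tp disj eP] by simp
    then have "h e \<in> ?M" by (rule up)
    moreover have "h e = h f"
    proof -
      have "e - f = F * Const (- l)" by (simp add: e_def Const_uminus)
      then show ?thesis using h_eq_iff[OF eP f(1)] by blast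
    qed
    ultimately show "h f \<in> ?M" by simp
  qed
qed

lemma h_sum:
  assumes "\<And>i. i < (n::nat) \<Longrightarrow> g i \<in> Pol U V"
  shows "h (\<Sum>i<n. Const (c i) * g i) = (\<Oplus>\<^bsub>A\<^esub>i\<in>{..<n}. k (c i) \<otimes>\<^bsub>A\<^esub> h (g i))"
  using assms
proof (induction n)
  case 0
  then show ?case by (simp add: h_0)
next
  case (Suc n)
  then have 1: "(\<Sum>i<n. Const (c i) * g i) \<in> Pol U V" by (auto intro!: Pol_sum)
  have "h (\<Sum>i<Suc n. Const (c i) * g i) = h (Const (c n) * g n) \<oplus>\<^bsub>A\<^esub> h (\<Sum>i<n. Const (c i) * g i)"
    using 1 Suc.prems by (simp add: h_add add.commute)
  also have "\<dots> = (\<Oplus>\<^bsub>A\<^esub>i\<in>insert n {..<n}. k (c i) \<otimes>\<^bsub>A\<^esub> h (g i))"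
    using Suc by (subst A.finsum_insert) (auto simp: h_mult h_Const)
  finally show ?case by (simp add: lessThan_Suc)
qed

text \<open>The cotangent space is dual to the kernel of the gradient of \<open>F\<close>: the coordinates other than one
  with nonvanishing derivative form a basis, and if the gradient vanishes, fewer elements than there
  are variables do not suffice.\<close>

lemma cotangent_basis_exists:
  assumes t: "t \<in> zeros" and w: "w \<in> U \<union> V" "pd t w F \<noteq> 0" and n: "Suc n = card (U \<union> V)"
  shows "\<exists>b. cotangent_basis A k (point t) n b"
proof -
  have tp: "t \<in> pts V" using t by (rule zeros_pts)
  have "card (U \<union> V - {w}) = n" using n w by simp
  then obtain e where e: "bij_betw e {..<n} (U \<union> V - {w})"
    using ex_bij_betw_nat_finite[of "U \<union> V - {w}"] by (auto simp: atLeast0LessThan)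
  define \<beta> where "\<beta> i = Var (e i) - Const (t (e i))" for i
  have \<beta>: "\<beta> i \<in> Pol U V" "poly_eval t (\<beta> i) = 0" if "i < n" for i
    using that bij_betwE[OF e] by (auto simp: \<beta>_def)
  have "cotangent_basis A k (point t) n (\<lambda>i. h (\<beta> i))"
    unfolding cotangent_basis_def
  proof (intro conjI allI impI ballI)
    show "h (\<beta> i) \<in> point_ideal A (point t)" if "i < n" for i
      using \<beta>[OF that] t by (simp add: point_ideal_def point_h)
    fix a assume "a \<in> point_ideal A (point t)"
    then obtain f where f: "f \<in> Pol U V" "h f = a" and f0: "poly_eval t f = 0"
      using t by (auto simp: point_ideal_def point_h elim: h_cases)
    \<comment> \<open>The derivative in the direction w fixes the multiple of the differential of
      \<open>F\<close>; the remaining derivatives then determine the coefficients.\<close>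
    define l where "l = pd t w f / pd t w F"
    have crit: "a \<ominus>\<^bsub>A\<^esub> (\<Oplus>\<^bsub>A\<^esub>i\<in>{..<n}. k (c i) \<otimes>\<^bsub>A\<^esub> h (\<beta> i))
        \<in> ideal_prod A (point_ideal A (point t)) (point_ideal A (point t)) \<longleftrightarrow>
        (\<forall>i<n. c i = pd t (e i) f - l * pd t (e i) F)" for c
    proof -
      define s where "s = (\<Sum>i<n. Const (c i) * \<beta> i)"
      have s: "s \<in> Pol U V" "poly_eval t s = 0"
        using \<beta> by (auto simp: s_def poly_eval_sum poly_eval_mult[OF tp Pol_Const[of _ U V]] intro!: Pol_sum)
      have pds: "pd t v s = (\<Sum>i<n. c i * (if v = e i then 1 else 0))" for v
      proof -
        have "pd t v s = (\<Sum>i<n. pd t v (Const (c i) * \<beta> i))"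
          unfolding s_def using \<beta> by (intro pd_sum[OF tp disj]) auto
        also have "\<dots> = (\<Sum>i<n. c i * (if v = e i then 1 else 0))"
        proof (intro sum.cong refl)
          fix i assume "i \<in> {..<n}"
          then have i: "i < n" by simp
          then have ei: "Var (e i) \<in> Pol U V" using bij_betwE[OF e] by auto
          show "pd t v (Const (c i) * \<beta> i) = c i * (if v = e i then 1 else 0)"
            using pd_Const_mult[OF tp disj \<beta>(1)[OF i]] pd_diff[OF tp disj ei Pol_Const]
            by (simp add: \<beta>_def pd_Var pd_Const)
        qed
        finally show ?thesis .
      qed
      have pdsw: "pd t w s = 0"
        unfolding pds using bij_betwE[OF e] by (intro sum.neutral) auto
      have pdse: "pd t (e i) s = c i" if i: "i < n" for i
      proof -
        have "(\<Sum>j<n. c j * (if e i = e j then 1 else 0)) = (\<Sum>j<n. if j = i then c j else 0)"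
          using i e by (intro sum.cong) (auto simp: bij_betw_def inj_on_def)
        then show ?thesis using i by (simp add: pds)
      qed
      have "a \<ominus>\<^bsub>A\<^esub> (\<Oplus>\<^bsub>A\<^esub>i\<in>{..<n}. k (c i) \<otimes>\<^bsub>A\<^esub> h (\<beta> i)) = h (f - s)"
        using f s \<beta> by (simp add: h_diff h_sum s_def)
      then have "a \<ominus>\<^bsub>A\<^esub> (\<Oplus>\<^bsub>A\<^esub>i\<in>{..<n}. k (c i) \<otimes>\<^bsub>A\<^esub> h (\<beta> i))
        \<in> ideal_prod A (point_ideal A (point t)) (point_ideal A (point t)) \<longleftrightarrow>
        (\<exists>\<mu>. \<forall>v\<in>U \<union> V. pd t v (f - s) = \<mu> * pd t v F)"
        using f s f0 by (simp add: h_cotangent_iff[OF t])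
      also have "\<dots> \<longleftrightarrow> (\<exists>\<mu>. \<forall>v\<in>insert w (e ` {..<n}). pd t v f - pd t v s = \<mu> * pd t v F)"
      proof -
        have "U \<union> V = insert w (e ` {..<n})" using e w by (auto simp: bij_betw_def)
        then show ?thesis using f s by (simp add: pd_diff[OF tp disj])
      qed
      also have "\<dots> \<longleftrightarrow> (\<exists>\<mu>. \<mu> = l \<and> (\<forall>i<n. pd t (e i) f - c i = \<mu> * pd t (e i) F))"
        using w by (intro ex_cong1) (auto simp: pdsw pdse l_def field_simps)
      also have "\<dots> \<longleftrightarrow> (\<forall>i<n. c i = pd t (e i) f - l * pd t (e i) F)"
        by (auto simp: algebra_simps)
      finally show ?thesis .
    qed
    show "\<exists>!c. c \<in> {..<n} \<rightarrow>\<^sub>E UNIV \<and> a \<ominus>\<^bsub>A\<^esub> (\<Oplus>\<^bsub>A\<^esub>i\<in>{..<n}. k (c i) \<otimes>\<^bsub>A\<^esub> h (\<beta> i))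
        \<in> ideal_prod A (point_ideal A (point t)) (point_ideal A (point t))"
      unfolding crit
    proof (rule ex1I[of _ "\<lambda>i\<in>{..<n}. pd t (e i) f - l * pd t (e i) F"])
      fix c assume "c \<in> {..<n} \<rightarrow>\<^sub>E UNIV \<and> (\<forall>i<n. c i = pd t (e i) f - l * pd t (e i) F)"
      then show "c = (\<lambda>i\<in>{..<n}. pd t (e i) f - l * pd t (e i) F)"
        by (intro extensionalityI[of _ "{..<n}"]) (auto simp: PiE_def)
    qed auto
  qed
  then show ?thesis by blast
qed

lemma cotangent_basis_not_exists:
  assumes t: "t \<in> zeros" and F: "\<And>v. v \<in> U \<union> V \<Longrightarrow> pd t v F = 0" and n: "n < card (U \<union> V)"
  shows "\<not> cotangent_basis A k (point t) n b"
proof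
  assume b: "cotangent_basis A k (point t) n b"
  have tp: "t \<in> pts V" using t by (rule zeros_pts)
  have "\<forall>i<n. \<exists>f. f \<in> Pol U V \<and> h f = b i \<and> poly_eval t f = 0"
  proof (intro allI impI)
    fix i assume "i < n"
    then have bi: "b i \<in> point_ideal A (point t)" using b by (simp add: cotangent_basis_def)
    then obtain f where "f \<in> Pol U V" "h f = b i" by (auto simp: point_ideal_def elim: h_cases)
    with bi t show "\<exists>f. f \<in> Pol U V \<and> h f = b i \<and> poly_eval t f = 0"
      by (intro exI[of _ f]) (auto simp: point_ideal_def simp flip: point_h)
  qed
  then obtain \<beta> where \<beta>: "\<And>i. i < n \<Longrightarrow> \<beta> i \<in> Pol U V" "\<And>i. i < n \<Longrightarrow> h (\<beta> i) = b i"
    "\<And>i. i < n \<Longrightarrow> poly_eval t (\<beta> i) = 0" by metis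
  \<comment> \<open>A nonzero tangent vector that the differentials of the n given elements kill. A
    coordinate w with \<open>x w \<noteq> 0\<close> is not killed by it, hence lies outside their
    span modulo the square.\<close>
  obtain x where x: "\<exists>v\<in>U \<union> V. x v \<noteq> 0" "\<And>i. i < n \<Longrightarrow> (\<Sum>v\<in>U \<union> V. pd t v (\<beta> i) * x v) = 0"
    using homogeneous_system_solvable[of "{..<n}" "U \<union> V" "\<lambda>i v. pd t v (\<beta> i)"] n by auto
  then obtain w where w: "w \<in> U \<union> V" "x w \<noteq> 0" by blast
  define f where "f = Var w - Const (t w)"
  have f: "f \<in> Pol U V" "poly_eval t f = 0" using w by (auto simp: f_def)
  have vw: "Var w \<in> Pol U V" using w by auto
  have "h f \<in> point_ideal A (point t)" using f t by (simp add: point_ideal_def point_h)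
  then obtain c where c: "h f \<ominus>\<^bsub>A\<^esub> (\<Oplus>\<^bsub>A\<^esub>i\<in>{..<n}. k (c i) \<otimes>\<^bsub>A\<^esub> b i)
          \<in> ideal_prod A (point_ideal A (point t)) (point_ideal A (point t))"
    using b unfolding cotangent_basis_def by blast
  define s where "s = (\<Sum>i<n. Const (c i) * \<beta> i)"
  have s: "s \<in> Pol U V" "poly_eval t s = 0"
    using \<beta> by (auto simp: s_def poly_eval_sum poly_eval_mult[OF tp Pol_Const[of _ U V]] intro!: Pol_sum)
  have "(\<Oplus>\<^bsub>A\<^esub>i\<in>{..<n}. k (c i) \<otimes>\<^bsub>A\<^esub> b i) = h s"
    using h_sum[of n \<beta> c] \<beta> by (auto simp: s_def intro!: A.finsum_cong')
  then have "h (f - s) \<in> ideal_prod A (point_ideal A (point t)) (point_ideal A (point t))"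
    using c f s by (simp add: h_diff)
  then have 1: "pd t v (f - s) = 0" if "v \<in> U \<union> V" for v
    using h_cotangent_iff[OF t, of "f - s"] f s F that by auto
  have pds: "pd t v s = (\<Sum>i<n. c i * pd t v (\<beta> i))" for v
  proof -
    have "pd t v s = (\<Sum>i<n. pd t v (Const (c i) * \<beta> i))"
      unfolding s_def using \<beta> by (intro pd_sum[OF tp disj]) auto
    also have "\<dots> = (\<Sum>i<n. c i * pd t v (\<beta> i))"
      using \<beta>(1) by (intro sum.cong refl pd_Const_mult[OF tp disj]) auto
    finally show ?thesis .
  qed
  have "(\<Sum>v\<in>U \<union> V. pd t v s * x v) = (\<Sum>i<n. c i * (\<Sum>v\<in>U \<union> V. pd t v (\<beta> i) * x v))"
    unfolding pds sum_distrib_left sum_distrib_right by (subst sum.swap) (simp add: mult.assoc)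
  also have "\<dots> = 0" using x(2) by simp
  finally have 2: "(\<Sum>v\<in>U \<union> V. pd t v s * x v) = 0" .
  have "(\<Sum>v\<in>U \<union> V. pd t v s * x v) = (\<Sum>v\<in>U \<union> V. if v = w then x v else 0)"
  proof (intro sum.cong refl)
    fix v assume v: "v \<in> U \<union> V"
    have "pd t v s = pd t v f" using 1[OF v] pd_diff[OF tp disj f(1) s(1)] by simp
    also have "\<dots> = (if v = w then 1 else 0)"
      unfolding f_def by (simp add: pd_diff[OF tp disj vw Pol_Const] pd_Var pd_Const)
    finally show "pd t v s * x v = (if v = w then x v else 0)" by simp
  qed
  also have "\<dots> = x w" using w by simp
  finally show False using 2 w by simp
qed

lemma regular_point_iff:
  assumes t: "t \<in> zeros" and n: "Suc n = card (U \<union> V)"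
    and height: "ideal_height A (point_ideal A (point t)) = enat n"
  shows "regular_point A k (point t) \<longleftrightarrow> (\<exists>v\<in>U \<union> V. pd t v F \<noteq> 0)"
proof
  assume "regular_point A k (point t)"
  then obtain b where "cotangent_basis A k (point t) n b"
    by (auto simp: regular_point_def height)
  then show "\<exists>v\<in>U \<union> V. pd t v F \<noteq> 0"
    using cotangent_basis_not_exists[OF t, of n b] n by auto
next
  assume "\<exists>v\<in>U \<union> V. pd t v F \<noteq> 0"
  then show "regular_point A k (point t)"
    using cotangent_basis_exists[OF t _ _ n] height by (auto simp: regular_point_def)
qed

end

section \<open>The cubic\<close>

text \<open>The cubic is linear in \<open>x\<^sub>3\<close>: it is \<open>gc - vc * x\<^sub>3\<close>, where \<open>vc\<close> is the invariant \<open>b\<^sub>2 c\<^sub>1\<close>.\<close>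

definition vc :: "(var \<Rightarrow> complex) \<Rightarrow> complex" where
  "vc t = t S3 - t X1 * t X2"

definition gc :: "(var \<Rightarrow> complex) \<Rightarrow> complex" where
  "gc t = (t X1)^2 + (t X2)^2 - (t S1 + t S2 * t S3) * t X1 - (t S2 + t S1 * t S3) * t X2
     + (t S3)^2 + t S1 * t S2 * t S3 + 1"

definition cubic_at :: "(var \<Rightarrow> complex) \<Rightarrow> complex" where
  "cubic_at t = cubic (t X1) (t X2) (t X3) (t S1) (t S2) (t S3)"

lemma cubic_at_eq: "cubic_at t = gc t - vc t * t X3"
  by (simp add: cubic_at_def cubic_def gc_def vc_def algebra_simps)

definition graph :: "(var \<Rightarrow> complex) \<Rightarrow> var \<Rightarrow> complex" where
  "graph t = t(X3 := gc t / vc t)"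

lemma cubic_at_graph: "vc t \<noteq> 0 \<Longrightarrow> cubic_at (graph t) = 0"
  unfolding cubic_at_eq by (simp add: graph_def gc_def vc_def)

lemma cubic_at_eq_graph: "vc t \<noteq> 0 \<Longrightarrow> cubic_at t = 0 \<Longrightarrow> graph t = t"
  by (rule ext) (simp add: cubic_at_eq graph_def field_simps)

section \<open>Pull-back of polynomials along the graph and along slices\<close>

definition vpoly :: lpoly where "vpoly = Var S3 - Var X1 * Var X2"

definition gpoly :: lpoly where
  "gpoly = (Var X1)^2 + (Var X2)^2 - (Var S1 + Var S2 * Var S3) * Var X1 - (Var S2 + Var S1 * Var S3) * Var X2
     + (Var S3)^2 + Var S1 * Var S2 * Var S3 + 1"

abbreviation vars6 :: "var set" where "vars6 \<equiv> {X1, X2, X3, S1, S2}"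

lemma gv_Pol [intro, simp]: "vpoly \<in> Pol vars6 {S3}" "gpoly \<in> Pol vars6 {S3}"
  by (auto simp: vpoly_def gpoly_def)

lemma poly_eval_L6:
  assumes "t \<in> pts {S3}" "p \<in> Pol vars6 {S3}" "q \<in> Pol vars6 {S3}"
  shows "poly_eval t (p * q) = poly_eval t p * poly_eval t q"
  using assms by (rule poly_eval_mult)

lemma poly_eval_vpoly:
  assumes t: "t \<in> pts {S3}" shows "poly_eval t vpoly = vc t"
  by (simp add: vpoly_def vc_def poly_eval_L6[OF t])

lemma poly_eval_gpoly:
  assumes t: "t \<in> pts {S3}" shows "poly_eval t gpoly = gc t"
  by (simp add: gpoly_def gc_def poly_eval_L6[OF t] poly_eval_power[OF t, of _ vars6])

text \<open>Substitute \<open>gc t / vc t\<close> for x_3 and clear denominators. Irreducibility of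
  the graph thereby reduces to the absence of zero divisors in the polynomial ring.\<close>

lemma pull_back_graph:
  assumes "p \<in> Pol vars6 {S3}"
  shows "\<exists>q n. q \<in> Pol vars6 {S3} \<and>
    (\<forall>t\<in>pts {S3}. vc t \<noteq> 0 \<longrightarrow> poly_eval t q = vc t ^ n * poly_eval (graph t) p)"
  using assms
proof (induction p rule: Pol_induct)
  case (const c)
  show ?case by (intro exI[of _ "Const c"] exI[of _ 0]) auto
next
  case (var w)
  show ?case
  proof (cases "w = X3")
    case True
    then show ?thesis by (intro exI[of _ gpoly] exI[of _ 1]) (auto simp: poly_eval_gpoly graph_def)
  next
    case False
    then show ?thesis using var by (intro exI[of _ "Var w"] exI[of _ 0]) (auto simp: graph_def)
  qed
next
  case (inv w)
  then have "Var_inv w \<in> Pol vars6 {S3}" by (intro Pol_Var_inv) auto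
  then show ?case using inv by (intro exI[of _ "Var_inv w"] exI[of _ 0]) (auto simp: graph_def)
next
  case (add p1 p2)
  then obtain q1 n1 q2 n2 where q: "q1 \<in> Pol vars6 {S3}" "q2 \<in> Pol vars6 {S3}"
    "\<And>t. t\<in>pts {S3} \<Longrightarrow> vc t \<noteq> 0 \<Longrightarrow> poly_eval t q1 = vc t ^ n1 * poly_eval (graph t) p1"
    "\<And>t. t\<in>pts {S3} \<Longrightarrow> vc t \<noteq> 0 \<Longrightarrow> poly_eval t q2 = vc t ^ n2 * poly_eval (graph t) p2" by blast
  show ?case
  proof (intro exI[of _ "vpoly ^ n2 * q1 + vpoly ^ n1 * q2"] exI[of _ "n1 + n2"] conjI ballI impI)
    fix t assume t: "t \<in> pts {S3}" "vc t \<noteq> 0"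
    have pw: "poly_eval t (vpoly ^ m) = vc t ^ m" for m
      using poly_eval_power[OF t(1) gv_Pol(1)] poly_eval_vpoly[OF t(1)] by simp
    show "poly_eval t (vpoly ^ n2 * q1 + vpoly ^ n1 * q2) = vc t ^ (n1 + n2) * poly_eval (graph t) (p1 + p2)"
      using q t by (simp add: poly_eval_L6[OF t(1)] pw power_add algebra_simps)
  qed (use q in auto)
next
  case (mult p1 p2)
  then obtain q1 n1 q2 n2 where q: "q1 \<in> Pol vars6 {S3}" "q2 \<in> Pol vars6 {S3}"
    "\<And>t. t\<in>pts {S3} \<Longrightarrow> vc t \<noteq> 0 \<Longrightarrow> poly_eval t q1 = vc t ^ n1 * poly_eval (graph t) p1"
    "\<And>t. t\<in>pts {S3} \<Longrightarrow> vc t \<noteq> 0 \<Longrightarrow> poly_eval t q2 = vc t ^ n2 * poly_eval (graph t) p2" by blast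
  show ?case
  proof (intro exI[of _ "q1 * q2"] exI[of _ "n1 + n2"] conjI ballI impI)
    fix t assume t: "t \<in> pts {S3}" "vc t \<noteq> 0"
    then have "graph t \<in> pts {S3}" by (simp add: pts_def graph_def)
    then show "poly_eval t (q1 * q2) = vc t ^ (n1 + n2) * poly_eval (graph t) (p1 * p2)"
      using q t mult by (simp add: poly_eval_L6 power_add algebra_simps)
  qed (use q in auto)
qed

definition slice :: "var set \<Rightarrow> (var \<Rightarrow> complex) \<Rightarrow> (var \<Rightarrow> complex) \<Rightarrow> var \<Rightarrow> complex" where
  "slice E t0 t v = (if v \<in> E then t v else t0 v)"

lemma slice_pts: "t \<in> pts V \<Longrightarrow> t0 \<in> pts V \<Longrightarrow> slice E t0 t \<in> pts V"
  by (auto simp: pts_def slice_def)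

lemma pull_back_slice:
  assumes t0: "t0 \<in> pts V" and disj: "U \<inter> V = {}" and p: "p \<in> Pol U V"
  shows "\<exists>q. q \<in> Pol U V \<and> (\<forall>t\<in>pts V. poly_eval t q = poly_eval (slice E t0 t) p)"
  using p
proof (induction p rule: Pol_induct)
  case (const c)
  show ?case by (intro exI[of _ "Const c"]) auto
next
  case (var w)
  then show ?case by (intro exI[of _ "if w \<in> E then Var w else Const (t0 w)"]) (auto simp: slice_def)
next
  case (inv w)
  then show ?case
    using disj by (intro exI[of _ "if w \<in> E then Var_inv w else Const (inverse (t0 w))"]) (auto simp: slice_def)
next
  case (add p1 p2)
  then obtain q1 q2 where q: "q1 \<in> Pol U V" "q2 \<in> Pol U V"
    "\<And>t. t\<in>pts V \<Longrightarrow> poly_eval t q1 = poly_eval (slice E t0 t) p1"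
    "\<And>t. t\<in>pts V \<Longrightarrow> poly_eval t q2 = poly_eval (slice E t0 t) p2" by blast
  then show ?case by (intro exI[of _ "q1 + q2"]) auto
next
  case (mult p1 p2)
  then obtain q1 q2 where q: "q1 \<in> Pol U V" "q2 \<in> Pol U V"
    "\<And>t. t\<in>pts V \<Longrightarrow> poly_eval t q1 = poly_eval (slice E t0 t) p1"
    "\<And>t. t\<in>pts V \<Longrightarrow> poly_eval t q2 = poly_eval (slice E t0 t) p2" by blast
  have "poly_eval t (q1 * q2) = poly_eval (slice E t0 t) (p1 * p2)" if t: "t \<in> pts V" for t
    using poly_eval_mult[OF t q(1,2)] poly_eval_mult[OF slice_pts[OF t t0] mult(1,2)] q t by simp
  then show ?case using q by (intro exI[of _ "q1 * q2"]) auto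
qed

lemma poly_eval_eq_0_imp_pts: "(\<And>t. t \<in> pts V \<Longrightarrow> poly_eval t p = 0) \<Longrightarrow> p = 0"
  by (rule poly_eval_eq_0_imp) (auto simp: pts_def)

text \<open>\<open>E\<close> lists the base coordinates that are free, and taking one of them out of
  \<open>E\<close> is a step of the chain of irreducible sets. The set is empty if v vanishes on the
  whole slice.\<close>

definition graph_slice :: "var set \<Rightarrow> (var \<Rightarrow> complex) \<Rightarrow> (var \<Rightarrow> complex) set" where
  "graph_slice E t0 = {graph (slice E t0 t) | t. t \<in> pts {S3} \<and> vc (slice E t0 t) \<noteq> 0}"

text \<open>The pull-backs f' and g' agree with f and g up to powers of v, but only where v is
  nonzero; the third factor v' makes the product vanish everywhere. If v' is the factor that is
  zero, the slice is empty.\<close>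

lemma graph_slice_prod_zero:
  assumes t0: "t0 \<in> pts {S3}" and f: "f \<in> Pol vars6 {S3}" and g: "g \<in> Pol vars6 {S3}"
    and fg: "\<And>t. t \<in> graph_slice E t0 \<Longrightarrow> poly_eval t f * poly_eval t g = 0"
  shows "(\<forall>t\<in>graph_slice E t0. poly_eval t f = 0) \<or> (\<forall>t\<in>graph_slice E t0. poly_eval t g = 0)"
proof -
  have disj: "vars6 \<inter> {S3} = {}" by auto
  have "\<exists>q n. q \<in> Pol vars6 {S3} \<and> (\<forall>t\<in>pts {S3}. vc (slice E t0 t) \<noteq> 0 \<longrightarrow>
      poly_eval t q = vc (slice E t0 t) ^ n * poly_eval (graph (slice E t0 t)) p)"
    if p: "p \<in> Pol vars6 {S3}" for p
  proof -
    obtain q n where q: "q \<in> Pol vars6 {S3}"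
      "\<And>t. t\<in>pts {S3} \<Longrightarrow> vc t \<noteq> 0 \<Longrightarrow> poly_eval t q = vc t ^ n * poly_eval (graph t) p"
      using pull_back_graph[OF p] by blast
    obtain q' where "q' \<in> Pol vars6 {S3}" "\<And>t. t\<in>pts {S3} \<Longrightarrow> poly_eval t q' = poly_eval (slice E t0 t) q"
      using pull_back_slice[OF t0 disj q(1)] by blast
    then show ?thesis using q(2) slice_pts[OF _ t0] by (intro exI[of _ q'] exI[of _ n]) auto
  qed
  from this[OF f] this[OF g] obtain f' m g' n where
    f': "f' \<in> Pol vars6 {S3}" "\<And>t. t \<in> pts {S3} \<Longrightarrow> vc (slice E t0 t) \<noteq> 0 \<Longrightarrow>
      poly_eval t f' = vc (slice E t0 t) ^ m * poly_eval (graph (slice E t0 t)) f"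
    and g': "g' \<in> Pol vars6 {S3}" "\<And>t. t \<in> pts {S3} \<Longrightarrow> vc (slice E t0 t) \<noteq> 0 \<Longrightarrow>
      poly_eval t g' = vc (slice E t0 t) ^ n * poly_eval (graph (slice E t0 t)) g" by blast
  obtain v' where v': "v' \<in> Pol vars6 {S3}" "\<And>t. t\<in>pts {S3} \<Longrightarrow> poly_eval t v' = vc (slice E t0 t)"
    using pull_back_slice[OF t0 disj gv_Pol(1)] poly_eval_vpoly[OF slice_pts[OF _ t0]] by metis
  have "f' * g' * v' = 0"
  proof (rule poly_eval_eq_0_imp_pts)
    fix t :: "var \<Rightarrow> complex" assume t: "t \<in> pts {S3}"
    show "poly_eval t (f' * g' * v') = 0"
    proof (cases "vc (slice E t0 t) = 0")
      case True
      then show ?thesis using f' g' v' t by (simp add: poly_eval_L6[OF t])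
    next
      case False
      then have "graph (slice E t0 t) \<in> graph_slice E t0" using t by (auto simp: graph_slice_def)
      from fg[OF this] show ?thesis using f' g' v' t False by (simp add: poly_eval_L6[OF t])
    qed
  qed
  then consider "f' = 0" | "g' = 0" | "v' = 0" by auto
  then show ?thesis
  proof cases
    case 1
    then have "poly_eval s f = 0" if "s \<in> graph_slice E t0" for s
      using that f'(2) by (force simp: graph_slice_def)
    then show ?thesis by blast
  next
    case 2
    then have "poly_eval s g = 0" if "s \<in> graph_slice E t0" for s
      using that g'(2) by (force simp: graph_slice_def)
    then show ?thesis by blast
  next
    case 3
    then have "graph_slice E t0 = {}" using v'(2) by (force simp: graph_slice_def)
    then show ?thesis by blast
  qed
qed

lemma slice_prod_zero:
  assumes t0: "t0 \<in> pts V" and disj: "U \<inter> V = {}" and f: "f \<in> Pol U V" and g: "g \<in> Pol U V"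
    and fg: "\<And>t. t \<in> pts V \<Longrightarrow> poly_eval (slice E t0 t) f * poly_eval (slice E t0 t) g = 0"
  shows "(\<forall>t\<in>pts V. poly_eval (slice E t0 t) f = 0) \<or> (\<forall>t\<in>pts V. poly_eval (slice E t0 t) g = 0)"
proof -
  obtain f' where f': "f' \<in> Pol U V" "\<And>t. t\<in>pts V \<Longrightarrow> poly_eval t f' = poly_eval (slice E t0 t) f"
    using pull_back_slice[OF t0 disj f] by blast
  obtain g' where g': "g' \<in> Pol U V" "\<And>t. t\<in>pts V \<Longrightarrow> poly_eval t g' = poly_eval (slice E t0 t) g"
    using pull_back_slice[OF t0 disj g] by blast
  have "f' * g' = 0"
  proof (rule poly_eval_eq_0_imp_pts)
    fix t :: "var \<Rightarrow> complex" assume t: "t \<in> pts V"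
    show "poly_eval t (f' * g') = 0"
      using poly_eval_mult[OF t f'(1) g'(1)] f' g' fg t by simp
  qed
  then have "f' = 0 \<or> g' = 0" by simp
  then show ?thesis using f'(2) g'(2) by force
qed

subsection \<open>Density of the graph\<close>

text \<open>A point of the surface with \<open>v = 0\<close> is a limit of points with \<open>v \<noteq> 0\<close>: move \<open>x\<^sub>2\<close> slightly,
  keep \<open>x\<^sub>3\<close>, and take for \<open>x\<^sub>1\<close> the root of the monic quadratic equation that is closest to
  the old value. If \<open>v\<close> vanished at the new point, then \<open>x\<^sub>2\<close> would be a root of a fixed polynomial.\<close>

lemma continuous_poly_eval_X1_X2:
  assumes t: "t \<in> pts {S3}" and p: "p \<in> Pol vars6 {S3}"
    and a: "(a \<longlongrightarrow> a0) \<F>" and b: "(b \<longlongrightarrow> b0) \<F>"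
  shows "((\<lambda>n. poly_eval (t(X1 := a n, X2 := b n)) p) \<longlongrightarrow> poly_eval (t(X1 := a0, X2 := b0)) p) \<F>"
  using p
proof (induction p rule: Pol_induct)
  case (var v)
  show ?case using a b by (cases v) auto
next
  case (add p q)
  then show ?case by (auto intro: tendsto_add)
next
  case (mult p q)
  have "t(X1 := x, X2 := y) \<in> pts {S3}" for x y using t by (auto simp: pts_def)
  note * = poly_eval_L6[OF this mult(1,2)]
  show ?case unfolding * by (intro tendsto_mult mult)
qed auto

text \<open>On the surface, v = 0 forces x_1 x_2 = s_3 and \<open>gc t = 0\<close>. This is gc times
  x_2^2 with x_1 eliminated by the first equation: a monic quartic in x_2 whose coefficients depend
  on the parameters s_i alone.\<close>

definition root_poly :: "(var \<Rightarrow> complex) \<Rightarrow> complex poly" where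
  "root_poly t = [:(t S3)^2, - (t S1 + t S2 * t S3) * t S3, (t S3)^2 + t S1 * t S2 * t S3 + 1,
     - (t S2 + t S1 * t S3), 1:]"

lemma vanishing_off_root_poly:
  assumes "t S3 \<noteq> 0" "cubic_at t = 0" "vc t = 0"
  shows "poly (root_poly t) (t X2) = 0"
proof -
  have x: "t X1 * t X2 = t S3" using assms by (simp add: vc_def)
  have "gc t = 0" using assms by (simp add: cubic_at_eq)
  then have "gc t * t X2 ^ 2 = 0" by simp
  moreover have "poly (root_poly t) (t X2) = gc t * t X2 ^ 2"
    by (simp add: root_poly_def gc_def x[symmetric] algebra_simps power2_eq_square power3_eq_cube power4_eq_xxxx)
  ultimately show ?thesis by simp
qed

text \<open>The distances from x to the two roots multiply to the norm of the value at x, and the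
  smaller of two factors has square at most the product. So a root tends to x as the value at x
  tends to 0.\<close>

lemma closest_root:
  fixes x b c :: complex
  obtains r where "r^2 + b * r + c = 0" "norm (r - x) ^ 2 \<le> norm (x^2 + b * x + c)"
proof -
  define s where "s = csqrt (b^2 - 4 * c)"
  have s2: "s^2 = b^2 - 4 * c" by (simp add: s_def)
  define r where "r = (- b + s) / 2"
  define q where "q = (- b - s) / 2"
  have fac: "z^2 + b * z + c = (r - z) * (q - z)" for z
  proof -
    have "(r - z) * (q - z) = z^2 + b * z + (b^2 - s^2) / 4"
      by (simp add: r_def q_def field_simps power2_eq_square)
    then show ?thesis by (simp add: s2)
  qed
  have n: "norm (x^2 + b * x + c) = norm (r - x) * norm (q - x)" by (simp add: fac norm_mult)
  show ?thesis
  proof (cases "norm (r - x) \<le> norm (q - x)")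
    case True
    then have "norm (r - x) ^ 2 \<le> norm (x^2 + b * x + c)"
      unfolding n by (simp only: power2_eq_square) (intro mult_left_mono norm_ge_zero)
    then show ?thesis using that[of r] fac[of r] by simp
  next
    case False
    then have "norm (q - x) ^ 2 \<le> norm (x^2 + b * x + c)"
      unfolding n by (simp only: power2_eq_square) (intro mult_right_mono norm_ge_zero, simp)
    then show ?thesis using that[of q] fac[of q] by simp
  qed
qed

lemma graph_dense:
  assumes t0: "t0 \<in> pts {S3}" "cubic_at t0 = 0" and p: "p \<in> Pol vars6 {S3}"
    and van: "\<And>t. t \<in> graph_slice {X1, X2} t0 \<Longrightarrow> poly_eval t p = 0"
  shows "poly_eval t0 p = 0"
proof -
  define x1 x2 where "x1 = t0 X1" and "x2 = t0 X2"
  define b c where "b y = y * t0 X3 - (t0 S1 + t0 S2 * t0 S3)"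
    and "c y = y^2 - (t0 S2 + t0 S1 * t0 S3) * y - t0 S3 * t0 X3 + (t0 S3)^2 + t0 S1 * t0 S2 * t0 S3 + 1" for y
  have cub: "cubic_at (t0(X1 := x, X2 := y)) = x^2 + b y * x + c y" for x y
    by (simp add: cubic_at_def cubic_def b_def c_def algebra_simps)
  have "\<forall>y. \<exists>r. r^2 + b y * r + c y = 0 \<and> norm (r - x1) ^ 2 \<le> norm (x1^2 + b y * x1 + c y)"
    using closest_root by metis
  then obtain r where r: "\<And>y. (r y)^2 + b y * r y + c y = 0"
    "\<And>y. norm (r y - x1) ^ 2 \<le> norm (x1^2 + b y * x1 + c y)" by metis
  have "((\<lambda>y. sqrt (norm (x1^2 + b y * x1 + c y))) \<longlongrightarrow> sqrt (norm (x1^2 + b x2 * x1 + c x2))) (at x2)"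
    unfolding b_def c_def by (intro tendsto_intros)
  moreover have "x1^2 + b x2 * x1 + c x2 = 0"
    using cub[of x1 x2] t0(2) by (simp add: x1_def x2_def)
  ultimately have "((\<lambda>y. sqrt (norm (x1^2 + b y * x1 + c y))) \<longlongrightarrow> 0) (at x2)" by simp
  moreover have "\<forall>\<^sub>F y in at x2. norm (r y - x1) \<le> sqrt (norm (x1^2 + b y * x1 + c y))"
    using r(2) by (intro always_eventually allI real_le_rsqrt)
  ultimately have "((\<lambda>y. r y - x1) \<longlongrightarrow> 0) (at x2)" by (rule Lim_null_comparison[rotated])
  then have rlim: "(r \<longlongrightarrow> x1) (at x2)" by (simp add: LIM_zero_iff)
  have lim: "((\<lambda>y. poly_eval (t0(X1 := r y, X2 := y)) p) \<longlongrightarrow> poly_eval (t0(X1 := x1, X2 := x2)) p) (at x2)"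
    by (rule continuous_poly_eval_X1_X2[OF t0(1) p rlim]) (rule tendsto_ident_at)
  \<comment> \<open>The leading coefficient is 1, so only finitely many y are bad, and close to
    \<open>x2\<close> none of them other than possibly \<open>x2\<close> itself, which the limit
    leaves out.\<close>
  have "root_poly t0 \<noteq> 0" by (simp add: root_poly_def)
  then have fin: "finite {y. poly (root_poly t0) y = 0}" by (rule poly_roots_finite)
  have "\<forall>\<^sub>F y in at x2. y \<notin> {y. poly (root_poly t0) y = 0}"
    using islimpt_finite[OF fin, of x2] unfolding islimpt_iff_eventually by (simp only: not_not)
  then have "\<forall>\<^sub>F y in at x2. poly_eval (t0(X1 := r y, X2 := y)) p = 0"
  proof (rule eventually_mono)
    fix y assume y: "y \<notin> {y. poly (root_poly t0) y = 0}"
    let ?t = "t0(X1 := r y, X2 := y)"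
    have pt: "?t \<in> pts {S3}" using t0 by (simp add: pts_def)
    have z: "cubic_at ?t = 0" using cub r(1) by simp
    have "root_poly ?t = root_poly t0" by (simp add: root_poly_def)
    then have v: "vc ?t \<noteq> 0" using vanishing_off_root_poly[of ?t] y z pt by (auto simp: pts_def)
    have "slice {X1, X2} t0 ?t = ?t" by (rule ext) (simp add: slice_def)
    then have "?t \<in> graph_slice {X1, X2} t0"
      unfolding graph_slice_def using cubic_at_eq_graph[OF v z] pt v by (intro CollectI exI[of _ ?t]) simp
    then show "poly_eval ?t p = 0" by (rule van)
  qed
  then have "((\<lambda>y. poly_eval (t0(X1 := r y, X2 := y)) p) \<longlongrightarrow> 0) (at x2)"
    by (rule tendsto_eventually)
  from tendsto_unique[OF _ lim this] have "poly_eval (t0(X1 := x1, X2 := x2)) p = 0" by simp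
  then show ?thesis by (simp add: x1_def x2_def)
qed

subsection \<open>Chains of irreducible sets\<close>

lemma graph_slice_mono:
  assumes "E \<subseteq> E'" "t0 \<in> pts {S3}" shows "graph_slice E t0 \<subseteq> graph_slice E' t0"
proof
  fix s assume "s \<in> graph_slice E t0"
  then obtain t where t: "s = graph (slice E t0 t)" "t \<in> pts {S3}" "vc (slice E t0 t) \<noteq> 0"
    by (auto simp: graph_slice_def)
  have "slice E' t0 (slice E t0 t) = slice E t0 t"
    using assms(1) by (intro ext) (auto simp: slice_def)
  then show "s \<in> graph_slice E' t0"
    unfolding graph_slice_def using t slice_pts[OF t(2) assms(2)]
    by (intro CollectI exI[of _ "slice E t0 t"]) auto
qed

lemma graph_slice_zero:
  assumes "t0 \<in> pts {S3}" "t \<in> graph_slice E t0"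
  shows "t \<in> pts {S3} \<and> cubic_at t = 0"
proof -
  obtain s where s: "t = graph (slice E t0 s)" "s \<in> pts {S3}" "vc (slice E t0 s) \<noteq> 0"
    using assms(2) by (auto simp: graph_slice_def)
  have "slice E t0 s \<in> pts {S3}" using s assms by (intro slice_pts)
  then show ?thesis using s cubic_at_graph by (auto simp: pts_def graph_def)
qed

lemma graph_slice_fixed: "t \<in> graph_slice E t0 \<Longrightarrow> w \<notin> E \<Longrightarrow> w \<noteq> X3 \<Longrightarrow> t w = t0 w"
  by (auto simp: graph_slice_def graph_def slice_def)

lemma graph_slice_memI:
  assumes "t0 \<in> pts {S3}" "t \<in> pts {S3}" "vc t \<noteq> 0" "\<And>w. w \<notin> E \<Longrightarrow> w \<noteq> X3 \<Longrightarrow> t w = t0 w"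
  shows "graph t \<in> graph_slice E t0"
proof -
  have eq: "graph (slice E t0 t) = graph t" "vc (slice E t0 t) = vc t"
  proof -
    have *: "slice E t0 t w = t w" if "w \<noteq> X3" for w
      using assms(4)[of w] that by (auto simp: slice_def)
    then have **: "vc (slice E t0 t) = vc t" "gc (slice E t0 t) = gc t" by (simp_all add: vc_def gc_def)
    then show "graph (slice E t0 t) = graph t" using * by (auto simp: graph_def)
    show "vc (slice E t0 t) = vc t" by (rule **)
  qed
  then show ?thesis
    unfolding graph_slice_def using assms by (intro CollectI exI[of _ t]) auto
qed

text \<open>All points of a line in the direction of x_3 share one surface slice, so density can be
  applied at each of them.\<close>

lemma graph_slice_cong:
  assumes "\<And>w. w \<noteq> X3 \<Longrightarrow> t0 w = t1 w" "X3 \<notin> E"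
  shows "graph_slice E t0 = graph_slice E t1"
proof -
  have "graph (slice E t0 t) = graph (slice E t1 t) \<and> vc (slice E t0 t) = vc (slice E t1 t)" for t
  proof -
    have *: "slice E t0 t w = slice E t1 t w" if "w \<noteq> X3" for w
      using assms(1)[of w] that by (auto simp: slice_def)
    then have **: "vc (slice E t0 t) = vc (slice E t1 t)" "gc (slice E t0 t) = gc (slice E t1 t)"
      by (simp_all add: vc_def gc_def)
    then show ?thesis using * by (auto simp: graph_def)
  qed
  then show ?thesis by (simp add: graph_slice_def)
qed

definition van_line :: "(var \<Rightarrow> complex) \<Rightarrow> (var \<Rightarrow> complex) set" where
  "van_line t0 = {slice {X3} t0 t | t. t \<in> pts {S3}}"

text \<open>The curve through the point: a slice of the graph if \<open>v \<noteq> 0\<close>, and otherwise the line in the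
  surface along which only \<open>x\<^sub>3\<close> varies.\<close>

definition curve_through :: "(var \<Rightarrow> complex) \<Rightarrow> (var \<Rightarrow> complex) set" where
  "curve_through t0 = (if vc t0 \<noteq> 0 then graph_slice {X1} t0 else van_line t0)"

lemma van_line_zero:
  assumes "t0 \<in> pts {S3}" "cubic_at t0 = 0" "vc t0 = 0" "t \<in> van_line t0"
  shows "t \<in> pts {S3} \<and> cubic_at t = 0 \<and> (\<forall>w. w \<noteq> X3 \<longrightarrow> t w = t0 w)"
proof -
  obtain s where s: "t = slice {X3} t0 s" using assms(4) by (auto simp: van_line_def)
  have w: "t w = t0 w" if "w \<noteq> X3" for w using s that by (auto simp: slice_def)
  then have "vc t = vc t0" "gc t = gc t0" by (simp_all add: vc_def gc_def)
  then show ?thesis using assms w by (auto simp: cubic_at_eq pts_def)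
qed

lemma self_in_curve:
  assumes "t0 \<in> pts {S3}" "cubic_at t0 = 0" shows "t0 \<in> curve_through t0"
proof (cases "vc t0 = 0")
  case False
  then show ?thesis using graph_slice_memI[of t0 t0 "{X1}"] cubic_at_eq_graph[of t0] assms
    by (simp add: curve_through_def)
next
  case True
  have "slice {X3} t0 t0 = t0" by (auto simp: slice_def)
  then show ?thesis using True assms by (auto simp: curve_through_def van_line_def intro!: exI[of _ t0])
qed

lemma curve_zero:
  assumes "t0 \<in> pts {S3}" "cubic_at t0 = 0" "t \<in> curve_through t0"
  shows "t \<in> pts {S3} \<and> cubic_at t = 0 \<and> (\<forall>w\<in>{S1, S2, S3}. t w = t0 w)"
  using assms graph_slice_zero[of t0 t "{X1}"] graph_slice_fixed[of t "{X1}" t0] van_line_zero[of t0 t]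
  by (auto simp: curve_through_def split: if_splits)

lemma nonzero_avoiding: obtains z :: complex where "z \<noteq> 0" "z \<noteq> a"
  using that[of 1] that[of 2] by (cases "a = 1") auto

text \<open>The steps of the chain are proved at once for the ring of the quotient and for that of a
  fibre: the sets are the same, and only the ring in which vanishing is tested changes.\<close>

locale sub_ring6 =
  fixes U V :: "var set"
  assumes sub: "Pol U V \<subseteq> Pol vars6 {S3}" and X: "{X1, X2, X3} \<subseteq> U" and V: "V \<subseteq> {S3}"
begin

text \<open>Strictness is witnessed by \<open>Var w - Const a\<close>. The alternative of an
  inclusion between ideals is meant for the line at v = 0, which lies in the closure of the graph
  but not in the graph.\<close>

lemma van_psubset:
  assumes "Z' \<subseteq> Z \<or> van_ideal U V Z \<subseteq> van_ideal U V Z'" "w \<in> U \<union> V"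
    "\<And>t. t \<in> Z' \<Longrightarrow> t w = a" "t \<in> Z" "t w \<noteq> a"
  shows "van_ideal U V Z \<subset> van_ideal U V Z'"
proof -
  have "Var w - Const a \<in> van_ideal U V Z'" "Var w - Const a \<notin> van_ideal U V Z"
    using assms by (auto simp: van_ideal_def)
  moreover have "van_ideal U V Z \<subseteq> van_ideal U V Z'" using assms(1) by (auto simp: van_ideal_def)
  ultimately show ?thesis by blast
qed

lemma chain_parameter:
  assumes t0: "t0 \<in> pts {S3}" and E: "X1 \<in> E" "X2 \<in> E" "w \<notin> E" "w \<in> {S1, S2, S3}" "w \<in> U \<union> V"
  shows "van_ideal U V (graph_slice (insert w E) t0) \<subset> van_ideal U V (graph_slice E t0)"
proof -
  obtain z where z: "z \<noteq> 0" "z \<noteq> t0 w" by (rule nonzero_avoiding)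
  \<comment> \<open>With x_1 = x_2 = 0 the value of v is s_3, and z is nonzero in case w is
    \<open>S3\<close>.\<close>
  define t where "t = t0(X1 := 0, X2 := 0, w := z)"
  have t: "t \<in> pts {S3}" "vc t \<noteq> 0" using t0 z E(4) by (auto simp: t_def pts_def vc_def)
  have "graph t \<in> graph_slice (insert w E) t0"
    using E by (intro graph_slice_memI t0 t) (auto simp: t_def)
  moreover have "graph t w \<noteq> t0 w" using z E by (auto simp: graph_def t_def)
  moreover have "graph_slice E t0 \<subseteq> graph_slice (insert w E) t0"
    using t0 by (intro graph_slice_mono) auto
  moreover have "s w = t0 w" if "s \<in> graph_slice E t0" for s
    using graph_slice_fixed[OF that] E by auto
  ultimately show ?thesis using E by (intro van_psubset[where w = w and a = "t0 w"]) auto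
qed

lemma chain_surface_curve:
  assumes t0: "t0 \<in> pts {S3}" and cub: "cubic_at t0 = 0"
  shows "van_ideal U V (graph_slice {X1, X2} t0) \<subset> van_ideal U V (curve_through t0)"
proof (cases "vc t0 = 0")
  case False
  \<comment> \<open>x_2 leaves its old value, and x_1 = 0 makes v equal to s_3, hence nonzero. The
    case v = 0 exchanges the roles of x_1 and x_2.\<close>
  define t where "t = t0(X1 := 0, X2 := t0 X2 + 1)"
  have t: "t \<in> pts {S3}" "vc t \<noteq> 0" using t0 by (auto simp: t_def pts_def vc_def)
  have "graph t \<in> graph_slice {X1, X2} t0"
    by (intro graph_slice_memI t0 t) (auto simp: t_def)
  moreover have "graph t X2 \<noteq> t0 X2" by (auto simp: graph_def t_def)
  moreover have "graph_slice {X1} t0 \<subseteq> graph_slice {X1, X2} t0"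
    using t0 by (intro graph_slice_mono) auto
  moreover have "s X2 = t0 X2" if "s \<in> graph_slice {X1} t0" for s
    using graph_slice_fixed[OF that] by auto
  ultimately show ?thesis
    using X False by (intro van_psubset[where w = X2 and a = "t0 X2"]) (auto simp: curve_through_def)
next
  case True
  define t where "t = t0(X1 := t0 X1 + 1, X2 := 0)"
  have t: "t \<in> pts {S3}" "vc t \<noteq> 0" using t0 by (auto simp: t_def pts_def vc_def)
  have "graph t \<in> graph_slice {X1, X2} t0"
    by (intro graph_slice_memI t0 t) (auto simp: t_def)
  moreover have "graph t X1 \<noteq> t0 X1" by (auto simp: graph_def t_def)
  moreover have "van_ideal U V (graph_slice {X1, X2} t0) \<subseteq> van_ideal U V (van_line t0)"
  proof
    fix p assume p: "p \<in> van_ideal U V (graph_slice {X1, X2} t0)"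
    have "poly_eval s p = 0" if s: "s \<in> van_line t0" for s
    proof (rule graph_dense)
      have sw: "s \<in> pts {S3} \<and> cubic_at s = 0 \<and> (\<forall>w. w \<noteq> X3 \<longrightarrow> s w = t0 w)"
        by (rule van_line_zero[OF t0 cub True s])
      then show "s \<in> pts {S3}" "cubic_at s = 0" by auto
      show "p \<in> Pol vars6 {S3}" using p sub by (auto simp: van_ideal_def)
      have "graph_slice {X1, X2} s = graph_slice {X1, X2} t0"
        using sw by (intro graph_slice_cong) auto
      then show "poly_eval t p = 0" if "t \<in> graph_slice {X1, X2} s" for t
        using p that by (auto simp: van_ideal_def)
    qed
    then show "p \<in> van_ideal U V (van_line t0)" using p by (auto simp: van_ideal_def)
  qed
  moreover have "s X1 = t0 X1" if "s \<in> van_line t0" for s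
    using van_line_zero[OF t0 cub True that] by auto
  ultimately show ?thesis
    using X True by (intro van_psubset[where w = X1 and a = "t0 X1"]) (auto simp: curve_through_def)
qed

lemma chain_curve_point:
  assumes t0: "t0 \<in> pts {S3}" and cub: "cubic_at t0 = 0"
  shows "van_ideal U V (curve_through t0) \<subset> van_ideal U V {t0}"
proof (cases "vc t0 = 0")
  case False
  have S3: "t0 S3 \<noteq> 0" using t0 by (auto simp: pts_def)
  \<comment> \<open>v is affine in x_1 and not identically zero, as s_3 is nonzero; it cannot vanish
    at two values of x_1.\<close>
  have "\<exists>z. z \<noteq> t0 X1 \<and> t0 S3 - z * t0 X2 \<noteq> 0"
  proof (rule ccontr)
    assume n: "\<not> ?thesis"
    have "t0 X1 + 1 \<noteq> t0 X1" "t0 X1 + 2 \<noteq> t0 X1" by simp_all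
    with n have 1: "t0 S3 - (t0 X1 + 1) * t0 X2 = 0" "t0 S3 - (t0 X1 + 2) * t0 X2 = 0" by metis+
    then have "t0 X2 = 0" by (simp add: algebra_simps)
    with 1 S3 show False by simp
  qed
  then obtain z where z: "z \<noteq> t0 X1" "t0 S3 - z * t0 X2 \<noteq> 0" by blast
  define t where "t = t0(X1 := z)"
  have t: "t \<in> pts {S3}" "vc t \<noteq> 0" using t0 z by (auto simp: t_def pts_def vc_def)
  have "graph t \<in> curve_through t0"
    using False unfolding curve_through_def by (simp, intro graph_slice_memI t0 t) (auto simp: t_def)
  moreover have "graph t X1 \<noteq> t0 X1" using z by (auto simp: graph_def t_def)
  ultimately show ?thesis
    using X self_in_curve[OF t0 cub] by (intro van_psubset[where w = X1 and a = "t0 X1"]) auto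
next
  case True
  define t where "t = t0(X3 := t0 X3 + 1)"
  have "slice {X3} t0 t = t" by (auto simp: t_def slice_def)
  moreover have "t \<in> pts {S3}" using t0 by (auto simp: t_def pts_def)
  ultimately have "t \<in> curve_through t0"
    using True by (auto simp: curve_through_def van_line_def intro!: exI[of _ t])
  moreover have "t X3 \<noteq> t0 X3" by (simp add: t_def)
  ultimately show ?thesis
    using X self_in_curve[OF t0 cub] by (intro van_psubset[where w = X3 and a = "t0 X3"]) auto
qed

end

context hypersurface
begin

lemma irred_graph_slice:
  assumes "Pol U V \<subseteq> Pol vars6 {S3}" "t0 \<in> pts {S3}" "graph_slice E t0 \<noteq> {}"
  shows "irred (graph_slice E t0)"
  unfolding irred_def using assms graph_slice_prod_zero[OF assms(2)] by blast

lemma irred_curve: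
  assumes sub: "Pol U V \<subseteq> Pol vars6 {S3}" and t0: "t0 \<in> pts {S3}" and cub: "cubic_at t0 = 0"
  shows "irred (curve_through t0)"
proof (cases "vc t0 = 0")
  case False
  then show ?thesis using irred_graph_slice[OF sub t0, of "{X1}"] self_in_curve[OF t0 cub]
    by (auto simp: curve_through_def)
next
  case True
  have "(\<forall>t\<in>van_line t0. poly_eval t f = 0) \<or> (\<forall>t\<in>van_line t0. poly_eval t g = 0)"
    if fg: "f \<in> Pol U V" "g \<in> Pol U V" "\<forall>t\<in>van_line t0. poly_eval t f * poly_eval t g = 0" for f g
  proof -
    have "(\<forall>t\<in>pts {S3}. poly_eval (slice {X3} t0 t) f = 0) \<or> (\<forall>t\<in>pts {S3}. poly_eval (slice {X3} t0 t) g = 0)"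
      using fg sub by (intro slice_prod_zero[OF t0, of vars6]) (auto simp: van_line_def)
    then show ?thesis by (auto simp: van_line_def)
  qed
  then show ?thesis using True self_in_curve[OF t0 cub] by (auto simp: irred_def curve_through_def)
qed

end

lemma graph_slice_nonempty:
  assumes "t0 \<in> pts {S3}" "{X1, X2} \<subseteq> E" shows "graph_slice E t0 \<noteq> {}"
proof -
  have "graph (t0(X1 := 0, X2 := 0)) \<in> graph_slice E t0"
    using assms by (intro graph_slice_memI) (auto simp: pts_def vc_def)
  then show ?thesis by blast
qed

subsection \<open>The cubic relation and its gradient\<close>

text \<open>Leaving the parameters open covers both \<open>F\<close>, where they are variables, and
  \<open>F_at\<close>, where they are constants. The last part asks in addition that they be free of
  x_2 and x_3, so that the discriminant can be computed at chosen values of these.\<close>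

lemma cubic_lpoly:
  fixes s1 s2 s3 :: lpoly
  defines "G \<equiv> cubic (Var X1) (Var X2) (Var X3) s1 s2 s3"
  assumes XU: "{X1, X2, X3} \<subseteq> U" "X1 \<notin> V" and s: "s1 \<in> Pol (U - {X1}) V" "s2 \<in> Pol (U - {X1}) V" "s3 \<in> Pol (U - {X1}) V"
  shows cubic_lpoly_Pol: "G \<in> Pol U V"
    and cubic_lpoly_eval: "\<And>t. t \<in> pts V \<Longrightarrow> poly_eval t G =
      cubic (t X1) (t X2) (t X3) (poly_eval t s1) (poly_eval t s2) (poly_eval t s3)"
    and cubic_lpoly_vanish: "\<And>p. (\<exists>t\<in>pts V. poly_eval t s3 \<noteq> 0) \<Longrightarrow> X2 \<notin> V \<Longrightarrow> X3 \<notin> V \<Longrightarrow>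
      (\<And>t x. x \<in> {X2, X3} \<Longrightarrow> \<forall>s\<in>{s1,s2,s3}. \<forall>z. poly_eval (t(x := z)) s = poly_eval t s) \<Longrightarrow>
      p \<in> Pol U V \<Longrightarrow> (\<And>t. t \<in> pts V \<Longrightarrow> poly_eval t G = 0 \<Longrightarrow> poly_eval t p = 0) \<Longrightarrow>
      \<exists>g\<in>Pol U V. p = G * g"
proof -
  have sU: "q \<in> Pol U V" if "q \<in> Pol (U - {X1}) V" for q
    using that Pol_mono[of "U - {X1}" U V V] XU by auto
  show GP: "G \<in> Pol U V" unfolding G_def cubic_def using XU sU[OF s(1)] sU[OF s(2)] sU[OF s(3)] by auto
  have vars: "Var X1 \<in> Pol U V" "Var X2 \<in> Pol U V" "Var X3 \<in> Pol U V" using XU by auto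
  show "poly_eval t G = cubic (t X1) (t X2) (t X3) (poly_eval t s1) (poly_eval t s2) (poly_eval t s3)"
    if t: "t \<in> pts V" for t
    unfolding G_def cubic_def using vars sU[OF s(1)] sU[OF s(2)] sU[OF s(3)]
    by (simp add: poly_eval_mult[OF t, of _ U] poly_eval_power[OF t, of _ U])
  define \<beta> where "\<beta> = Var X2 * Var X3 - (s1 + s2 * s3)"
  define \<gamma> where "\<gamma> = Var X2 ^ 2 - (s2 + s1 * s3) * Var X2 - s3 * Var X3 + s3 ^ 2 + s1 * s2 * s3 + 1"
  have \<beta>\<gamma>: "\<beta> \<in> Pol (U - {X1}) V" "\<gamma> \<in> Pol (U - {X1}) V"
    using XU s by (auto simp: \<beta>_def \<gamma>_def)
  have vars': "Var X2 \<in> Pol (U - {X1}) V" "Var X3 \<in> Pol (U - {X1}) V" using XU by auto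
  have G: "G = Var X1 ^ 2 + \<beta> * Var X1 + \<gamma>"
    unfolding G_def cubic_def \<beta>_def \<gamma>_def by (simp add: algebra_simps)
  fix p assume s3: "\<exists>t\<in>pts V. poly_eval t s3 \<noteq> 0" and XV: "X2 \<notin> V" "X3 \<notin> V" and
    ind: "\<And>t x. x \<in> {X2, X3} \<Longrightarrow> \<forall>s\<in>{s1,s2,s3}. \<forall>z. poly_eval (t(x := z)) s = poly_eval t s"
    and p: "p \<in> Pol U V" "\<And>t. t \<in> pts V \<Longrightarrow> poly_eval t G = 0 \<Longrightarrow> poly_eval t p = 0"
  have "\<beta> ^ 2 - Const 4 * \<gamma> \<noteq> 0"
  proof
    assume 0: "\<beta> ^ 2 - Const 4 * \<gamma> = 0"
    obtain t where t: "t \<in> pts V" "poly_eval t s3 \<noteq> 0" using s3 by blast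
    \<comment> \<open>The discriminant at x_2 = 0 and x_3 = z is affine in z with slope 4 s_3, so it
      does not vanish both at z = 0 and at z = 1.\<close>
    have *: "(poly_eval t s1 + poly_eval t s2 * poly_eval t s3) ^ 2 - 4 *
        (- poly_eval t s3 * z + poly_eval t s3 ^ 2 + poly_eval t s1 * poly_eval t s2 * poly_eval t s3 + 1) = 0" for z
    proof -
      let ?t = "t(X2 := 0, X3 := z)"
      have t': "?t \<in> pts V" using t XV by (auto simp: pts_def)
      have e: "poly_eval ?t s = poly_eval t s" if "s \<in> {s1, s2, s3}" for s
        using ind[of X3 "t(X2 := 0)"] ind[of X2 t] that by auto
      have b: "poly_eval ?t \<beta> = - (poly_eval t s1 + poly_eval t s2 * poly_eval t s3)"
        unfolding \<beta>_def using s vars' e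
        by (simp add: poly_eval_mult[OF t', of _ "U - {X1}"] poly_eval_power[OF t', of _ "U - {X1}"])
      have c: "poly_eval ?t \<gamma> = - poly_eval t s3 * z + poly_eval t s3 ^ 2 + poly_eval t s1 * poly_eval t s2 * poly_eval t s3 + 1"
        unfolding \<gamma>_def using s vars' e
        by (simp add: poly_eval_mult[OF t', of _ "U - {X1}"] poly_eval_power[OF t', of _ "U - {X1}"])
      have "poly_eval ?t (\<beta> ^ 2 - Const 4 * \<gamma>) = 0" by (simp add: 0)
      then have "(poly_eval ?t \<beta>) ^ 2 - 4 * poly_eval ?t \<gamma> = 0"
        using \<beta>\<gamma> by (simp add: poly_eval_mult[OF t', of _ "U - {X1}"] poly_eval_power[OF t', of _ "U - {X1}"])
      then show ?thesis unfolding b c by (simp only: power2_minus)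
    qed
    show False using *[of 0] *[of 1] t(2) by (simp add: algebra_simps)
  qed
  then show "\<exists>g\<in>Pol U V. p = G * g"
    using XU by (intro vanishing_imp_multiple[OF _ XU(2) \<beta>\<gamma> G _ p]) auto
qed

section \<open>The relations of the quotient and of the fibres, and their gradients\<close>

lemma F_Pol: "F \<in> Pol vars6 {S3}"
  unfolding F_def by (rule cubic_lpoly_Pol) auto

lemma poly_eval_F: "t \<in> pts {S3} \<Longrightarrow> poly_eval t F = cubic_at t"
  unfolding F_def cubic_at_def by (subst cubic_lpoly_eval[where U = vars6 and V = "{S3}"]) auto

lemma F_vanish:
  assumes "p \<in> Pol vars6 {S3}" "\<And>t. t \<in> pts {S3} \<Longrightarrow> cubic_at t = 0 \<Longrightarrow> poly_eval t p = 0"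
  shows "\<exists>g\<in>Pol vars6 {S3}. p = F * g"
  unfolding F_def
proof (rule cubic_lpoly_vanish)
  show "\<exists>t\<in>pts {S3}. poly_eval t (Var S3) \<noteq> 0" by (intro bexI[of _ "\<lambda>_. 1"]) (auto simp: pts_def)
  fix t assume "t \<in> pts {S3}" "poly_eval t (cubic (Var X1) (Var X2) (Var X3) (Var S1) (Var S2) (Var S3)) = 0"
  then show "poly_eval t p = 0" using assms(2) poly_eval_F[unfolded F_def] by auto
qed (use assms in auto)

abbreviation vars3 :: "var set" where "vars3 \<equiv> {X1, X2, X3}"

lemma F_at_Pol: "F_at (\<sigma>1, \<sigma>2, \<sigma>3) \<in> Pol vars3 {}"
  unfolding F_at_def prod.case by (rule cubic_lpoly_Pol) auto

lemma pts_empty [simp]: "t \<in> pts {}"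
  by (simp add: pts_def)

lemma poly_eval_F_at: "poly_eval t (F_at (\<sigma>1, \<sigma>2, \<sigma>3)) = cubic (t X1) (t X2) (t X3) \<sigma>1 \<sigma>2 \<sigma>3"
  unfolding F_at_def prod.case by (subst cubic_lpoly_eval[where U = vars3 and V = "{}"]) auto

lemma F_at_vanish:
  assumes "\<sigma>3 \<noteq> 0" "p \<in> Pol vars3 {}" "\<And>t. cubic (t X1) (t X2) (t X3) \<sigma>1 \<sigma>2 \<sigma>3 = 0 \<Longrightarrow> poly_eval t p = 0"
  shows "\<exists>g\<in>Pol vars3 {}. p = F_at (\<sigma>1, \<sigma>2, \<sigma>3) * g"
  unfolding F_at_def prod.case
proof (rule cubic_lpoly_vanish)
  fix t assume "poly_eval t (cubic (Var X1) (Var X2) (Var X3) (Const \<sigma>1) (Const \<sigma>2) (Const \<sigma>3)) = 0"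
  then show "poly_eval t p = 0" using assms(3) poly_eval_F_at[unfolded F_at_def prod.case] by auto
qed (use assms in auto)

lemma has_pd_fun:
  assumes t: "t \<in> pts V" and f: "\<And>s. s \<in> pts V \<Longrightarrow> poly_eval s f = \<phi> s"
    and D: "((\<lambda>z. \<phi> (t(v := z))) has_field_derivative D) (at (t v))"
  shows "pd t v f = D"
proof (rule has_pd_imp_pd)
  have "\<forall>\<^sub>F z in nhds (t v). poly_eval (t(v := z)) f = \<phi> (t(v := z))"
    using eventually_upd_pts[OF t, of v] by (rule eventually_mono) (rule f)
  then show "has_pd t v f D" unfolding has_pd_def using D by (subst DERIV_cong_ev[OF refl _ refl])
qed

lemma pd_F:
  assumes t: "t \<in> pts {S3}"
  shows "pd t X1 F = t X2 * t X3 + 2 * t X1 - (t S1 + t S2 * t S3)"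
    "pd t X2 F = t X1 * t X3 + 2 * t X2 - (t S2 + t S1 * t S3)"
    "pd t X3 F = t X1 * t X2 - t S3"
    "pd t S1 F = - t X1 - t S3 * t X2 + t S2 * t S3"
    "pd t S2 F = - t S3 * t X1 - t X2 + t S1 * t S3"
    "pd t S3 F = - t S2 * t X1 - t S1 * t X2 - t X3 + 2 * t S3 + t S1 * t S2"
  subgoal
    apply (rule has_pd_fun[OF t poly_eval_F], assumption)
    apply (simp add: cubic_at_def cubic_def)
    apply (rule derivative_eq_intros refl)+
    apply (simp add: algebra_simps)
    done
  subgoal
    apply (rule has_pd_fun[OF t poly_eval_F], assumption)
    apply (simp add: cubic_at_def cubic_def)
    apply (rule derivative_eq_intros refl)+
    apply (simp add: algebra_simps)
    done
  subgoal
    apply (rule has_pd_fun[OF t poly_eval_F], assumption)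
    apply (simp add: cubic_at_def cubic_def)
    apply (rule derivative_eq_intros refl)+
    apply (simp add: algebra_simps)
    done
  subgoal
    apply (rule has_pd_fun[OF t poly_eval_F], assumption)
    apply (simp add: cubic_at_def cubic_def)
    apply (rule derivative_eq_intros refl)+
    apply (simp add: algebra_simps)
    done
  subgoal
    apply (rule has_pd_fun[OF t poly_eval_F], assumption)
    apply (simp add: cubic_at_def cubic_def)
    apply (rule derivative_eq_intros refl)+
    apply (simp add: algebra_simps)
    done
  subgoal
    apply (rule has_pd_fun[OF t poly_eval_F], assumption)
    apply (simp add: cubic_at_def cubic_def)
    apply (rule derivative_eq_intros refl)+
    apply (simp add: algebra_simps)
    done
  done

lemma pd_F_at:
  shows "pd t X1 (F_at (\<sigma>1, \<sigma>2, \<sigma>3)) = t X2 * t X3 + 2 * t X1 - (\<sigma>1 + \<sigma>2 * \<sigma>3)"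
    "pd t X2 (F_at (\<sigma>1, \<sigma>2, \<sigma>3)) = t X1 * t X3 + 2 * t X2 - (\<sigma>2 + \<sigma>1 * \<sigma>3)"
    "pd t X3 (F_at (\<sigma>1, \<sigma>2, \<sigma>3)) = t X1 * t X2 - \<sigma>3"
  subgoal
    apply (rule has_pd_fun[OF pts_empty poly_eval_F_at])
    apply (simp add: cubic_def)
    apply (rule derivative_eq_intros refl)+
    apply (simp add: algebra_simps)
    done
  subgoal
    apply (rule has_pd_fun[OF pts_empty poly_eval_F_at])
    apply (simp add: cubic_def)
    apply (rule derivative_eq_intros refl)+
    apply (simp add: algebra_simps)
    done
  subgoal
    apply (rule has_pd_fun[OF pts_empty poly_eval_F_at])
    apply (simp add: cubic_def)
    apply (rule derivative_eq_intros refl)+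
    apply (simp add: algebra_simps)
    done
  done

section \<open>The analytic data\<close>

lemma mat22_entry [simp]:
  "mat22 a b c d $ 1 $ 1 = a" "mat22 a b c d $ 1 $ 2 = b"
  "mat22 a b c d $ 2 $ 1 = c" "mat22 a b c d $ 2 $ 2 = d"
  by (simp_all add: mat22_def)

lemma mat22_eqI:
  fixes M N :: mat22
  assumes "M $ 1 $ 1 = N $ 1 $ 1" "M $ 1 $ 2 = N $ 1 $ 2" "M $ 2 $ 1 = N $ 2 $ 1" "M $ 2 $ 2 = N $ 2 $ 2"
  shows "M = N"
  using assms by (simp add: vec_eq_iff forall_2)

lemma mat22_collapse: "mat22 (M $ 1 $ 1) (M $ 1 $ 2) (M $ 2 $ 1) (M $ 2 $ 2) = M"
  by (rule mat22_eqI) simp_all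

lemma mat22_mult:
  "mat22 a b c d ** mat22 a' b' c' d' =
     mat22 (a * a' + b * c') (a * b' + b * d') (c * a' + d * c') (c * b' + d * d')"
  by (rule mat22_eqI) (simp_all add: matrix_matrix_mult_def sum_2)

lemma mat22_one: "mat 1 = mat22 1 0 0 1"
  by (rule mat22_eqI) (simp_all add: mat_def)

lemma det_mat22: "det (mat22 a b c d) = a * d - b * c"
  by (simp add: det_2)

lemma mat22_inject: "mat22 a b c d = mat22 a' b' c' d' \<longleftrightarrow> a = a' \<and> b = b' \<and> c = c' \<and> d = d'"
  by (metis mat22_entry)

text \<open>The third matrix is determined by the other two: it is the inverse of their product,
  written as the adjugate because the determinant is 1.\<close>

definition mk_data :: "complex \<Rightarrow> complex \<Rightarrow> complex \<Rightarrow> complex \<Rightarrow> complex \<Rightarrow> complex \<Rightarrow> complex \<Rightarrow> complex \<Rightarrow> triple" where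
  "mk_data a b c d a' b' c' d' = (mat22 a b c d, mat22 a' b' c' d',
     mat22 (c * b' + d * d') (- (a * b' + b * d')) (- (c * a' + d * c')) (a * a' + b * c'))"

text \<open>A matrix of determinant 1 has the prescribed triangular form as soon as its upper left
  entry is nonzero; f_1 and f_2 are read off from the lower left and the upper right entry.\<close>

lemma mk_data_mem:
  assumes "a * d - b * c = 1" "a' * d' - b' * c' = 1" "c * b' + d * d' \<noteq> 0"
  shows "mk_data a b c d a' b' c' d' \<in> analytic_data"
proof -
  define \<alpha> where "\<alpha> = c * b' + d * d'"
  define p q r where "p = a * b' + b * d'" and "q = c * a' + d * c'" and "r = a * a' + b * c'"
  have "r * \<alpha> - p * q = (a * d - b * c) * (a' * d' - b' * c')"
    by (simp add: \<alpha>_def p_def q_def r_def algebra_simps)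
  then have det: "r * \<alpha> - p * q = 1" using assms by simp
  have \<alpha>: "\<alpha> \<noteq> 0" using assms by (simp add: \<alpha>_def)
  have form: "mat22 \<alpha> (- p) (- q) r
      = mat22 \<alpha> 0 0 (inverse \<alpha>) ** mat22 1 0 (- (q * \<alpha>)) 1 ** mat22 1 (- (p / \<alpha>)) 0 1"
    using \<alpha> det by (simp add: mat22_mult mat22_inject field_simps)
  have prod: "mat22 a b c d ** mat22 a' b' c' d' ** mat22 \<alpha> (- p) (- q) r = mat 1"
  proof -
    have "mat22 a b c d ** mat22 a' b' c' d' = mat22 r p q \<alpha>"
      by (simp add: mat22_mult mat22_inject \<alpha>_def p_def q_def r_def)
    then show ?thesis using det by (simp add: mat22_mult mat22_one mat22_inject algebra_simps)
  qed
  have "det (mat22 \<alpha> (- p) (- q) r) = 1" using det by (simp add: det_mat22 algebra_simps)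
  then show ?thesis
    unfolding mk_data_def analytic_data_def \<alpha>_def[symmetric] p_def[symmetric] q_def[symmetric] r_def[symmetric]
    using assms prod form \<alpha> by (auto simp: det_mat22)
qed

lemma analytic_data_cases:
  assumes "P \<in> analytic_data"
  shows analytic_data_eq: "P = mk_data (a1 P) (b1 P) (c1 P) (d1 P) (a2 P) (b2 P) (c2 P) (d2 P)"
    and analytic_data_det: "a1 P * d1 P - b1 P * c1 P = 1" "a2 P * d2 P - b2 P * c2 P = 1"
    and analytic_data_alpha: "alpha P = b2 P * c1 P + d1 P * d2 P" "alpha P \<noteq> 0"
proof -
  obtain M1 M2 Mi where P: "P = (M1, M2, Mi)" by (cases P)
  obtain \<alpha> f1 f2 where M: "det M1 = 1" "det M2 = 1" "M1 ** M2 ** Mi = mat 1" "\<alpha> \<noteq> 0"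
    "Mi = mat22 \<alpha> 0 0 (inverse \<alpha>) ** mat22 1 0 f1 1 ** mat22 1 f2 0 1"
    using assms by (auto simp: P analytic_data_def)
  have M1: "M1 = mat22 (a1 P) (b1 P) (c1 P) (d1 P)" and M2: "M2 = mat22 (a2 P) (b2 P) (c2 P) (d2 P)"
    by (simp_all add: P a1_def b1_def c1_def d1_def a2_def b2_def c2_def d2_def mat22_collapse)
  show det: "a1 P * d1 P - b1 P * c1 P = 1" "a2 P * d2 P - b2 P * c2 P = 1"
    using M(1,2) unfolding M1 M2 det_mat22 by auto
  let ?N = "mat22 (c1 P * b2 P + d1 P * d2 P) (- (a1 P * b2 P + b1 P * d2 P))
    (- (c1 P * a2 P + d1 P * c2 P)) (a1 P * a2 P + b1 P * c2 P)"
  have dd: "(a1 P * a2 P + b1 P * c2 P) * (c1 P * b2 P + d1 P * d2 P)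
      - (a1 P * b2 P + b1 P * d2 P) * (c1 P * a2 P + d1 P * c2 P) = 1"
  proof -
    have "(a1 P * a2 P + b1 P * c2 P) * (c1 P * b2 P + d1 P * d2 P)
      - (a1 P * b2 P + b1 P * d2 P) * (c1 P * a2 P + d1 P * c2 P)
      = (a1 P * d1 P - b1 P * c1 P) * (a2 P * d2 P - b2 P * c2 P)" by (simp add: algebra_simps)
    then show ?thesis using det by simp
  qed
  have "?N ** (M1 ** M2) = mat 1"
    unfolding M1 M2 mat22_mult mat22_one mat22_inject using dd by (auto simp: algebra_simps)
  then have "Mi = (?N ** (M1 ** M2)) ** Mi" by simp
  also have "\<dots> = ?N ** (M1 ** M2 ** Mi)" by (simp only: matrix_mul_assoc)
  also have "\<dots> = ?N" by (simp only: M(3) matrix_mul_rid)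
  finally have "Mi = ?N" .
  then show "P = mk_data (a1 P) (b1 P) (c1 P) (d1 P) (a2 P) (b2 P) (c2 P) (d2 P)"
    unfolding mk_data_def by (simp only: P[symmetric] M1[symmetric] M2[symmetric]) (simp add: P)
  show "alpha P = b2 P * c1 P + d1 P * d2 P"
  proof -
    have "alpha P = Mi $ 1 $ 1" by (simp add: alpha_def P)
    also have "\<dots> = ?N $ 1 $ 1" by (rule arg_cong[OF \<open>Mi = ?N\<close>])
    finally show ?thesis by (simp add: algebra_simps)
  qed
  have "alpha P = Mi $ 1 $ 1" by (simp add: alpha_def P)
  also have "\<dots> = \<alpha>" unfolding M(5) mat22_mult by simp
  finally show "alpha P \<noteq> 0" using M(4) by simp
qed

lemma mk_data_entries [simp]:
  "a1 (mk_data a b c d a' b' c' d') = a" "b1 (mk_data a b c d a' b' c' d') = b"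
  "c1 (mk_data a b c d a' b' c' d') = c" "d1 (mk_data a b c d a' b' c' d') = d"
  "a2 (mk_data a b c d a' b' c' d') = a'" "b2 (mk_data a b c d a' b' c' d') = b'"
  "c2 (mk_data a b c d a' b' c' d') = c'" "d2 (mk_data a b c d a' b' c' d') = d'"
  "alpha (mk_data a b c d a' b' c' d') = b' * c + d * d'"
  by (simp_all add: mk_data_def a1_def b1_def c1_def d1_def a2_def b2_def c2_def d2_def alpha_def)

lemma act_mk_data:
  assumes "z \<noteq> 0"
  shows "act z (mk_data a b c d a' b' c' d') =
    mk_data a (z * b) (c / z) d a' (z * b') (c' / z) d'"
proof -
  have "matrix_inv (mat22 z 0 0 1) = mat22 (1 / z) 0 0 1"
  proof -
    have 1: "mat22 z 0 0 1 ** mat22 (1 / z) 0 0 1 = mat 1" "mat22 (1 / z) 0 0 1 ** mat22 z 0 0 1 = mat 1"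
      using assms by (simp_all add: mat22_mult mat22_one)
    then have "\<exists>N. mat22 z 0 0 1 ** N = mat 1 \<and> N ** mat22 z 0 0 1 = mat 1" by blast
    from someI_ex[OF this] have left: "matrix_inv (mat22 z 0 0 1) ** mat22 z 0 0 1 = mat 1"
      unfolding matrix_inv_def by blast
    have "matrix_inv (mat22 z 0 0 1) = matrix_inv (mat22 z 0 0 1) ** (mat22 z 0 0 1 ** mat22 (1 / z) 0 0 1)"
      by (simp add: 1)
    also have "\<dots> = (matrix_inv (mat22 z 0 0 1) ** mat22 z 0 0 1) ** mat22 (1 / z) 0 0 1"
      by (simp only: matrix_mul_assoc)
    also have "\<dots> = mat22 (1 / z) 0 0 1" by (simp add: left)
    finally show ?thesis .
  qed
  then show ?thesis
    using assms by (simp add: act_def mk_data_def mat22_mult mat22_inject field_simps)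
qed

lemma act_entries:
  assumes P: "P \<in> analytic_data" and z: "z \<noteq> 0"
  shows "act z P \<in> analytic_data" "a1 (act z P) = a1 P" "b1 (act z P) = z * b1 P" "c1 (act z P) = c1 P / z"
    "d1 (act z P) = d1 P" "a2 (act z P) = a2 P" "b2 (act z P) = z * b2 P" "c2 (act z P) = c2 P / z"
    "d2 (act z P) = d2 P"
proof -
  note P' = analytic_data_cases[OF P]
  have eq: "act z P = mk_data (a1 P) (z * b1 P) (c1 P / z) (d1 P) (a2 P) (z * b2 P) (c2 P / z) (d2 P)"
    by (subst P'(1)) (rule act_mk_data[OF z])
  show "act z P \<in> analytic_data"
    unfolding eq using P' z by (intro mk_data_mem) (auto simp: algebra_simps)
  show "a1 (act z P) = a1 P" "b1 (act z P) = z * b1 P" "c1 (act z P) = c1 P / z"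
    "d1 (act z P) = d1 P" "a2 (act z P) = a2 P" "b2 (act z P) = z * b2 P" "c2 (act z P) = c2 P / z"
    "d2 (act z P) = d2 P" by (simp_all add: eq)
qed

section \<open>Coordinates on the analytic data\<close>

abbreviation cd :: "triple \<Rightarrow> var \<Rightarrow> complex" where "cd P \<equiv> (\<lambda>v. coord v P)"

lemma trace_entries: "trace (fst P) = a1 P + d1 P" "trace (fst (snd P)) = a2 P + d2 P"
  by (simp_all add: trace_def sum_2 a1_def d1_def a2_def d2_def)

text \<open>The formula for x_3 simplifies to the trace of M_1 M_2, which is also the trace of the
  inverse M_infinity since the determinant is 1.\<close>

lemma coord_entries:
  "cd P X1 = d1 P" "cd P X2 = d2 P" "cd P S1 = a1 P + d1 P" "cd P S2 = a2 P + d2 P"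
  "P \<in> analytic_data \<Longrightarrow> cd P S3 = b2 P * c1 P + d1 P * d2 P"
  "P \<in> analytic_data \<Longrightarrow> cd P X3 = b1 P * c2 P + a1 P * a2 P + b2 P * c1 P + d1 P * d2 P"
  by (simp_all add: trace_entries analytic_data_alpha Let_def algebra_simps)

lemma coord_zero:
  assumes P: "P \<in> analytic_data" shows "cd P \<in> pts {S3}" "cubic_at (cd P) = 0"
proof -
  note P' = analytic_data_cases[OF P]
  show "cd P \<in> pts {S3}" using P' by (simp add: pts_def)
  have "cubic_at (cd P) = (a1 P * d1 P - 1) * (a2 P * d2 P - 1) - (b1 P * c1 P) * (b2 P * c2 P)"
    unfolding cubic_at_def coord_entries(1-4) coord_entries(5,6)[OF P]
    by (simp add: cubic_def algebra_simps power2_eq_square)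
  moreover have "a1 P * d1 P - 1 = b1 P * c1 P" "a2 P * d2 P - 1 = b2 P * c2 P"
    using P'(2,3) by (simp_all add: algebra_simps)
  ultimately show "cubic_at (cd P) = 0" by simp
qed

text \<open>\<open>uc\<close> is the invariant \<open>b\<^sub>1 c\<^sub>2\<close>. With \<open>p = a\<^sub>1 d\<^sub>1 - 1\<close> and \<open>q = a\<^sub>2 d\<^sub>2 - 1\<close>, the cubic is \<open>p * q - uc * vc\<close>.\<close>

definition uc :: "(var \<Rightarrow> complex) \<Rightarrow> complex" where
  "uc t = t X3 - t X1 * t X2 + t S2 * t X1 + t S1 * t X2 - t S1 * t S2 - t S3"

lemma cubic_at_uv:
  "cubic_at t = ((t S1 - t X1) * t X1 - 1) * ((t S2 - t X2) * t X2 - 1) - uc t * vc t"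
  by (simp add: cubic_at_def cubic_def uc_def vc_def algebra_simps power2_eq_square)

text \<open>Needed for the relations among the invariants: a polynomial that is zero on all analytic
  data vanishes on the whole hypersurface.\<close>

lemma coord_surj:
  assumes t: "t \<in> pts {S3}" "cubic_at t = 0"
  obtains P where "P \<in> analytic_data" "cd P = t"
proof -
  define p q u v where "p = (t S1 - t X1) * t X1 - 1" and "q = (t S2 - t X2) * t X2 - 1"
    and "u = uc t" and "v = vc t"
  have pq: "p * q = u * v" using t(2) by (simp add: cubic_at_uv p_def q_def u_def v_def)
  \<comment> \<open>The matrix with rows \<open>(p, u)\<close> and \<open>(v, q)\<close> is singular, hence a column \<open>(b, b')\<close> times a row \<open>(c, c')\<close>.\<close>
  have "\<exists>b c b' c'. b * c = p \<and> b' * c' = q \<and> b * c' = u \<and> b' * c = v"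
  proof (cases "p = 0")
    case False
    have "v * (u / p) = q" using pq False by (simp add: field_simps)
    then show ?thesis
      using False by (intro exI[of _ p] exI[of _ 1] exI[of _ v] exI[of _ "u / p"]) simp
  next
    case True
    then show ?thesis
    proof (cases "u = 0")
      case False
      then show ?thesis
        using True pq by (intro exI[of _ u] exI[of _ 0] exI[of _ q] exI[of _ 1]) auto
    next
      case u: True
      then show ?thesis
        using True by (intro exI[of _ 0] exI[of _ v] exI[of _ 1] exI[of _ q]) auto
    qed
  qed
  then obtain b c b' c' where bc: "b * c = p" "b' * c' = q" "b * c' = u" "b' * c = v" by blast
  define P where "P = mk_data (t S1 - t X1) b c (t X1) (t S2 - t X2) b' c' (t X2)"
  have al: "c * b' + t X1 * t X2 = t S3" using bc(4) by (simp add: v_def vc_def algebra_simps)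
  have P: "P \<in> analytic_data"
    unfolding P_def using t(1) al bc by (intro mk_data_mem) (auto simp: p_def q_def pts_def)
  have "cd P v = t v" for v
  proof (cases v)
    case X3
    have "cd P X3 = b * c' + (t S1 - t X1) * (t S2 - t X2) + b' * c + t X1 * t X2"
      using coord_entries(6)[OF P] by (simp add: P_def)
    also have "\<dots> = t X3" unfolding bc by (simp add: u_def uc_def v_def vc_def algebra_simps)
    finally show ?thesis by (simp only: X3)
  next
    case S3
    then show ?thesis using coord_entries(5)[OF P] al by (simp add: P_def algebra_simps)
  qed (use coord_entries(1-4)[of P] in \<open>auto simp: P_def\<close>)
  then show ?thesis using that[OF P] by blast
qed

section \<open>Invariant functions\<close>

lemma poly_eval_cd_mult:
  assumes "P \<in> analytic_data" "p \<in> Pol vars6 {S3}" "q \<in> Pol vars6 {S3}"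
  shows "poly_eval (cd P) (p * q) = poly_eval (cd P) p * poly_eval (cd P) q"
  using poly_eval_L6[OF coord_zero(1)[OF assms(1)] assms(2,3)] .

definition upoly :: lpoly where
  "upoly = Var X3 - Var X1 * Var X2 + Var S2 * Var X1 + Var S1 * Var X2 - Var S1 * Var S2 - Var S3"

definition ppoly :: lpoly where "ppoly = (Var S1 - Var X1) * Var X1 - 1"

definition qpoly :: lpoly where "qpoly = (Var S2 - Var X2) * Var X2 - 1"

lemma uvpq_Pol [intro, simp]:
  "upoly \<in> Pol vars6 {S3}" "ppoly \<in> Pol vars6 {S3}" "qpoly \<in> Pol vars6 {S3}"
  by (auto simp: upoly_def ppoly_def qpoly_def)

lemma poly_eval_uvpq:
  assumes t: "t \<in> pts {S3}"
  shows "poly_eval t upoly = uc t" "poly_eval t ppoly = (t S1 - t X1) * t X1 - 1"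
    "poly_eval t qpoly = (t S2 - t X2) * t X2 - 1"
  by (simp_all add: upoly_def uc_def ppoly_def qpoly_def poly_eval_L6[OF t])

lemma products_eq_poly_eval:
  assumes P: "P \<in> analytic_data"
  shows "b1 P * c1 P = poly_eval (cd P) ppoly" "b2 P * c2 P = poly_eval (cd P) qpoly"
    "b1 P * c2 P = poly_eval (cd P) upoly" "b2 P * c1 P = poly_eval (cd P) vpoly"
  unfolding poly_eval_uvpq[OF coord_zero(1)[OF P]] poly_eval_vpoly[OF coord_zero(1)[OF P]] uc_def vc_def
    coord_entries(1-4) coord_entries(5,6)[OF P]
  using analytic_data_det[OF P] by (simp_all add: algebra_simps)

text \<open>The torus acts on \<open>term_fun p i j k l\<close> with weight \<open>i + j - k - l\<close>.\<close>

definition term_fun :: "lpoly \<Rightarrow> nat \<Rightarrow> nat \<Rightarrow> nat \<Rightarrow> nat \<Rightarrow> triple \<Rightarrow> complex" where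
  "term_fun p i j k l P = poly_eval (cd P) p * b1 P ^ i * b2 P ^ j * c1 P ^ k * c2 P ^ l"

text \<open>Weight zero means as many factors b as factors c. One of each is split off at a time,
  and the four possible products are p, q, u and v.\<close>

lemma monomial_weight_zero:
  assumes "i + j = k + l"
  shows "\<exists>q\<in>Pol vars6 {S3}. \<forall>P\<in>analytic_data. b1 P ^ i * b2 P ^ j * c1 P ^ k * c2 P ^ l = poly_eval (cd P) q"
  using assms
proof (induction "i + j" arbitrary: i j k l)
  case 0
  then show ?case by (intro bexI[of _ 1]) auto
next
  case (Suc n)
  have step: "\<exists>q\<in>Pol vars6 {S3}. \<forall>P\<in>analytic_data. b1 P ^ i * b2 P ^ j * c1 P ^ k * c2 P ^ l = poly_eval (cd P) q"
    if "n = i' + j'" "i' + j' = k' + l'" "r \<in> Pol vars6 {S3}"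
      "\<And>P. P \<in> analytic_data \<Longrightarrow> b1 P ^ i * b2 P ^ j * c1 P ^ k * c2 P ^ l
        = poly_eval (cd P) r * (b1 P ^ i' * b2 P ^ j' * c1 P ^ k' * c2 P ^ l')" for i' j' k' l' r
  proof -
    obtain q where q: "q \<in> Pol vars6 {S3}"
      "\<forall>P\<in>analytic_data. b1 P ^ i' * b2 P ^ j' * c1 P ^ k' * c2 P ^ l' = poly_eval (cd P) q"
      using Suc.hyps(1)[OF \<open>n = i' + j'\<close> \<open>i' + j' = k' + l'\<close>] by blast
    show ?thesis
      using q that by (intro bexI[of _ "r * q"]) (auto simp: poly_eval_cd_mult)
  qed
  have "i > 0 \<or> j > 0" "k > 0 \<or> l > 0" using Suc by auto
  then consider i' k' where "i = Suc i'" "k = Suc k'" | i' l' where "i = Suc i'" "l = Suc l'"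
    | j' k' where "j = Suc j'" "k = Suc k'" | j' l' where "j = Suc j'" "l = Suc l'"
    by (metis gr0_implies_Suc)
  then show ?case
  proof cases
    case 1
    then show ?thesis
      using Suc by (intro step[of i' j k' l ppoly]) (auto simp: algebra_simps simp flip: products_eq_poly_eval)
  next
    case 2
    then show ?thesis
      using Suc by (intro step[of i' j k l' upoly]) (auto simp: algebra_simps simp flip: products_eq_poly_eval)
  next
    case 3
    then show ?thesis
      using Suc by (intro step[of i j' k' l vpoly]) (auto simp: algebra_simps simp flip: products_eq_poly_eval)
  next
    case 4
    then show ?thesis
      using Suc by (intro step[of i j' k l' qpoly]) (auto simp: algebra_simps simp flip: products_eq_poly_eval)
  qed
qed

text \<open>Combinations of monomials in the off-diagonal entries, with polynomials in the
  invariants as coefficients. Such an expression need not be unique, but each of its terms has a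
  weight.\<close>

inductive_set term_sums :: "(triple \<Rightarrow> complex) set" where
  single: "p \<in> Pol vars6 {S3} \<Longrightarrow> term_fun p i j k l \<in> term_sums"
| add: "f \<in> term_sums \<Longrightarrow> g \<in> term_sums \<Longrightarrow> (\<lambda>P. f P + g P) \<in> term_sums"

lemma term_sums_mult:
  assumes "f \<in> term_sums" "g \<in> term_sums"
  shows "\<exists>h\<in>term_sums. \<forall>P\<in>analytic_data. h P = f P * g P"
  using assms(1)
proof (induction f rule: term_sums.induct)
  case (single p i j k l)
  show ?case
    using assms(2)
  proof (induction g rule: term_sums.induct)
    case (single p' i' j' k' l')
    show ?case
      using \<open>p \<in> Pol vars6 {S3}\<close> single
      by (intro bexI[of _ "term_fun (p * p') (i + i') (j + j') (k + k') (l + l')"] term_sums.single)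
        (auto simp: term_fun_def poly_eval_cd_mult power_add)
  next
    case (add g g')
    then obtain h h' where "h \<in> term_sums" "h' \<in> term_sums"
      "\<forall>P\<in>analytic_data. h P = term_fun p i j k l P * g P"
      "\<forall>P\<in>analytic_data. h' P = term_fun p i j k l P * g' P" by blast
    then show ?case by (intro bexI[of _ "\<lambda>P. h P + h' P"] term_sums.add) (auto simp: algebra_simps)
  qed
next
  case (add f f')
  then obtain h h' where "h \<in> term_sums" "h' \<in> term_sums"
    "\<forall>P\<in>analytic_data. h P = f P * g P" "\<forall>P\<in>analytic_data. h' P = f' P * g P" by blast
  then show ?case by (intro bexI[of _ "\<lambda>P. h P + h' P"] term_sums.add) (auto simp: algebra_simps)
qed

text \<open>Diagonal entries are differences of coordinates, such as a_1 = s_1 - x_1, and the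
  entries of M_infinity are those of the adjugate of M_1 M_2.\<close>

lemma regular_fun_term_sum:
  assumes "f \<in> regular_funs"
  shows "\<exists>h\<in>term_sums. \<forall>P\<in>analytic_data. f P = h P"
  using assms
proof (induction f rule: regular_funs.induct)
  case (const c)
  show ?case by (intro bexI[of _ "term_fun (Const c) 0 0 0 0"] term_sums.single) (auto simp: term_fun_def)
next
  case (entry1 i j)
  consider "i = 1 \<and> j = 1" | "i = 1 \<and> j = 2" | "i = 2 \<and> j = 1" | "i = 2 \<and> j = 2"
    using exhaust_2 by metis
  then show ?case
  proof cases
    case 1
    then show ?thesis
      by (intro bexI[of _ "term_fun (Var S1 - Var X1) 0 0 0 0"] term_sums.single)
        (auto simp: term_fun_def trace_entries a1_def)
  next
    case 2
    then show ?thesis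
      by (intro bexI[of _ "term_fun 1 1 0 0 0"] term_sums.single) (auto simp: term_fun_def b1_def)
  next
    case 3
    then show ?thesis
      by (intro bexI[of _ "term_fun 1 0 0 1 0"] term_sums.single) (auto simp: term_fun_def c1_def)
  next
    case 4
    then show ?thesis
      by (intro bexI[of _ "term_fun (Var X1) 0 0 0 0"] term_sums.single) (auto simp: term_fun_def d1_def)
  qed
next
  case (entry2 i j)
  consider "i = 1 \<and> j = 1" | "i = 1 \<and> j = 2" | "i = 2 \<and> j = 1" | "i = 2 \<and> j = 2"
    using exhaust_2 by metis
  then show ?case
  proof cases
    case 1
    then show ?thesis
      by (intro bexI[of _ "term_fun (Var S2 - Var X2) 0 0 0 0"] term_sums.single)
        (auto simp: term_fun_def trace_entries a2_def)
  next
    case 2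
    then show ?thesis
      by (intro bexI[of _ "term_fun 1 0 1 0 0"] term_sums.single) (auto simp: term_fun_def b2_def)
  next
    case 3
    then show ?thesis
      by (intro bexI[of _ "term_fun 1 0 0 0 1"] term_sums.single) (auto simp: term_fun_def c2_def)
  next
    case 4
    then show ?thesis
      by (intro bexI[of _ "term_fun (Var X2) 0 0 0 0"] term_sums.single) (auto simp: term_fun_def d2_def)
  qed
next
  case (entry_inf i j)
  have Mi: "snd (snd P) = mat22 (c1 P * b2 P + d1 P * d2 P) (- (a1 P * b2 P + b1 P * d2 P))
    (- (c1 P * a2 P + d1 P * c2 P)) (a1 P * a2 P + b1 P * c2 P)" if "P \<in> analytic_data" for P
    using arg_cong[OF analytic_data_eq[OF that], of "\<lambda>P. snd (snd P)"] by (simp add: mk_data_def)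
  have coords: "d1 P = cd P X1" "d2 P = cd P X2" "a1 P = cd P S1 - cd P X1" "a2 P = cd P S2 - cd P X2" for P
    by (simp_all add: trace_entries)
  consider "i = 1 \<and> j = 1" | "i = 1 \<and> j = 2" | "i = 2 \<and> j = 1" | "i = 2 \<and> j = 2"
    using exhaust_2 by metis
  then show ?case
  proof cases
    case 1
    then show ?thesis
      by (intro bexI[of _ "term_fun (Var S3) 0 0 0 0"] term_sums.single) (auto simp: term_fun_def alpha_def)
  next
    case 2
    show ?thesis
      by (intro bexI[of _ "\<lambda>P. term_fun (Var X1 - Var S1) 0 1 0 0 P + term_fun (- Var X2) 1 0 0 0 P"]
            term_sums.single term_sums.add)
        (use 2 in \<open>auto simp: term_fun_def Mi trace_entries algebra_simps\<close>)
  next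
    case 3
    show ?thesis
      by (intro bexI[of _ "\<lambda>P. term_fun (Var X2 - Var S2) 0 0 1 0 P + term_fun (- Var X1) 0 0 0 1 P"]
            term_sums.single term_sums.add)
        (use 3 in \<open>auto simp: term_fun_def Mi trace_entries algebra_simps\<close>)
  next
    case 4
    show ?thesis
      by (intro bexI[of _ "\<lambda>P. term_fun ((Var S1 - Var X1) * (Var S2 - Var X2)) 0 0 0 0 P + term_fun 1 1 0 0 1 P"]
            term_sums.single term_sums.add)
        (use 4 in \<open>auto simp: term_fun_def Mi trace_entries poly_eval_cd_mult algebra_simps\<close>)
  qed
next
  case inverse_alpha
  show ?case
    by (intro bexI[of _ "term_fun (Var_inv S3) 0 0 0 0"] term_sums.single Pol_Var_inv) (auto simp: term_fun_def)
next
  case (add f g)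
  then obtain h h' where "h \<in> term_sums" "h' \<in> term_sums"
    "\<forall>P\<in>analytic_data. f P = h P" "\<forall>P\<in>analytic_data. g P = h' P" by blast
  then show ?case by (intro bexI[of _ "\<lambda>P. h P + h' P"] term_sums.add) auto
next
  case (mult f g)
  then obtain h h' where h: "h \<in> term_sums" "h' \<in> term_sums"
    "\<forall>P\<in>analytic_data. f P = h P" "\<forall>P\<in>analytic_data. g P = h' P" by blast
  from term_sums_mult[OF h(1,2)] obtain m where "m \<in> term_sums" "\<forall>P\<in>analytic_data. m P = h P * h' P"
    by blast
  with h show ?case by (intro bexI[of _ m]) simp_all
qed

lemma cd_act: "P \<in> analytic_data \<Longrightarrow> z \<noteq> 0 \<Longrightarrow> cd (act z P) = cd P"
proof
  fix v assume that: "P \<in> analytic_data" "z \<noteq> 0"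
  show "cd (act z P) v = cd P v"
    using coord_entries[of P] coord_entries[of "act z P"] act_entries[OF that] that
    by (cases v) (simp_all only: times_divide_eq_right times_divide_eq_left mult.assoc mult.left_commute[of _ z]
      nonzero_mult_div_cancel_left simp_thms not_False_eq_True)
qed

text \<open>Only the component of weight zero is asked to be a polynomial in the coordinates.
  Components with index outside \<open>S\<close> are zero, so that decompositions over different
  sets can be added.\<close>

lemma weight_decomposition:
  assumes "f \<in> term_sums"
  shows "\<exists>(S :: int set) \<phi>. finite S \<and> (\<forall>P\<in>analytic_data. f P = (\<Sum>n\<in>S. \<phi> n P)) \<and>
    (\<forall>n P z. P \<in> analytic_data \<longrightarrow> z \<noteq> 0 \<longrightarrow> \<phi> n (act z P) = z powi n * \<phi> n P) \<and>
    (\<forall>n. n \<notin> S \<longrightarrow> (\<forall>P. \<phi> n P = 0)) \<and>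
    (\<exists>p\<in>Pol vars6 {S3}. \<forall>P\<in>analytic_data. \<phi> 0 P = poly_eval (cd P) p)"
  using assms
proof (induction f rule: term_sums.induct)
  case (single p i j k l)
  define w where "w = int (i + j) - int (k + l)"
  define \<phi> where "\<phi> n P = (if n = w then term_fun p i j k l P else 0)" for n P
  have wt: "term_fun p i j k l (act z P) = z powi w * term_fun p i j k l P"
    if "P \<in> analytic_data" "z \<noteq> 0" for z P
  proof -
    have "z powi w = z ^ i * z ^ j / (z ^ k * z ^ l)"
      using that by (simp add: w_def power_int_diff power_add power_int_add)
    then show ?thesis
      using that by (simp add: term_fun_def act_entries cd_act power_mult_distrib power_divide)
  qed
  have zero: "\<exists>p\<in>Pol vars6 {S3}. \<forall>P\<in>analytic_data. \<phi> 0 P = poly_eval (cd P) p"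
  proof (cases "w = 0")
    case True
    then have "i + j = k + l" by (simp add: w_def)
    then obtain q where q: "q \<in> Pol vars6 {S3}"
      "\<forall>P\<in>analytic_data. b1 P ^ i * b2 P ^ j * c1 P ^ k * c2 P ^ l = poly_eval (cd P) q"
      using monomial_weight_zero by blast
    then show ?thesis
      using True single
      by (intro bexI[of _ "p * q"]) (auto simp: \<phi>_def term_fun_def poly_eval_cd_mult mult.assoc)
  next
    case False
    then show ?thesis by (intro bexI[of _ 0]) (auto simp: \<phi>_def)
  qed
  show ?case
    by (intro exI[of _ "{w}"] exI[of _ \<phi>] conjI zero) (auto simp: \<phi>_def wt)
next
  case (add f g)
  then obtain S \<phi> p T \<psi> q where
    1: "finite S" "\<forall>P\<in>analytic_data. f P = (\<Sum>n\<in>S. \<phi> n P)"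
    "\<forall>n P z. P \<in> analytic_data \<longrightarrow> z \<noteq> 0 \<longrightarrow> \<phi> n (act z P) = z powi n * \<phi> n P"
    "\<forall>n. n \<notin> S \<longrightarrow> (\<forall>P. \<phi> n P = 0)"
    "p \<in> Pol vars6 {S3}" "\<forall>P\<in>analytic_data. \<phi> (0::int) P = poly_eval (cd P) p" and
    2: "finite T" "\<forall>P\<in>analytic_data. g P = (\<Sum>n\<in>T. \<psi> n P)"
    "\<forall>n P z. P \<in> analytic_data \<longrightarrow> z \<noteq> 0 \<longrightarrow> \<psi> n (act z P) = z powi n * \<psi> n P"
    "\<forall>n. n \<notin> T \<longrightarrow> (\<forall>P. \<psi> n P = 0)"
    "q \<in> Pol vars6 {S3}" "\<forall>P\<in>analytic_data. \<psi> (0::int) P = poly_eval (cd P) q"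
    by (elim exE conjE bexE) blast
  have s: "(\<Sum>n\<in>S. \<phi> n P) = (\<Sum>n\<in>S \<union> T. \<phi> n P)" "(\<Sum>n\<in>T. \<psi> n P) = (\<Sum>n\<in>S \<union> T. \<psi> n P)" for P
    using 1(1,4) 2(1,4) by (intro sum.mono_neutral_left; blast)+
  show ?case
  proof (intro exI[of _ "S \<union> T"] exI[of _ "\<lambda>n P. \<phi> n P + \<psi> n P"] conjI)
    show "\<forall>P\<in>analytic_data. f P + g P = (\<Sum>n\<in>S \<union> T. \<phi> n P + \<psi> n P)"
      using 1 2 by (simp add: s sum.distrib)
    show "\<exists>p\<in>Pol vars6 {S3}. \<forall>P\<in>analytic_data. \<phi> 0 P + \<psi> 0 P = poly_eval (cd P) p"
      using 1 2 by (intro bexI[of _ "p + q"]) auto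
  qed (use 1 2 in \<open>auto simp: algebra_simps\<close>)
qed

text \<open>Invariance makes the sum of \<open>\<phi> n P * z powi n\<close> independent of z, and
  independence of the characters \<open>z powi n\<close> leaves only weight zero. This takes the
  place of averaging over the torus.\<close>

lemma invariant_poly:
  assumes "f \<in> carrier quot_ring"
  shows "\<exists>p\<in>Pol vars6 {S3}. \<forall>P\<in>analytic_data. f P = poly_eval (cd P) p"
proof -
  have f: "f \<in> regular_funs" "\<And>c P. c \<noteq> 0 \<Longrightarrow> P \<in> analytic_data \<Longrightarrow> f (act c P) = f P"
    using assms by (auto simp: quot_ring_def)
  obtain h where h: "h \<in> term_sums" "\<And>P. P \<in> analytic_data \<Longrightarrow> f P = h P"
    using regular_fun_term_sum[OF f(1)] by blast
  obtain S \<phi> p where S: "finite S" "\<forall>P\<in>analytic_data. h P = (\<Sum>n\<in>S. \<phi> n P)"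
    "\<forall>n P z. P \<in> analytic_data \<longrightarrow> z \<noteq> 0 \<longrightarrow> \<phi> n (act z P) = z powi n * \<phi> n P"
    "\<forall>n. n \<notin> S \<longrightarrow> (\<forall>P. \<phi> n P = 0)"
    "p \<in> Pol vars6 {S3}" "\<forall>P\<in>analytic_data. \<phi> (0::int) P = poly_eval (cd P) p"
    using weight_decomposition[OF h(1)] by (elim exE conjE bexE) blast
  have "f P = poly_eval (cd P) p" if P: "P \<in> analytic_data" for P
  proof -
    \<comment> \<open>Weight 0 is adjoined so that the constant \<open>f P\<close> becomes the
      coefficient of a character in the family.\<close>
    let ?T = "insert 0 S"
    have "\<forall>n\<in>?T. \<phi> n P - (if n = 0 then f P else 0) = 0"
    proof (rule characters_independent[where G = "{z::complex. z \<noteq> 0}" and tm = "(*)" and ch = "\<lambda>n z. z powi n"])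
      fix z :: complex assume "z \<in> {z. z \<noteq> 0}"
      then have z: "z \<noteq> 0" by simp
      have "f P = h (act z P)" using f(2)[OF z P] h(2)[OF act_entries(1)[OF P z]] by simp
      also have "\<dots> = (\<Sum>n\<in>S. \<phi> n (act z P))" using S(2) act_entries(1)[OF P z] by blast
      also have "\<dots> = (\<Sum>n\<in>S. \<phi> n P * z powi n)"
        using S(3)[rule_format, OF P z] by (intro sum.cong refl) (simp only: mult.commute)
      also have "\<dots> = (\<Sum>n\<in>?T. \<phi> n P * z powi n)"
      proof (intro sum.mono_neutral_left ballI)
        fix n assume "n \<in> ?T - S"
        then have "\<phi> n P = 0" using S(4) by blast
        then show "\<phi> n P * z powi n = 0" by simp
      qed (use S(1) in auto)
      finally have "(\<Sum>n\<in>?T. \<phi> n P * z powi n) = f P" by simp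
      moreover have "(\<Sum>n\<in>?T. (if n = 0 then f P else 0) * z powi n) = f P"
        using S(1) by (subst sum.mono_neutral_right[of _ "{0}"]) auto
      ultimately show "(\<Sum>n\<in>?T. (\<phi> n P - (if n = 0 then f P else 0)) * z powi n) = 0"
        by (simp only: left_diff_distrib sum_subtractf diff_self)
    next
      show "\<exists>x\<in>{z::complex. z \<noteq> 0}. x powi i \<noteq> x powi j" if "i \<noteq> j" for i j
        using that two_powi_inject by (intro bexI[of _ 2]) auto
      show "\<exists>x\<in>{z::complex. z \<noteq> 0}. x powi i \<noteq> 0" for i
        by (intro bexI[of _ 1]) auto
    qed (use S(1) in \<open>auto simp: power_int_mult_distrib\<close>)
    then show ?thesis using S(6) P by simp
  qed
  then show ?thesis using S(5) by blast
qed

section \<open>The ring of invariants as the quotient by the cubic\<close>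

definition h6 :: "lpoly \<Rightarrow> triple \<Rightarrow> complex" where
  "h6 p = (\<lambda>P\<in>analytic_data. poly_eval (cd P) p)"

lemma regular_funs_extensional: "f \<in> regular_funs \<Longrightarrow> f \<in> extensional analytic_data"
  by (induction rule: regular_funs.induct) (rule restrict_extensional)+

lemma quot_ring_simps:
  "f \<otimes>\<^bsub>quot_ring\<^esub> g = (\<lambda>P\<in>analytic_data. f P * g P)" "\<one>\<^bsub>quot_ring\<^esub> = (\<lambda>P\<in>analytic_data. 1)"
  "f \<oplus>\<^bsub>quot_ring\<^esub> g = (\<lambda>P\<in>analytic_data. f P + g P)" "\<zero>\<^bsub>quot_ring\<^esub> = (\<lambda>P\<in>analytic_data. 0)"
  by (simp_all add: quot_ring_def)

lemma coord_fun_regular: "(\<lambda>P\<in>analytic_data. cd P v) \<in> regular_funs"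
proof -
  let ?R = "\<lambda>f. (\<lambda>P\<in>analytic_data. f P) \<in> regular_funs"
  have add: "?R (\<lambda>P. f P + g P)" if "?R f" "?R g" for f g
  proof -
    have "(\<lambda>P\<in>analytic_data. (\<lambda>P\<in>analytic_data. f P) P + (\<lambda>P\<in>analytic_data. g P) P) \<in> regular_funs"
      using that by (rule regular_funs.add)
    then show ?thesis by (simp cong: restrict_cong)
  qed
  have mult: "?R (\<lambda>P. f P * g P)" if "?R f" "?R g" for f g
  proof -
    have "(\<lambda>P\<in>analytic_data. (\<lambda>P\<in>analytic_data. f P) P * (\<lambda>P\<in>analytic_data. g P) P) \<in> regular_funs"
      using that by (rule regular_funs.mult)
    then show ?thesis by (simp cong: restrict_cong)
  qed
  have e: "?R a1" "?R b1" "?R c1" "?R d1" "?R a2" "?R b2" "?R c2" "?R d2"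
    unfolding a1_def b1_def c1_def d1_def a2_def b2_def c2_def d2_def
    by (rule regular_funs.entry1 regular_funs.entry2)+
  have 3: "(\<lambda>P\<in>analytic_data. cd P X3)
      = (\<lambda>P\<in>analytic_data. b1 P * c2 P + a1 P * a2 P + b2 P * c1 P + d1 P * d2 P)"
    by (rule restrict_ext) (rule coord_entries)
  have 6: "(\<lambda>P\<in>analytic_data. cd P S3) = (\<lambda>P\<in>analytic_data. b2 P * c1 P + d1 P * d2 P)"
    by (rule restrict_ext) (rule coord_entries)
  show ?thesis
  proof (cases v)
    case X3
    show ?thesis unfolding X3 3 by (intro add mult e)
  next
    case S3
    show ?thesis unfolding S3 6 by (intro add mult e)
  qed (use e add in \<open>auto simp: trace_entries\<close>)
qed

lemma h6_regular: "p \<in> Pol vars6 {S3} \<Longrightarrow> h6 p \<in> regular_funs"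
proof (induction p rule: Pol_induct)
  case (const c)
  then show ?case using regular_funs.const[of c] by (simp only: h6_def poly_eval_Const)
next
  case (var v)
  then show ?case using coord_fun_regular[of v] by (simp only: h6_def poly_eval_Var)
next
  case (inv v)
  then have "v = S3" by simp
  then show ?case using regular_funs.inverse_alpha by (simp only: h6_def poly_eval_Var_inv coord.simps)
next
  case (add p q)
  then have "(\<lambda>P\<in>analytic_data. h6 p P + h6 q P) \<in> regular_funs" by (intro regular_funs.add)
  moreover have "h6 (p + q) = (\<lambda>P\<in>analytic_data. h6 p P + h6 q P)"
    unfolding h6_def by (intro restrict_ext) simp
  ultimately show ?case by (simp only:)
next
  case (mult p q)
  then have "(\<lambda>P\<in>analytic_data. h6 p P * h6 q P) \<in> regular_funs" by (intro regular_funs.mult)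
  moreover have "h6 (p * q) = (\<lambda>P\<in>analytic_data. h6 p P * h6 q P)"
    unfolding h6_def using mult(1,2) by (intro restrict_ext) (simp add: poly_eval_cd_mult)
  ultimately show ?case by (simp only:)
qed

lemma h6_closed: "p \<in> Pol vars6 {S3} \<Longrightarrow> h6 p \<in> carrier quot_ring"
  using h6_regular[of p] by (simp add: quot_ring_def h6_def cd_act act_entries(1))

lemma quot_ring_cases:
  assumes "f \<in> carrier quot_ring" obtains p where "p \<in> Pol vars6 {S3}" "f = h6 p"
proof -
  obtain p where p: "p \<in> Pol vars6 {S3}" "\<And>P. P \<in> analytic_data \<Longrightarrow> f P = poly_eval (cd P) p"
    using invariant_poly[OF assms] by blast
  have "f \<in> extensional analytic_data"
    using assms regular_funs_extensional by (auto simp: quot_ring_def)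
  then have "f = h6 p" using p(2) by (intro extensionalityI[of f analytic_data]) (auto simp: h6_def)
  with p(1) show ?thesis by (rule that)
qed

lemma h6_mult: "p \<in> Pol vars6 {S3} \<Longrightarrow> q \<in> Pol vars6 {S3} \<Longrightarrow> h6 (p * q) = h6 p \<otimes>\<^bsub>quot_ring\<^esub> h6 q"
  unfolding quot_ring_simps h6_def by (rule restrict_ext) (simp add: poly_eval_cd_mult)

lemma h6_add: "h6 (p + q) = h6 p \<oplus>\<^bsub>quot_ring\<^esub> h6 q"
  unfolding quot_ring_simps h6_def by (rule restrict_ext) simp

lemma h6_0: "h6 0 = \<zero>\<^bsub>quot_ring\<^esub>" and h6_1: "h6 1 = \<one>\<^bsub>quot_ring\<^esub>"
  unfolding quot_ring_simps h6_def by simp_all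

lemma quot_ring_cring: "cring quot_ring"
proof (rule cringI)
  show "abelian_group quot_ring"
  proof (rule abelian_groupI)
    fix x y z assume "x \<in> carrier quot_ring" "y \<in> carrier quot_ring" "z \<in> carrier quot_ring"
    then obtain p q r where pq: "p \<in> Pol vars6 {S3}" "x = h6 p" "q \<in> Pol vars6 {S3}" "y = h6 q"
      "r \<in> Pol vars6 {S3}" "z = h6 r" by (metis quot_ring_cases)
    then show "x \<oplus>\<^bsub>quot_ring\<^esub> y \<in> carrier quot_ring" using h6_closed[of "p + q"] by (simp add: h6_add)
    show "x \<oplus>\<^bsub>quot_ring\<^esub> y \<oplus>\<^bsub>quot_ring\<^esub> z = x \<oplus>\<^bsub>quot_ring\<^esub> (y \<oplus>\<^bsub>quot_ring\<^esub> z)"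
      by (simp add: pq add.assoc flip: h6_add)
    show "x \<oplus>\<^bsub>quot_ring\<^esub> y = y \<oplus>\<^bsub>quot_ring\<^esub> x"
      by (simp add: pq add.commute flip: h6_add)
  next
    show "\<zero>\<^bsub>quot_ring\<^esub> \<in> carrier quot_ring" using h6_closed[of 0] by (simp add: h6_0)
  next
    fix x assume "x \<in> carrier quot_ring"
    then obtain p where p: "p \<in> Pol vars6 {S3}" "x = h6 p" by (metis quot_ring_cases)
    show "\<zero>\<^bsub>quot_ring\<^esub> \<oplus>\<^bsub>quot_ring\<^esub> x = x" by (simp add: p flip: h6_add h6_0)
    show "\<exists>y\<in>carrier quot_ring. y \<oplus>\<^bsub>quot_ring\<^esub> x = \<zero>\<^bsub>quot_ring\<^esub>"
      using p h6_closed[of "- p"] by (intro bexI[of _ "h6 (- p)"]) (auto simp flip: h6_add h6_0)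
  qed
  show "comm_monoid quot_ring"
  proof (rule comm_monoidI)
    fix x y z assume "x \<in> carrier quot_ring" "y \<in> carrier quot_ring" "z \<in> carrier quot_ring"
    then obtain p q r where pq: "p \<in> Pol vars6 {S3}" "x = h6 p" "q \<in> Pol vars6 {S3}" "y = h6 q"
      "r \<in> Pol vars6 {S3}" "z = h6 r" by (metis quot_ring_cases)
    then show "x \<otimes>\<^bsub>quot_ring\<^esub> y \<in> carrier quot_ring" using h6_closed[of "p * q"] by (simp add: h6_mult)
    show "x \<otimes>\<^bsub>quot_ring\<^esub> y \<otimes>\<^bsub>quot_ring\<^esub> z = x \<otimes>\<^bsub>quot_ring\<^esub> (y \<otimes>\<^bsub>quot_ring\<^esub> z)"
      using pq by (simp add: mult.assoc flip: h6_mult)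
    show "x \<otimes>\<^bsub>quot_ring\<^esub> y = y \<otimes>\<^bsub>quot_ring\<^esub> x"
      using pq by (simp add: mult.commute flip: h6_mult)
  next
    show "\<one>\<^bsub>quot_ring\<^esub> \<in> carrier quot_ring" using h6_closed[of 1] by (simp add: h6_1)
  next
    fix x assume "x \<in> carrier quot_ring"
    then obtain p where p: "p \<in> Pol vars6 {S3}" "x = h6 p" by (metis quot_ring_cases)
    then show "\<one>\<^bsub>quot_ring\<^esub> \<otimes>\<^bsub>quot_ring\<^esub> x = x" by (simp flip: h6_mult h6_1)
  qed
  fix x y z assume "x \<in> carrier quot_ring" "y \<in> carrier quot_ring" "z \<in> carrier quot_ring"
  then obtain p q r where pq: "p \<in> Pol vars6 {S3}" "x = h6 p" "q \<in> Pol vars6 {S3}" "y = h6 q"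
    "r \<in> Pol vars6 {S3}" "z = h6 r" by (metis quot_ring_cases)
  then show "(x \<oplus>\<^bsub>quot_ring\<^esub> y) \<otimes>\<^bsub>quot_ring\<^esub> z = x \<otimes>\<^bsub>quot_ring\<^esub> z \<oplus>\<^bsub>quot_ring\<^esub> y \<otimes>\<^bsub>quot_ring\<^esub> z"
    by (simp add: distrib_right flip: h6_mult h6_add)
qed

lemma h6_eq_iff: "h6 p = h6 q \<longleftrightarrow> (\<forall>P\<in>analytic_data. poly_eval (cd P) p = poly_eval (cd P) q)"
proof
  assume eq: "h6 p = h6 q"
  show "\<forall>P\<in>analytic_data. poly_eval (cd P) p = poly_eval (cd P) q"
  proof
    fix P assume "P \<in> analytic_data"
    then show "poly_eval (cd P) p = poly_eval (cd P) q" using fun_cong[OF eq, of P] by (simp add: h6_def)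
  qed
qed (auto simp: h6_def intro!: restrict_ext)

lemma poly_eval_F_cd: "P \<in> analytic_data \<Longrightarrow> poly_eval (cd P) F = 0"
  by (simp add: poly_eval_F coord_zero)

interpretation Q: hypersurface vars6 "{S3}" F quot_ring quot_const h6
proof (rule hypersurface.intro)
  show "vars6 \<inter> {S3} = {}" by auto
  show "cring quot_ring" by (rule quot_ring_cring)
  show "F \<in> Pol vars6 {S3}" by (rule F_Pol)
  have "poly_eval (\<lambda>_. 1) F = 1"
    by (subst poly_eval_F) (auto simp: pts_def cubic_at_def cubic_def)
  then show "F \<noteq> 0" by auto
  show "h6 \<in> ring_hom (poly_ring vars6 {S3}) quot_ring"
    by (rule ring_hom_memI) (auto simp: h6_closed h6_mult h6_add h6_1)
  show "h6 ` Pol vars6 {S3} = carrier quot_ring"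
    using h6_closed by (auto elim: quot_ring_cases)
  show "h6 p = \<zero>\<^bsub>quot_ring\<^esub> \<longleftrightarrow> (\<exists>g\<in>Pol vars6 {S3}. p = F * g)" if p: "p \<in> Pol vars6 {S3}" for p
  proof
    assume "h6 p = \<zero>\<^bsub>quot_ring\<^esub>"
    then have *: "poly_eval (cd P) p = 0" if "P \<in> analytic_data" for P
      using that unfolding h6_0[symmetric] h6_eq_iff by simp
    show "\<exists>g\<in>Pol vars6 {S3}. p = F * g"
    proof (rule F_vanish[OF p])
      fix t assume "t \<in> pts {S3}" "cubic_at t = 0"
      then obtain P where P: "P \<in> analytic_data" "cd P = t" by (rule coord_surj)
      show "poly_eval t p = 0" using *[OF P(1)] by (simp only: P(2))
    qed
  next
    assume "\<exists>g\<in>Pol vars6 {S3}. p = F * g"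
    then show "h6 p = \<zero>\<^bsub>quot_ring\<^esub>"
      unfolding h6_0[symmetric] h6_eq_iff by (auto simp: poly_eval_cd_mult F_Pol poly_eval_F_cd)
  qed
  show "h6 (Const c) = quot_const c" for c by (simp add: h6_def quot_const_def)
qed

section \<open>Points and singular locus of the quotient\<close>

lemma Q_zeros: "t \<in> Q.zeros \<longleftrightarrow> t \<in> pts {S3} \<and> cubic_at t = 0"
  by (auto simp: Q.zeros_def poly_eval_F)

lemma quot_map_point: "P \<in> analytic_data \<Longrightarrow> quot_map P = Q.point (cd P)"
proof (rule extensionalityI[of _ "carrier quot_ring"])
  assume P: "P \<in> analytic_data"
  fix f assume f: "f \<in> carrier quot_ring"
  then obtain p where p: "p \<in> Pol vars6 {S3}" "f = h6 p" by (metis quot_ring_cases)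
  have "Q.point (cd P) f = poly_eval (cd P) p"
    unfolding p(2) using p P coord_zero by (intro Q.point_h) (auto simp: Q_zeros)
  then show "quot_map P f = Q.point (cd P) f" using f p P by (simp add: quot_map_def h6_def)
qed (auto simp: quot_map_def Q.point_def)

text \<open>The parameters are frozen before the x_i, in the order s_3, s_2, s_1. What remains is
  surface, curve and point in the fibre through t; six sets give five inclusions.\<close>

lemma Q_height:
  assumes t: "t \<in> Q.zeros" shows "ideal_height quot_ring (point_ideal quot_ring (Q.point t)) = enat 5"
proof -
  have tp: "t \<in> pts {S3}" "cubic_at t = 0" using t by (auto simp: Q_zeros)
  interpret sub_ring6 vars6 "{S3}" by standard auto
  define Z where "Z i = (if i = 0 then graph_slice {S3, S2, S1, X1, X2} t else if i = 1 then graph_slice {S2, S1, X1, X2} t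
    else if i = 2 then graph_slice {S1, X1, X2} t else if i = 3 then graph_slice {X1, X2} t
    else if i = 4 then curve_through t else {t})" for i :: nat
  show ?thesis
  proof (rule Q.ideal_height_eq[OF t, of 5 Z])
    fix i :: nat assume "i \<le> 5"
    show "Z i \<subseteq> Q.zeros"
      using graph_slice_zero[OF tp(1)] curve_zero[OF tp] t by (auto simp: Z_def Q_zeros)
    show "Q.irred (Z i)"
      unfolding Z_def using Q.irred_graph_slice[OF order_refl tp(1)] Q.irred_curve[OF order_refl tp]
        graph_slice_nonempty[OF tp(1)] Q.irred_singleton by auto
  next
    fix i :: nat assume "i < 5"
    then consider "i = 0" | "i = 1" | "i = 2" | "i = 3" | "i = 4" by linarith
    then show "van_ideal vars6 {S3} (Z i) \<subset> van_ideal vars6 {S3} (Z (Suc i))"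
    proof cases
      case 1
      then show ?thesis using chain_parameter[OF tp(1), of "{S2, S1, X1, X2}" S3] by (simp add: Z_def)
    next
      case 2
      then show ?thesis using chain_parameter[OF tp(1), of "{S1, X1, X2}" S2] by (simp add: Z_def)
    next
      case 3
      then show ?thesis using chain_parameter[OF tp(1), of "{X1, X2}" S1] by (simp add: Z_def)
    next
      case 4
      then show ?thesis using chain_surface_curve[OF tp] by (simp add: Z_def)
    next
      case 5
      then show ?thesis using chain_curve_point[OF tp] by (simp add: Z_def)
    qed
  qed (auto simp: Z_def)
qed

text \<open>The derivative in x_3 is -v. Once v = 0, the derivative in s_3 is -u, and those in s_1
  and s_2 are x_1 q and x_2 p, where x_1 and x_2 are nonzero because their product is s_3. The
  derivatives in x_1 and x_2 vanish as a consequence.\<close>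

lemma gradient_zero_iff:
  assumes "t \<in> pts {S3}" "cubic_at t = 0"
  shows "(\<forall>v\<in>vars6 \<union> {S3}. pd t v F = 0) \<longleftrightarrow>
    uc t = 0 \<and> vc t = 0 \<and> (t S1 - t X1) * t X1 = 1 \<and> (t S2 - t X2) * t X2 = 1"
proof
  assume 0: "\<forall>v\<in>vars6 \<union> {S3}. pd t v F = 0"
  have S3: "t S3 \<noteq> 0" using assms by (auto simp: pts_def)
  have e: "t X1 * t X2 - t S3 = 0" "- t X1 - t S3 * t X2 + t S2 * t S3 = 0" "- t S3 * t X1 - t X2 + t S1 * t S3 = 0"
    "- t S2 * t X1 - t S1 * t X2 - t X3 + 2 * t S3 + t S1 * t S2 = 0"
    using 0 pd_F[OF assms(1)] by auto
  have v: "t S3 = t X1 * t X2" using e(1) by simp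
  have "uc t = 0" using e(4) by (simp add: uc_def v algebra_simps)
  moreover have "vc t = 0" using v by (simp add: vc_def)
  moreover have "t X1 * ((t S2 - t X2) * t X2 - 1) = 0" "t X2 * ((t S1 - t X1) * t X1 - 1) = 0"
    using e(2,3) by (simp_all add: v algebra_simps)
  moreover have "t X1 \<noteq> 0" "t X2 \<noteq> 0" using S3 v by auto
  ultimately show "uc t = 0 \<and> vc t = 0 \<and> (t S1 - t X1) * t X1 = 1 \<and> (t S2 - t X2) * t X2 = 1"
    by auto
next
  assume a: "uc t = 0 \<and> vc t = 0 \<and> (t S1 - t X1) * t X1 = 1 \<and> (t S2 - t X2) * t X2 = 1"
  define a1' a2' where "a1' = t S1 - t X1" and "a2' = t S2 - t X2"
  have S: "t S1 = a1' + t X1" "t S2 = a2' + t X2" by (simp_all add: a1'_def a2'_def)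
  have v: "t S3 = t X1 * t X2" using a by (simp add: vc_def)
  have x3: "t X3 = a1' * a2' + t X1 * t X2" using a by (simp add: uc_def S v algebra_simps)
  have r: "a1' * t X1 = 1" "a2' * t X2 = 1" using a by (simp_all add: a1'_def a2'_def)
  have nz: "t X1 \<noteq> 0" "t X2 \<noteq> 0" using r by auto
  have r': "a1' = 1 / t X1" "a2' = 1 / t X2" using r nz by (simp_all add: field_simps)
  have "t X2 * t X3 + 2 * t X1 - (t S1 + t S2 * t S3) = 0"
    "t X1 * t X3 + 2 * t X2 - (t S2 + t S1 * t S3) = 0"
    "t X1 * t X2 - t S3 = 0" "- t X1 - t S3 * t X2 + t S2 * t S3 = 0" "- t S3 * t X1 - t X2 + t S1 * t S3 = 0"
    "- t S2 * t X1 - t S1 * t X2 - t X3 + 2 * t S3 + t S1 * t S2 = 0"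
    unfolding S v x3 r' using nz by (simp_all add: field_simps power2_eq_square)
  then show "\<forall>v\<in>vars6 \<union> {S3}. pd t v F = 0" using pd_F[OF assms(1)] by auto
qed

lemma singular_quot_iff:
  assumes t: "t \<in> Q.zeros"
  shows "Q.point t \<in> singular_locus quot_ring quot_const \<longleftrightarrow>
    uc t = 0 \<and> vc t = 0 \<and> (t S1 - t X1) * t X1 = 1 \<and> (t S2 - t X2) * t X2 = 1"
proof -
  have "regular_point quot_ring quot_const (Q.point t) \<longleftrightarrow> (\<exists>v\<in>vars6 \<union> {S3}. pd t v F \<noteq> 0)"
    by (rule Q.regular_point_iff[OF t _ Q_height[OF t]]) simp
  then show ?thesis
    using gradient_zero_iff[of t] t Q.point_mem[OF t] by (auto simp: singular_locus_def Q_zeros)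
qed

lemma singular_locus_equations:
  "singular_locus quot_ring quot_const =
        {\<xi> \<in> alg_points quot_ring quot_const.
           \<xi> (\<lambda>P\<in>analytic_data. b1 P * c2 P) = 0 \<and>
           \<xi> (\<lambda>P\<in>analytic_data. b2 P * c1 P) = 0 \<and>
           \<xi> (\<lambda>P\<in>analytic_data. a1 P * d1 P - 1) = 0 \<and>
           \<xi> (\<lambda>P\<in>analytic_data. a2 P * d2 P - 1) = 0}" (is "_ = ?S")
proof -
  have h: "(\<lambda>P\<in>analytic_data. b1 P * c2 P) = h6 upoly" "(\<lambda>P\<in>analytic_data. b2 P * c1 P) = h6 vpoly"
    unfolding h6_def by (rule restrict_ext, simp only: products_eq_poly_eval)+
  have h': "(\<lambda>P\<in>analytic_data. a1 P * d1 P - 1) = h6 ppoly"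
    "(\<lambda>P\<in>analytic_data. a2 P * d2 P - 1) = h6 qpoly"
    unfolding h6_def by (rule restrict_ext, simp add: poly_eval_uvpq[OF coord_zero(1)] trace_entries)+
  have "\<xi> \<in> singular_locus quot_ring quot_const \<longleftrightarrow> \<xi> \<in> ?S" if \<xi>: "\<xi> \<in> alg_points quot_ring quot_const" for \<xi>
  proof -
    obtain t where t: "t \<in> Q.zeros" "\<xi> = Q.point t" using Q.alg_points_cases[OF \<xi>] by metis
    have tp: "t \<in> pts {S3}" using t by (simp add: Q_zeros)
    show ?thesis
      using \<xi> t unfolding h h' by (simp add: singular_quot_iff Q.point_h poly_eval_uvpq[OF tp] poly_eval_vpoly[OF tp])
  qed
  then show ?thesis by (auto simp: singular_locus_def)
qed

text \<open>If b = 0 or c = 0, all four products b_i c_j vanish. Conversely a singular point is the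
  image of a pair of diagonal matrices, for which b and c are both zero.\<close>

lemma singular_locus_reducible:
  "singular_locus quot_ring quot_const =
        quot_map ` {P \<in> analytic_data. (b1 P = 0 \<and> b2 P = 0) \<or> (c1 P = 0 \<and> c2 P = 0)}" (is "_ = quot_map ` ?R")
proof
  show "quot_map ` ?R \<subseteq> singular_locus quot_ring quot_const"
  proof
    fix \<xi> assume "\<xi> \<in> quot_map ` ?R"
    then obtain P where P: "P \<in> analytic_data" "(b1 P = 0 \<and> b2 P = 0) \<or> (c1 P = 0 \<and> c2 P = 0)" "\<xi> = quot_map P"
      by blast
    have z: "cd P \<in> Q.zeros" using coord_zero[OF P(1)] by (simp add: Q_zeros)
    have "uc (cd P) = b1 P * c2 P" "vc (cd P) = b2 P * c1 P"
      "(cd P S1 - cd P X1) * cd P X1 - 1 = b1 P * c1 P" "(cd P S2 - cd P X2) * cd P X2 - 1 = b2 P * c2 P"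
      using products_eq_poly_eval[OF P(1)] poly_eval_uvpq[OF coord_zero(1)[OF P(1)]]
        poly_eval_vpoly[OF coord_zero(1)[OF P(1)]] by simp_all
    then show "\<xi> \<in> singular_locus quot_ring quot_const"
      unfolding P(3) quot_map_point[OF P(1)] singular_quot_iff[OF z] using P(2) by auto
  qed
  show "singular_locus quot_ring quot_const \<subseteq> quot_map ` ?R"
  proof
    fix \<xi> assume s: "\<xi> \<in> singular_locus quot_ring quot_const"
    then have "\<xi> \<in> alg_points quot_ring quot_const" by (simp add: singular_locus_def)
    then obtain t where t: "t \<in> Q.zeros" "\<xi> = Q.point t" using Q.alg_points_cases by metis
    then have e: "uc t = 0" "vc t = 0" "(t S1 - t X1) * t X1 = 1" "(t S2 - t X2) * t X2 = 1"
      using s singular_quot_iff by auto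
    have S3: "t S3 = t X1 * t X2" "t S3 \<noteq> 0" using t e by (auto simp: vc_def Q_zeros pts_def)
    define P where "P = mk_data (t S1 - t X1) 0 0 (t X1) (t S2 - t X2) 0 0 (t X2)"
    have P: "P \<in> analytic_data" unfolding P_def using e S3 by (intro mk_data_mem) auto
    have "cd P v = t v" for v
    proof (cases v)
      case X3
      have "cd P X3 = (t S1 - t X1) * (t S2 - t X2) + t X1 * t X2"
        unfolding coord_entries(6)[OF P] by (simp add: P_def)
      also have "\<dots> = t X3 - uc t" unfolding uc_def S3(1) by (simp add: algebra_simps)
      also have "\<dots> = t X3" by (simp add: e)
      finally have "cd P X3 = t X3" .
      then show ?thesis by (simp only: X3)
    next
      case S3': S3
      have "cd P S3 = t S3" unfolding coord_entries(5)[OF P] S3(1) by (simp add: P_def)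
      then show ?thesis by (simp only: S3')
    qed (use coord_entries(1-4)[of P] in \<open>auto simp: P_def\<close>)
    then have "cd P = t" by blast
    then have "\<xi> = quot_map P" using quot_map_point[OF P] t by simp
    then show "\<xi> \<in> quot_map ` ?R" using P by (auto simp: P_def)
  qed
qed

section \<open>The presentation as an isomorphism of rings\<close>

context hypersurface
begin

lemma factor_iso:
  "\<exists>\<phi> \<in> ring_iso (poly_ring U V Quot genideal (poly_ring U V) {F}) A.
     \<forall>p \<in> Pol U V. \<phi> (genideal (poly_ring U V) {F} +>\<^bsub>poly_ring U V\<^esub> p) = h p"
proof -
  interpret L: cring "poly_ring U V" by (rule poly_ring_cring)
  interpret A: cring A by (rule A_cring)
  interpret H: ring_hom_ring "poly_ring U V" A h
    by (intro ring_hom_ringI2 L.ring_axioms A.ring_axioms h_hom)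
  have "genideal (poly_ring U V) {F} = cgenideal (poly_ring U V) F"
    using L.cgenideal_eq_genideal[OF F_Pol] by simp
  also have "\<dots> = a_kernel (poly_ring U V) A h"
    unfolding a_kernel_def' cgenideal_def using h_ker F_Pol by (auto simp: mult.commute)
  finally have ker: "genideal (poly_ring U V) {F} = a_kernel (poly_ring U V) A h" .
  show ?thesis
    unfolding ker
    by (rule bexI[of _ "\<lambda>X. the_elem (h ` X)"]) (use h_surj in \<open>auto intro!: H.FactRing_iso_set\<close>)
qed

end

subsection \<open>The fibres\<close>

lemma complex_cring: "cring (type_ring (UNIV :: complex set))"
proof (rule cringI)
  show "abelian_group (type_ring (UNIV :: complex set))"
  proof (rule abelian_groupI)
    fix x assume "x \<in> carrier (type_ring (UNIV :: complex set))"
    show "\<exists>y\<in>carrier (type_ring (UNIV :: complex set)). y \<oplus>\<^bsub>type_ring UNIV\<^esub> x = \<zero>\<^bsub>type_ring UNIV\<^esub>"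
      by (intro bexI[of _ "- x"]) auto
  qed (auto simp: algebra_simps)
  show "comm_monoid (type_ring (UNIV :: complex set))"
    by (rule comm_monoidI) (auto simp: algebra_simps)
qed (auto simp: algebra_simps)

lemma coord_fun_h6: "coord_fun v = h6 (Var v)"
  by (simp add: coord_fun_def h6_def)

locale cubic_fibre =
  fixes \<sigma>1 \<sigma>2 \<sigma>3 :: complex
  assumes \<sigma>3: "\<sigma>3 \<noteq> 0"
begin

abbreviation "\<sigma> \<equiv> (\<sigma>1, \<sigma>2, \<sigma>3)"
abbreviation "I \<equiv> fibre_ideal \<sigma>"

lemma fibre_ideal_eq:
  "I = genideal quot_ring {h6 (Var S1 - Const \<sigma>1), h6 (Var S2 - Const \<sigma>2), h6 (Var S3 - Const \<sigma>3)}"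
  by (simp add: fibre_ideal_def coord_fun_h6 Q.h_diff Q.h_Const)

lemma gens_carrier:
  "{h6 (Var S1 - Const \<sigma>1), h6 (Var S2 - Const \<sigma>2), h6 (Var S3 - Const \<sigma>3)} \<subseteq> carrier quot_ring"
  by (auto intro!: h6_closed)

lemma fibre_ideal: "ideal I quot_ring"
proof -
  interpret A: cring quot_ring by (rule quot_ring_cring)
  show ?thesis unfolding fibre_ideal_eq by (rule A.genideal_ideal[OF gens_carrier])
qed

lemma gens_mem: "h6 (Var S1 - Const \<sigma>1) \<in> I" "h6 (Var S2 - Const \<sigma>2) \<in> I" "h6 (Var S3 - Const \<sigma>3) \<in> I"
proof -
  interpret A: cring quot_ring by (rule quot_ring_cring)
  show "h6 (Var S1 - Const \<sigma>1) \<in> I" "h6 (Var S2 - Const \<sigma>2) \<in> I" "h6 (Var S3 - Const \<sigma>3) \<in> I"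
    unfolding fibre_ideal_eq using A.genideal_self[OF gens_carrier] by blast+
qed

text \<open>Evaluation at a point over the parameters kills the three generators of the fibre ideal,
  hence the whole ideal.\<close>

lemma fibre_ideal_vanish:
  assumes p: "p \<in> Pol vars6 {S3}" "h6 p \<in> I" and t: "t \<in> pts {S3}" "cubic_at t = 0"
    and s: "t S1 = \<sigma>1" "t S2 = \<sigma>2" "t S3 = \<sigma>3"
  shows "poly_eval t p = 0"
proof -
  interpret A: cring quot_ring by (rule quot_ring_cring)
  interpret C: cring "type_ring (UNIV :: complex set)" by (rule complex_cring)
  have tz: "t \<in> Q.zeros" using t by (simp add: Q_zeros)
  interpret H: ring_hom_ring quot_ring "type_ring UNIV" "Q.point t"
    using Q.point_mem[OF tz] by (intro ring_hom_ringI2 A.ring_axioms C.ring_axioms) (simp add: alg_points_def)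
  have "I \<subseteq> a_kernel quot_ring (type_ring UNIV) (Q.point t)"
    unfolding fibre_ideal_eq
  proof (rule A.genideal_minimal[OF H.kernel_is_ideal])
    show "{h6 (Var S1 - Const \<sigma>1), h6 (Var S2 - Const \<sigma>2), h6 (Var S3 - Const \<sigma>3)}
      \<subseteq> a_kernel quot_ring (type_ring UNIV) (Q.point t)"
      unfolding a_kernel_def' using s tz by (auto simp: Q.point_h h6_closed)
  qed
  then have "Q.point t (h6 p) = 0" using p(2) unfolding a_kernel_def' by auto
  then show ?thesis using p tz by (simp add: Q.point_h)
qed

text \<open>Congruence modulo the fibre ideal, for polynomials. Substituting the parameters for the
  variables s_i is carried out by its congruence rules.\<close>

definition spec_eq :: "lpoly \<Rightarrow> lpoly \<Rightarrow> bool" where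
  "spec_eq p q \<longleftrightarrow> p \<in> Pol vars6 {S3} \<and> q \<in> Pol vars6 {S3} \<and> h6 (p - q) \<in> I"

lemma I_add: "h6 p \<in> I \<Longrightarrow> h6 q \<in> I \<Longrightarrow> h6 (p + q) \<in> I"
  using additive_subgroup.a_closed[OF ideal.axioms(1)[OF fibre_ideal]] by (simp add: h6_add)

lemma I_mult: "h6 p \<in> I \<Longrightarrow> p \<in> Pol vars6 {S3} \<Longrightarrow> q \<in> Pol vars6 {S3} \<Longrightarrow> h6 (q * p) \<in> I"
  using ideal.I_l_closed[OF fibre_ideal] by (simp add: h6_mult h6_closed)

lemma I_0: "h6 0 \<in> I"
  using additive_subgroup.zero_closed[OF ideal.axioms(1)[OF fibre_ideal]] by (simp add: h6_0)

lemma spec_refl: "p \<in> Pol vars6 {S3} \<Longrightarrow> spec_eq p p"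
  by (simp add: spec_eq_def I_0)

lemma spec_add: "spec_eq p q \<Longrightarrow> spec_eq p' q' \<Longrightarrow> spec_eq (p + p') (q + q')"
  using I_add[of "p - q" "p' - q'"] by (simp add: spec_eq_def algebra_simps)

lemma spec_mult:
  assumes "spec_eq p q" "spec_eq p' q'" shows "spec_eq (p * p') (q * q')"
proof -
  have "h6 (p * (p' - q') + q' * (p - q)) \<in> I"
    using assms by (intro I_add I_mult) (auto simp: spec_eq_def)
  moreover have "p * (p' - q') + q' * (p - q) = p * p' - q * q'" by (simp add: algebra_simps)
  ultimately show ?thesis using assms by (simp add: spec_eq_def)
qed

lemma spec_diff:
  assumes "spec_eq p q" "spec_eq p' q'" shows "spec_eq (p - p') (q - q')"
proof -
  have "spec_eq (p + (Const (-1)) * p') (q + Const (-1) * q')"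
    using assms by (intro spec_add spec_mult spec_refl) auto
  then show ?thesis by (simp add: Const_uminus)
qed

lemma spec_param: "spec_eq (Var S1) (Const \<sigma>1)" "spec_eq (Var S2) (Const \<sigma>2)" "spec_eq (Var S3) (Const \<sigma>3)"
  using gens_mem by (auto simp: spec_eq_def)

lemma Pol3_sub: "Pol vars3 {} \<subseteq> Pol vars6 {S3}"
  by (rule Pol_mono) auto

lemma spec_exists:
  assumes "p \<in> Pol vars6 {S3}" shows "\<exists>q\<in>Pol vars3 {}. spec_eq p q"
  using assms
proof (induction p rule: Pol_induct)
  case (const c)
  show ?case by (intro bexI[of _ "Const c"] spec_refl) auto
next
  case (var v)
  then consider "v \<in> vars3" | "v = S1" | "v = S2" | "v = S3" by blast
  then show ?case
  proof cases
    case 1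
    then show ?thesis by (intro bexI[of _ "Var v"] spec_refl) auto
  next
    case 2
    then show ?thesis using spec_param by (intro bexI[of _ "Const \<sigma>1"]) auto
  next
    case 3
    then show ?thesis using spec_param by (intro bexI[of _ "Const \<sigma>2"]) auto
  next
    case 4
    then show ?thesis using spec_param by (intro bexI[of _ "Const \<sigma>3"]) auto
  qed
next
  case (inv v)
  then have v: "v = S3" by simp
  have vi: "Var_inv S3 \<in> Pol vars6 {S3}" by (rule Pol_Var_inv) auto
  define i where "i = Const (inverse \<sigma>3)"
  have c: "i * Const \<sigma>3 = 1" using \<sigma>3 by (simp add: i_def flip: Const_mult)
  \<comment> \<open>1/s_3 - 1/\<open>\<sigma>3\<close> is a multiple of s_3 -
    \<open>\<sigma>3\<close>, so the inverse variable becomes a constant as well.\<close>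
  have "h6 ((- i * Var_inv S3) * (Var S3 - Const \<sigma>3)) \<in> I"
    using gens_mem vi by (intro I_mult) (auto simp: i_def)
  moreover have "(- i * Var_inv S3) * (Var S3 - Const \<sigma>3) = Var_inv S3 - i"
  proof -
    have "(- i * Var_inv S3) * (Var S3 - Const \<sigma>3)
        = (i * Const \<sigma>3) * Var_inv S3 - i * (Var_inv S3 * Var S3)" by (simp add: algebra_simps del: Var_inv_mult)
    then show ?thesis by (simp add: c)
  qed
  ultimately have "spec_eq (Var_inv v) i" using vi by (simp add: spec_eq_def v i_def)
  then show ?case by (intro bexI[of _ i]) (auto simp: i_def)
next
  case (add p p')
  then show ?case using spec_add by (meson Pol_add)
next
  case (mult p p')
  then show ?case using spec_mult by (meson Pol_mult)
qed

lemma spec_F: "spec_eq F (F_at \<sigma>)"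
  unfolding F_def F_at_def cubic_def prod.case power2_eq_square
  by (intro spec_add spec_diff spec_mult spec_param spec_refl) auto

lemma h6_F_at: "h6 (F_at \<sigma>) \<in> I"
proof -
  have FP: "F \<in> Pol vars6 {S3}" "F_at \<sigma> \<in> Pol vars6 {S3}" using spec_F by (auto simp: spec_eq_def)
  have "h6 F \<in> I" using Q.h_ker[OF FP(1)] I_0 by (auto simp: h6_0 intro: bexI[of _ 1])
  moreover have "h6 (Const (-1) * (F - F_at \<sigma>)) \<in> I"
    using spec_F by (intro I_mult) (auto simp: spec_eq_def)
  ultimately have "h6 (F + Const (-1) * (F - F_at \<sigma>)) \<in> I" by (rule I_add)
  then show ?thesis by (simp add: Const_uminus)
qed

definition h3 :: "lpoly \<Rightarrow> (triple \<Rightarrow> complex) set" where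
  "h3 p = fibre_class \<sigma> (h6 p)"

lemma h3_zero_iff: "p \<in> Pol vars6 {S3} \<Longrightarrow> h3 p = \<zero>\<^bsub>fibre_ring \<sigma>\<^esub> \<longleftrightarrow> h6 p \<in> I"
proof -
  assume p: "p \<in> Pol vars6 {S3}"
  interpret A: cring quot_ring by (rule quot_ring_cring)
  have sg: "subgroup I (add_monoid quot_ring)"
    by (rule additive_subgroup.a_subgroup[OF ideal.axioms(1)[OF fibre_ideal]])
  show ?thesis
    unfolding h3_def fibre_class_def fibre_ring_def FactRing_def
    using A.a_coset_join1[OF _ h6_closed[OF p] sg] A.a_coset_join2[OF h6_closed[OF p] sg] by auto
qed

lemma h3_hom6: "h3 \<in> ring_hom (poly_ring vars6 {S3}) (fibre_ring \<sigma>)"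
proof -
  have "(+>\<^bsub>quot_ring\<^esub>) I \<in> ring_hom quot_ring (quot_ring Quot I)"
    using ideal.rcos_ring_hom[OF fibre_ideal] .
  from ring_hom_trans[OF Q.h_hom this] show ?thesis
    unfolding h3_def[abs_def] fibre_class_def fibre_ring_def comp_def .
qed

lemma h3_eq_iff:
  assumes "p \<in> Pol vars6 {S3}" "q \<in> Pol vars6 {S3}" "spec_eq p q" shows "h3 p = h3 q"
proof -
  interpret A: cring quot_ring by (rule quot_ring_cring)
  interpret B: cring "fibre_ring \<sigma>"
    unfolding fibre_ring_def by (rule ideal.quotient_is_cring[OF fibre_ideal quot_ring_cring])
  have c: "h3 r \<in> carrier (fibre_ring \<sigma>)" if "r \<in> Pol vars6 {S3}" for r
    using ring_hom_closed[OF h3_hom6] that by simp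
  have "h3 (p - q) = \<zero>\<^bsub>fibre_ring \<sigma>\<^esub>" using assms by (subst h3_zero_iff) (auto simp: spec_eq_def)
  moreover have "h3 ((p - q) + q) = h3 (p - q) \<oplus>\<^bsub>fibre_ring \<sigma>\<^esub> h3 q"
    using ring_hom_add[OF h3_hom6, of "p - q" q] assms by simp
  ultimately show ?thesis using c[OF assms(2)] by simp
qed

text \<open>A polynomial in three variables that lies in the fibre ideal vanishes on the cubic
  surface and is therefore a multiple of \<open>F_at \<sigma>\<close>. Conversely \<open>F\<close>
  is zero in the quotient and congruent to \<open>F_at \<sigma>\<close>. In particular the
  scheme-theoretic fibre is reduced.\<close>

lemma F_at_presents: "hypersurface vars3 {} (F_at \<sigma>) (fibre_ring \<sigma>) (\<lambda>c. fibre_class \<sigma> (quot_const c)) h3"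
proof (rule hypersurface.intro)
  show "vars3 \<inter> {} = {}" by simp
  show "cring (fibre_ring \<sigma>)"
    unfolding fibre_ring_def by (rule ideal.quotient_is_cring[OF fibre_ideal quot_ring_cring])
  show "F_at \<sigma> \<in> Pol vars3 {}" by (rule F_at_Pol)
  \<comment> \<open>At x_1 = x_2 = 0 this value of x_3 cancels every term of the cubic except the
    constant 1.\<close>
  define t :: "var \<Rightarrow> complex" where "t = (\<lambda>_. 0)(X3 := (\<sigma>3^2 + \<sigma>1 * \<sigma>2 * \<sigma>3) / \<sigma>3)"
  have "poly_eval t (F_at \<sigma>) = 1"
    using \<sigma>3 by (simp add: poly_eval_F_at t_def cubic_def)
  then show "F_at \<sigma> \<noteq> 0" by auto
  show "h3 \<in> ring_hom (poly_ring vars3 {}) (fibre_ring \<sigma>)"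
  proof (rule ring_hom_memI)
    fix p q assume "p \<in> Pol vars3 {}" "q \<in> Pol vars3 {}"
    then have pq: "p \<in> Pol vars6 {S3}" "q \<in> Pol vars6 {S3}" using Pol3_sub by auto
    then show "h3 p \<in> carrier (fibre_ring \<sigma>)"
      "h3 (p \<otimes>\<^bsub>poly_ring vars3 {}\<^esub> q) = h3 p \<otimes>\<^bsub>fibre_ring \<sigma>\<^esub> h3 q"
      "h3 (p \<oplus>\<^bsub>poly_ring vars3 {}\<^esub> q) = h3 p \<oplus>\<^bsub>fibre_ring \<sigma>\<^esub> h3 q"
      using ring_hom_closed[OF h3_hom6, of p] ring_hom_mult[OF h3_hom6, of p q]
        ring_hom_add[OF h3_hom6, of p q] by simp_all
  qed (use ring_hom_one[OF h3_hom6] in simp)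
  show "h3 ` Pol vars3 {} = carrier (fibre_ring \<sigma>)"
  proof
    show "h3 ` Pol vars3 {} \<subseteq> carrier (fibre_ring \<sigma>)"
    proof
      fix X assume "X \<in> h3 ` Pol vars3 {}"
      then obtain q where q: "q \<in> Pol vars3 {}" "X = h3 q" by blast
      then have "q \<in> Pol vars6 {S3}" using Pol3_sub by blast
      then show "X \<in> carrier (fibre_ring \<sigma>)" unfolding q(2) by (rule ring_hom_closed[OF h3_hom6])
    qed
    show "carrier (fibre_ring \<sigma>) \<subseteq> h3 ` Pol vars3 {}"
    proof
      fix X assume "X \<in> carrier (fibre_ring \<sigma>)"
      then obtain f where f: "f \<in> carrier quot_ring" "X = fibre_class \<sigma> f"
        unfolding fibre_ring_def FactRing_def fibre_class_def by (auto simp: A_RCOSETS_def')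
      then obtain p where p: "p \<in> Pol vars6 {S3}" "f = h6 p" by (metis quot_ring_cases)
      then obtain q where q: "q \<in> Pol vars3 {}" "spec_eq p q" using spec_exists by blast
      then have "X = h3 q" using h3_eq_iff[OF p(1) _ q(2)] Pol3_sub f p by (auto simp: h3_def)
      then show "X \<in> h3 ` Pol vars3 {}" using q by blast
    qed
  qed
  show "h3 p = \<zero>\<^bsub>fibre_ring \<sigma>\<^esub> \<longleftrightarrow> (\<exists>g\<in>Pol vars3 {}. p = F_at \<sigma> * g)" if p: "p \<in> Pol vars3 {}" for p
  proof -
    have p6: "p \<in> Pol vars6 {S3}" using p Pol3_sub by blast
    show ?thesis
      unfolding h3_zero_iff[OF p6]
    proof
      assume I: "h6 p \<in> I"
      show "\<exists>g\<in>Pol vars3 {}. p = F_at \<sigma> * g"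
      proof (rule F_at_vanish[OF \<sigma>3 p])
        fix t :: "var \<Rightarrow> complex" assume t: "cubic (t X1) (t X2) (t X3) \<sigma>1 \<sigma>2 \<sigma>3 = 0"
        define s where "s = t(S1 := \<sigma>1, S2 := \<sigma>2, S3 := \<sigma>3)"
        have "poly_eval s p = 0"
          using p6 I by (rule fibre_ideal_vanish) (use \<sigma>3 t in \<open>auto simp: s_def pts_def cubic_at_def\<close>)
        moreover have "poly_eval s p = poly_eval t p"
          by (rule poly_eval_cong[OF p]) (auto simp: s_def)
        ultimately show "poly_eval t p = 0" by simp
      qed
    next
      assume "\<exists>g\<in>Pol vars3 {}. p = F_at \<sigma> * g"
      then obtain g where g: "g \<in> Pol vars3 {}" "p = g * F_at \<sigma>" by (auto simp: mult.commute)
      have "F_at \<sigma> \<in> Pol vars6 {S3}" using spec_F by (simp add: spec_eq_def)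
      then show "h6 p \<in> I" unfolding g(2) using h6_F_at g(1) Pol3_sub by (intro I_mult) auto
    qed
  qed
  show "h3 (Const c) = fibre_class \<sigma> (quot_const c)" for c by (simp add: h3_def Q.h_Const)
qed

sublocale Fb: hypersurface vars3 "{}" "F_at \<sigma>" "fibre_ring \<sigma>" "\<lambda>c. fibre_class \<sigma> (quot_const c)" h3
  by (rule F_at_presents)

text \<open>The ring of the fibre sees only x_1, x_2, x_3, while the sets of the chain need all six
  coordinates; this condition fixes the other three.\<close>

definition over :: "(var \<Rightarrow> complex) \<Rightarrow> bool" where
  "over t \<longleftrightarrow> t S1 = \<sigma>1 \<and> t S2 = \<sigma>2 \<and> t S3 = \<sigma>3"

lemma over_pts: "over t \<Longrightarrow> t \<in> pts {S3}"
  using \<sigma>3 by (simp add: over_def pts_def)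

lemma Fb_zeros: "over t \<Longrightarrow> t \<in> Fb.zeros \<longleftrightarrow> cubic_at t = 0"
  by (auto simp: Fb.zeros_def poly_eval_F_at cubic_at_def over_def)

lemma Fb_height:
  assumes o: "over t" and cub: "cubic_at t = 0"
  shows "ideal_height (fibre_ring \<sigma>) (point_ideal (fibre_ring \<sigma>) (Fb.point t)) = enat 2"
proof -
  note tp = over_pts[OF o]
  interpret S: sub_ring6 vars3 "{}" by standard (use Pol3_sub in auto)
  define Z where "Z i = (if i = 0 then graph_slice {X1, X2} t else if i = 1 then curve_through t else {t})" for i :: nat
  have over: "over s \<and> cubic_at s = 0" if "s \<in> Z i" for s i
  proof -
    have "s \<in> graph_slice {X1, X2} t \<Longrightarrow> s S1 = t S1 \<and> s S2 = t S2 \<and> s S3 = t S3 \<and> cubic_at s = 0"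
      using graph_slice_fixed[of s "{X1, X2}" t] graph_slice_zero[OF tp, of s] by simp
    moreover have "s \<in> curve_through t \<Longrightarrow> s S1 = t S1 \<and> s S2 = t S2 \<and> s S3 = t S3 \<and> cubic_at s = 0"
      using curve_zero[OF tp cub, of s] by simp
    ultimately show ?thesis using that o cub by (auto simp: Z_def over_def split: if_splits)
  qed
  show ?thesis
  proof (rule Fb.ideal_height_eq[of t 2 Z])
    show "t \<in> Fb.zeros" using Fb_zeros o cub by simp
    fix i :: nat assume "i \<le> 2"
    show "Z i \<subseteq> Fb.zeros" using over Fb_zeros by blast
    show "Fb.irred (Z i)"
      unfolding Z_def using Fb.irred_graph_slice[OF Pol3_sub tp] Fb.irred_curve[OF Pol3_sub tp cub]
        graph_slice_nonempty[OF tp] Fb.irred_singleton by auto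
  next
    fix i :: nat assume "i < 2"
    then consider "i = 0" | "i = 1" by linarith
    then show "van_ideal vars3 {} (Z i) \<subset> van_ideal vars3 {} (Z (Suc i))"
      using S.chain_surface_curve[OF tp cub] S.chain_curve_point[OF tp cub] by cases (auto simp: Z_def)
  qed (auto simp: Z_def)
qed

lemma fibre_singular_iff:
  "singular_locus (fibre_ring \<sigma>) (\<lambda>c. fibre_class \<sigma> (quot_const c)) \<noteq> {} \<longleftrightarrow>
    (\<exists>x1 x2 x3. cubic x1 x2 x3 \<sigma>1 \<sigma>2 \<sigma>3 = 0 \<and> x2 * x3 + 2 * x1 - (\<sigma>1 + \<sigma>2 * \<sigma>3) = 0 \<and>
       x1 * x3 + 2 * x2 - (\<sigma>2 + \<sigma>1 * \<sigma>3) = 0 \<and> x1 * x2 - \<sigma>3 = 0)"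
proof -
  \<comment> \<open>Default coordinates that place every point of the fibre ring \<open>over\<close>
    the parameters.\<close>
  define d where "d v = (case v of S1 \<Rightarrow> \<sigma>1 | S2 \<Rightarrow> \<sigma>2 | S3 \<Rightarrow> \<sigma>3 | _ \<Rightarrow> 0)" for v
  have reg: "Fb.point t \<in> singular_locus (fibre_ring \<sigma>) (\<lambda>c. fibre_class \<sigma> (quot_const c)) \<longleftrightarrow>
      t X2 * t X3 + 2 * t X1 - (\<sigma>1 + \<sigma>2 * \<sigma>3) = 0 \<and>
       t X1 * t X3 + 2 * t X2 - (\<sigma>2 + \<sigma>1 * \<sigma>3) = 0 \<and> t X1 * t X2 - \<sigma>3 = 0"
    if o: "over t" and z: "t \<in> Fb.zeros" for t
  proof -
    have cub: "cubic_at t = 0" using Fb_zeros o z by simp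
    have "regular_point (fibre_ring \<sigma>) (\<lambda>c. fibre_class \<sigma> (quot_const c)) (Fb.point t) \<longleftrightarrow>
        (\<exists>v\<in>vars3 \<union> {}. pd t v (F_at \<sigma>) \<noteq> 0)"
      by (rule Fb.regular_point_iff[OF z _ Fb_height[OF o cub]]) simp
    then show ?thesis using Fb.point_mem[OF z] by (auto simp: singular_locus_def pd_F_at)
  qed
  show ?thesis
  proof
    assume "singular_locus (fibre_ring \<sigma>) (\<lambda>c. fibre_class \<sigma> (quot_const c)) \<noteq> {}"
    then obtain \<xi> where \<xi>: "\<xi> \<in> singular_locus (fibre_ring \<sigma>) (\<lambda>c. fibre_class \<sigma> (quot_const c))" by blast
    then have "\<xi> \<in> alg_points (fibre_ring \<sigma>) (\<lambda>c. fibre_class \<sigma> (quot_const c))" by (simp add: singular_locus_def)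
    then obtain t where t: "t \<in> Fb.zeros" "\<xi> = Fb.point t" "\<And>v. v \<notin> vars3 \<union> {} \<Longrightarrow> t v = d v"
      using Fb.alg_points_cases[of \<xi> d] by blast
    have o: "over t" using t(3) by (simp add: over_def d_def)
    have "cubic (t X1) (t X2) (t X3) \<sigma>1 \<sigma>2 \<sigma>3 = 0"
      using t(1) by (simp add: Fb.zeros_def poly_eval_F_at)
    then show "\<exists>x1 x2 x3. cubic x1 x2 x3 \<sigma>1 \<sigma>2 \<sigma>3 = 0 \<and> x2 * x3 + 2 * x1 - (\<sigma>1 + \<sigma>2 * \<sigma>3) = 0 \<and>
       x1 * x3 + 2 * x2 - (\<sigma>2 + \<sigma>1 * \<sigma>3) = 0 \<and> x1 * x2 - \<sigma>3 = 0"
      using reg[OF o t(1)] \<xi> t(2) by blast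
  next
    assume "\<exists>x1 x2 x3. cubic x1 x2 x3 \<sigma>1 \<sigma>2 \<sigma>3 = 0 \<and> x2 * x3 + 2 * x1 - (\<sigma>1 + \<sigma>2 * \<sigma>3) = 0 \<and>
       x1 * x3 + 2 * x2 - (\<sigma>2 + \<sigma>1 * \<sigma>3) = 0 \<and> x1 * x2 - \<sigma>3 = 0"
    then obtain x1 x2 x3 where x: "cubic x1 x2 x3 \<sigma>1 \<sigma>2 \<sigma>3 = 0"
      "x2 * x3 + 2 * x1 - (\<sigma>1 + \<sigma>2 * \<sigma>3) = 0 \<and> x1 * x3 + 2 * x2 - (\<sigma>2 + \<sigma>1 * \<sigma>3) = 0 \<and> x1 * x2 - \<sigma>3 = 0"
      by blast
    define t where "t = d(X1 := x1, X2 := x2, X3 := x3)"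
    have "over t" "t \<in> Fb.zeros" using x by (auto simp: over_def t_def d_def Fb.zeros_def poly_eval_F_at)
    from reg[OF this] have "Fb.point t \<in> singular_locus (fibre_ring \<sigma>) (\<lambda>c. fibre_class \<sigma> (quot_const c))"
      using x(2) by (simp add: t_def)
    then show "singular_locus (fibre_ring \<sigma>) (\<lambda>c. fibre_class \<sigma> (quot_const c)) \<noteq> {}" by blast
  qed
qed

end

subsection \<open>The discriminant\<close>

text \<open>If \<open>x\<close> and \<open>y\<close> are eigenvalues of \<open>M\<^sub>1\<close> and \<open>M\<^sub>2\<close>, then \<open>R1\<close> vanishes iff \<open>s\<^sub>3\<close> is one of the four products
  of an eigenvalue of \<open>M\<^sub>1\<close> and an eigenvalue of \<open>M\<^sub>2\<close>.\<close>

lemma R1_product: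
  assumes "x \<noteq> 0" "y \<noteq> 0"
  shows "R1 (x + 1 / x) (y + 1 / y) s3 =
    (s3 + inverse s3 - (x * y + 1 / (x * y))) * (s3 + inverse s3 - (x / y + y / x))"
proof -
  have *: "w^2 - s1 * s2 * w + s1^2 + s2^2 - 4 = (w - A) * (w - B)"
    if "s1 * s2 = A + B" "A * B = s1^2 + s2^2 - 4" for w s1 s2 A B :: complex
  proof -
    have "(w - A) * (w - B) = w^2 - (A + B) * w + A * B" by (simp add: algebra_simps power2_eq_square)
    then show ?thesis by (simp add: that(2) flip: that(1))
  qed
  show ?thesis unfolding R1_def
    by (rule *) (use assms in \<open>simp_all add: field_simps power2_eq_square\<close>)
qed

lemma sum_inverse_eq:
  fixes s a :: complex
  assumes "s \<noteq> 0" "a \<noteq> 0" "s + inverse s = a + 1 / a" shows "s = a \<or> s = 1 / a"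
proof -
  have "(s - a) * (s * a - 1) = (s + inverse s - (a + 1 / a)) * (s * a)"
    using assms(1,2) by (simp add: field_simps)
  then have "(s - a) * (s * a - 1) = 0" using assms(3) by simp
  then consider "s = a" | "s * a = 1" by auto
  then show ?thesis using assms(2) by cases (auto simp: eq_divide_eq)
qed

lemma quadratic_root:
  fixes s :: complex obtains x where "x \<noteq> 0" "s = x + 1 / x"
proof -
  obtain r where r: "r^2 + (- s) * r + 1 = 0" using closest_root[where b = "- s" and c = 1] by metis
  then have "r \<noteq> 0" by auto
  then have "s = r + 1 / r" using r by (simp add: field_simps power2_eq_square)
  with \<open>r \<noteq> 0\<close> show ?thesis by (rule that)
qed

text \<open>Once v = 0, the cubic is \<open>p * q\<close> and its derivatives in x_1 and x_2 are
  \<open>(s1 - 2 * x1) * q + u * x2\<close> and \<open>(s2 - 2 * x2) * p + u * x1\<close>. Since p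
  or q is zero, so is u. If both are zero, x_1 and x_2 are eigenvalues of M_1 and M_2 with product
  s_3. If only p is zero, x_1 is a double eigenvalue and s_1^2 = 4; likewise for q.\<close>

lemma discriminant:
  fixes s1 s2 s3 :: complex
  assumes s3: "s3 \<noteq> 0"
  shows "(\<exists>x1 x2 x3. cubic x1 x2 x3 s1 s2 s3 = 0 \<and> x2 * x3 + 2 * x1 - (s1 + s2 * s3) = 0 \<and>
       x1 * x3 + 2 * x2 - (s2 + s1 * s3) = 0 \<and> x1 * x2 - s3 = 0) \<longleftrightarrow>
    (s1^2 - 4) * (s2^2 - 4) * R1 s1 s2 s3 = 0" (is "?L \<longleftrightarrow> ?R")
proof
  assume ?L
  then obtain x1 x2 x3 where x: "cubic x1 x2 x3 s1 s2 s3 = 0" "x2 * x3 + 2 * x1 - (s1 + s2 * s3) = 0"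
       "x1 * x3 + 2 * x2 - (s2 + s1 * s3) = 0" "x1 * x2 - s3 = 0" by blast
  have v: "s3 = x1 * x2" using x(4) by simp
  then have nz: "x1 \<noteq> 0" "x2 \<noteq> 0" using s3 by auto
  define p q u where "p = (s1 - x1) * x1 - 1" and "q = (s2 - x2) * x2 - 1"
    and "u = x3 - x1 * x2 + s2 * x1 + s1 * x2 - s1 * s2 - s3"
  have "cubic x1 x2 x3 s1 s2 s3 = p * q"
    by (simp add: cubic_def p_def q_def v algebra_simps power2_eq_square)
  then have pq: "p * q = 0" using x(1) by simp
  have "x2 * x3 + 2 * x1 - (s1 + s2 * s3) = (s1 - 2 * x1) * q + u * x2"
    "x1 * x3 + 2 * x2 - (s2 + s1 * s3) = (s2 - 2 * x2) * p + u * x1"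
    by (simp_all add: p_def q_def u_def v algebra_simps)
  then have e: "(s1 - 2 * x1) * q + u * x2 = 0" "(s2 - 2 * x2) * p + u * x1 = 0" using x(2,3) by simp_all
  have sq: "s^2 - 4 = 0" if "(s - z) * z - 1 = 0" "s - 2 * z = 0" for s z :: complex
  proof -
    have "s^2 - 4 = 4 * ((s - z) * z - 1) + (s - 2 * z)^2" by (simp add: algebra_simps power2_eq_square)
    then show ?thesis using that by simp
  qed
  have "p = 0 \<or> q = 0" using pq by simp
  then have u: "u = 0" using e nz by auto
  show ?R
  proof (cases "p = 0 \<and> q = 0")
    case True
    then have s12: "s1 = x1 + 1 / x1" "s2 = x2 + 1 / x2" using nz by (auto simp: p_def q_def field_simps)
    have "R1 s1 s2 s3 = 0"
      unfolding s12 R1_product[OF nz] v by (simp add: divide_inverse)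
    then show ?thesis by simp
  next
    case False
    then consider "p = 0" "s1 - 2 * x1 = 0" | "q = 0" "s2 - 2 * x2 = 0" using pq e u by auto
    then show ?thesis
    proof cases
      case 1
      then have "s1^2 - 4 = 0" using sq[of s1 x1] by (simp add: p_def)
      then show ?thesis by simp
    next
      case 2
      then have "s2^2 - 4 = 0" using sq[of s2 x2] by (simp add: q_def)
      then show ?thesis by simp
    qed
  qed
next
  assume R: ?R
  have I: ?L if v: "x1 * x2 = s3" and pq: "(s1 - x1) * x1 - 1 = p" "(s2 - x2) * x2 - 1 = q" "p * q = 0"
    and d: "(s1 - 2 * x1) * q = 0" "(s2 - 2 * x2) * p = 0" for x1 x2 p q
  proof -
    \<comment> \<open>This choice makes u zero.\<close>
    define x3 where "x3 = x1 * x2 - s2 * x1 - s1 * x2 + s1 * s2 + s3"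
    have "cubic x1 x2 x3 s1 s2 s3 = p * q"
      by (simp add: cubic_def x3_def algebra_simps power2_eq_square flip: v pq)
    moreover have "x2 * x3 + 2 * x1 - (s1 + s2 * s3) = (s1 - 2 * x1) * q"
      "x1 * x3 + 2 * x2 - (s2 + s1 * s3) = (s2 - 2 * x2) * p"
      by (simp_all add: x3_def algebra_simps flip: v pq)
    ultimately show ?L using pq d v by (intro exI[of _ x1] exI[of _ x2] exI[of _ x3]) simp
  qed
  have half: "(s - s / 2) * (s / 2) - 1 = 0" "s / 2 \<noteq> 0" if "s^2 - 4 = 0" for s :: complex
  proof -
    have "(s - s / 2) * (s / 2) - 1 = (s^2 - 4) / 4" by (simp add: field_simps power2_eq_square)
    then show "(s - s / 2) * (s / 2) - 1 = 0" using that by simp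
    show "s / 2 \<noteq> 0" using that by auto
  qed
  consider "s1^2 - 4 = 0" | "s2^2 - 4 = 0" | "R1 s1 s2 s3 = 0" using R by auto
  then show ?L
  proof cases
    case 1
    \<comment> \<open>x_1 is the double eigenvalue of M_1, and x_2 is forced by the product s_3;
      with p = 0 and s_1 = 2 x_1 the value of q may be arbitrary.\<close>
    show ?thesis
      by (rule I[of "s1 / 2" "s3 / (s1 / 2)", OF _ half(1)[OF 1] refl]) (use half(2)[OF 1] in auto)
  next
    case 2
    show ?thesis
      by (rule I[of "s3 / (s2 / 2)" "s2 / 2", OF _ refl half(1)[OF 2]]) (use half(2)[OF 2] in auto)
  next
    case 3
    obtain x where x: "x \<noteq> 0" "s1 = x + 1 / x" by (rule quadratic_root)
    obtain y where y: "y \<noteq> 0" "s2 = y + 1 / y" by (rule quadratic_root)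
    have z: ?L if "x' * y' = s3" "x' \<in> {x, 1 / x}" "y' \<in> {y, 1 / y}" for x' y'
    proof -
      have root: "(w + 1 / w - z) * z - 1 = 0" if "w \<noteq> 0" "z \<in> {w, 1 / w}" for w z :: complex
        using that by auto
      have "(s1 - x') * x' - 1 = 0" "(s2 - y') * y' - 1 = 0"
        unfolding x(2) y(2) using that(2,3) by (intro root x y; simp)+
      then show ?L using that(1) by (intro I[of x' y' 0 0]) auto
    qed
    have "s3 + inverse s3 = x * y + 1 / (x * y) \<or> s3 + inverse s3 = x / y + 1 / (x / y)"
      using 3 unfolding x(2) y(2) R1_product[OF x(1) y(1)] by simp
    then have "s3 = x * y \<or> s3 = 1 / (x * y) \<or> s3 = x / y \<or> s3 = 1 / (x / y)"
      using sum_inverse_eq[OF s3, of "x * y"] sum_inverse_eq[OF s3, of "x / y"] x(1) y(1) by auto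
    then show ?thesis
      using z[of x y] z[of "1 / x" "1 / y"] z[of x "1 / y"] z[of "1 / x" y] by auto
  qed
qed

subsection \<open>The degree of the fibres\<close>

definition mono_deg :: "(var \<Rightarrow>\<^sub>0 int) \<Rightarrow> int" where
  "mono_deg m = (\<Sum>v\<in>UNIV. Poly_Mapping.lookup m v)"

lemma mono_deg_add: "mono_deg (m + n) = mono_deg m + mono_deg n"
  by (simp add: mono_deg_def lookup_add sum.distrib)

lemma mono_deg_single: "mono_deg (Poly_Mapping.single v k) = k"
  by (simp add: mono_deg_def lookup_single when_def)

lemma mono_deg_0: "mono_deg 0 = 0"
  by (simp add: mono_deg_def)

lemma mono_deg_keys: "(\<Sum>v \<in> Poly_Mapping.keys m. Poly_Mapping.lookup m v) = mono_deg m"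
  unfolding mono_deg_def by (rule sum.mono_neutral_left) (auto simp: in_keys_iff)

definition deg_le :: "int \<Rightarrow> lpoly set" where
  "deg_le d = {p. \<forall>m\<in>Poly_Mapping.keys p. mono_deg m \<le> d}"

lemma deg_le_add: "p \<in> deg_le d \<Longrightarrow> q \<in> deg_le d \<Longrightarrow> p + q \<in> deg_le d"
  unfolding deg_le_def using Poly_Mapping.keys_add[of p q] by blast

lemma deg_le_diff: "p \<in> deg_le d \<Longrightarrow> q \<in> deg_le d \<Longrightarrow> p - q \<in> deg_le d"
  using deg_le_add[of p d "- q"] by (simp add: deg_le_def)

lemma deg_le_mult:
  assumes "p \<in> deg_le a" "q \<in> deg_le b" shows "p * q \<in> deg_le (a + b)"
  unfolding deg_le_def
proof (intro CollectI ballI)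
  fix m assume "m \<in> Poly_Mapping.keys (p * q)"
  then obtain k l where "k \<in> Poly_Mapping.keys p" "l \<in> Poly_Mapping.keys q" "m = k + l"
    using Poly_Mapping.keys_mult[of p q] by blast
  then show "mono_deg m \<le> a + b" using assms by (auto simp: deg_le_def mono_deg_add intro: add_mono)
qed

lemma deg_le_mono: "a \<le> b \<Longrightarrow> p \<in> deg_le a \<Longrightarrow> p \<in> deg_le b"
  unfolding deg_le_def by force

lemma deg_le_Const: "Const c \<in> deg_le 0"
  by (simp add: deg_le_def Const_def mono_deg_0)

lemma deg_le_Var: "Var v \<in> deg_le 1"
  by (simp add: deg_le_def Var_def mono_deg_single)

text \<open>The product of the three variables occurs with coefficient 1, and all other terms have
  degree at most 2 because the parameters are constants here, so nothing cancels.\<close>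

lemma total_degree_F_at: "total_degree (F_at (\<sigma>1, \<sigma>2, \<sigma>3)) = 3"
proof -
  define m0 where "m0 = Poly_Mapping.single X1 (1::int) + Poly_Mapping.single X2 1 + Poly_Mapping.single X3 1"
  define G where "G = Var X1 * Var X1 + Var X2 * Var X2 - Const (\<sigma>1 + \<sigma>2 * \<sigma>3) * Var X1
    - Const (\<sigma>2 + \<sigma>1 * \<sigma>3) * Var X2 - Const \<sigma>3 * Var X3 + Const (\<sigma>3^2 + \<sigma>1 * \<sigma>2 * \<sigma>3 + 1)"
  have F: "F_at (\<sigma>1, \<sigma>2, \<sigma>3) = Poly_Mapping.single m0 1 + G"
  proof -
    have "Var X1 * Var X2 * Var X3 = Poly_Mapping.single m0 1" by (simp add: Var_def mult_single m0_def)
    then show ?thesis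
      unfolding F_at_def prod.case cubic_def G_def
      by (simp add: Const_add Const_mult power2_eq_square algebra_simps)
  qed
  have G: "G \<in> deg_le 2"
  proof -
    have 2: "Var v * Var w \<in> deg_le 2" for v w
      using deg_le_mult[OF deg_le_Var deg_le_Var, of v w] by simp
    have 1: "Const c * Var v \<in> deg_le 2" for c v
      using deg_le_mult[OF deg_le_Const deg_le_Var, of c v] by (auto intro: deg_le_mono[of 1])
    have 0: "Const c \<in> deg_le 2" for c by (rule deg_le_mono[OF _ deg_le_Const]) simp
    show ?thesis unfolding G_def by (intro deg_le_add deg_le_diff 0 1 2)
  qed
  have m0: "mono_deg m0 = 3" by (simp add: m0_def mono_deg_add mono_deg_single)
  have "m0 \<notin> Poly_Mapping.keys G" using G m0 by (auto simp: deg_le_def)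
  then have in0: "m0 \<in> Poly_Mapping.keys (F_at (\<sigma>1, \<sigma>2, \<sigma>3))"
    by (simp add: F in_keys_iff lookup_add)
  have "F_at (\<sigma>1, \<sigma>2, \<sigma>3) \<in> deg_le 3"
    unfolding F by (intro deg_le_add deg_le_mono[OF _ G]) (auto simp: deg_le_def m0)
  then show ?thesis
    unfolding total_degree_def mono_deg_keys using in0 m0
    by (intro Max_eqI) (auto simp: deg_le_def intro: rev_image_eqI)
qed

section \<open>The map to the parameter space and the final statement\<close>

lemma parameter_map_surj:
  "(\<lambda>\<xi>. (\<xi> (coord_fun S1), \<xi> (coord_fun S2), \<xi> (coord_fun S3)))
         ` alg_points quot_ring quot_const = param_space" (is "?f ` _ = _")
proof
  have f: "?f (Q.point t) = (t S1, t S2, t S3)" if "t \<in> Q.zeros" for t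
    using that by (simp add: coord_fun_h6 Q.point_h)
  show "?f ` alg_points quot_ring quot_const \<subseteq> param_space"
  proof
    fix s assume "s \<in> ?f ` alg_points quot_ring quot_const"
    then obtain \<xi> where \<xi>: "\<xi> \<in> alg_points quot_ring quot_const" "s = ?f \<xi>" by blast
    then obtain t where t: "t \<in> Q.zeros" "\<xi> = Q.point t" using Q.alg_points_cases by metis
    then show "s \<in> param_space" using \<xi>(2) f[OF t(1)] by (simp add: param_space_def Q_zeros pts_def)
  qed
  show "param_space \<subseteq> ?f ` alg_points quot_ring quot_const"
  proof
    fix s assume "s \<in> param_space"
    then obtain s1 s2 s3 where s: "s = (s1, s2, s3)" "s3 \<noteq> 0" by (auto simp: param_space_def)
    \<comment> \<open>At x_1 = x_2 = 0 the cubic is linear in x_3 with coefficient -s_3, so every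
      parameter is reached.\<close>
    define t where "t = (\<lambda>_. 0)(S1 := s1, S2 := s2, S3 := s3, X3 := (s3^2 + s1 * s2 * s3 + 1) / s3)"
    have t: "t \<in> Q.zeros" using s(2) by (simp add: Q_zeros t_def pts_def cubic_at_def cubic_def)
    have "s = ?f (Q.point t)" unfolding f[OF t] by (simp add: t_def s)
    then show "s \<in> ?f ` alg_points quot_ring quot_const" using Q.point_mem[OF t] by blast
  qed
qed

theorem mainTheorem3:
  shows
    "((\<forall>P \<in> analytic_data. alpha P = b2 P * c1 P + d1 P * d2 P) \<and>
      (\<exists>\<phi> \<in> ring_iso (L6 Quot genideal L6 {F}) quot_ring.
         \<forall>p \<in> carrier L6. \<phi> (genideal L6 {F} +>\<^bsub>L6\<^esub> p)
           = (\<lambda>P\<in>analytic_data. poly_eval (\<lambda>v. coord v P) p)) \<and>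
      (\<lambda>\<xi>. (\<xi> (coord_fun S1), \<xi> (coord_fun S2), \<xi> (coord_fun S3)))
         ` alg_points quot_ring quot_const = param_space \<and>
      (\<forall>\<sigma> \<in> param_space. total_degree (F_at \<sigma>) = 3 \<and>
         (\<exists>\<psi> \<in> ring_iso (L3 Quot genideal L3 {F_at \<sigma>}) (fibre_ring \<sigma>).
            (\<forall>c. \<psi> (genideal L3 {F_at \<sigma>} +>\<^bsub>L3\<^esub> Const c) = fibre_class \<sigma> (quot_const c)) \<and>
            (\<forall>v \<in> {X1, X2, X3}.
               \<psi> (genideal L3 {F_at \<sigma>} +>\<^bsub>L3\<^esub> Var v) = fibre_class \<sigma> (coord_fun v)))))
     \<and>
     (singular_locus quot_ring quot_const =
        {\<xi> \<in> alg_points quot_ring quot_const.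
           \<xi> (\<lambda>P\<in>analytic_data. b1 P * c2 P) = 0 \<and>
           \<xi> (\<lambda>P\<in>analytic_data. b2 P * c1 P) = 0 \<and>
           \<xi> (\<lambda>P\<in>analytic_data. a1 P * d1 P - 1) = 0 \<and>
           \<xi> (\<lambda>P\<in>analytic_data. a2 P * d2 P - 1) = 0} \<and>
      singular_locus quot_ring quot_const =
        quot_map ` {P \<in> analytic_data. (b1 P = 0 \<and> b2 P = 0) \<or> (c1 P = 0 \<and> c2 P = 0)})
     \<and>
     (\<forall>\<sigma>1 \<sigma>2 \<sigma>3. (\<sigma>1, \<sigma>2, \<sigma>3) \<in> param_space \<longrightarrow>
        (singular_locus (fibre_ring (\<sigma>1, \<sigma>2, \<sigma>3))
            (\<lambda>c. fibre_class (\<sigma>1, \<sigma>2, \<sigma>3) (quot_const c)) \<noteq> {}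
         \<longleftrightarrow> (\<sigma>1^2 - 4) * (\<sigma>2^2 - 4) * R1 \<sigma>1 \<sigma>2 \<sigma>3 = 0))"
proof (intro conjI)
  show "\<forall>P \<in> analytic_data. alpha P = b2 P * c1 P + d1 P * d2 P"
    using analytic_data_alpha by blast
  show "\<exists>\<phi> \<in> ring_iso (L6 Quot genideal L6 {F}) quot_ring.
         \<forall>p \<in> carrier L6. \<phi> (genideal L6 {F} +>\<^bsub>L6\<^esub> p)
           = (\<lambda>P\<in>analytic_data. poly_eval (\<lambda>v. coord v P) p)"
    using Q.factor_iso unfolding h6_def .
  show "(\<lambda>\<xi>. (\<xi> (coord_fun S1), \<xi> (coord_fun S2), \<xi> (coord_fun S3)))
         ` alg_points quot_ring quot_const = param_space"
    by (rule parameter_map_surj)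
  show "\<forall>\<sigma> \<in> param_space. total_degree (F_at \<sigma>) = 3 \<and>
         (\<exists>\<psi> \<in> ring_iso (L3 Quot genideal L3 {F_at \<sigma>}) (fibre_ring \<sigma>).
            (\<forall>c. \<psi> (genideal L3 {F_at \<sigma>} +>\<^bsub>L3\<^esub> Const c) = fibre_class \<sigma> (quot_const c)) \<and>
            (\<forall>v \<in> {X1, X2, X3}.
               \<psi> (genideal L3 {F_at \<sigma>} +>\<^bsub>L3\<^esub> Var v) = fibre_class \<sigma> (coord_fun v)))"
  proof
    fix \<sigma> assume "\<sigma> \<in> param_space"
    then obtain \<sigma>1 \<sigma>2 \<sigma>3 where \<sigma>: "\<sigma> = (\<sigma>1, \<sigma>2, \<sigma>3)" "\<sigma>3 \<noteq> 0" by (auto simp: param_space_def)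
    interpret cubic_fibre \<sigma>1 \<sigma>2 \<sigma>3 by standard (rule \<sigma>(2))
    obtain \<psi> where \<psi>: "\<psi> \<in> ring_iso (L3 Quot genideal L3 {F_at \<sigma>}) (fibre_ring \<sigma>)"
      "\<And>p. p \<in> carrier L3 \<Longrightarrow> \<psi> (genideal L3 {F_at \<sigma>} +>\<^bsub>L3\<^esub> p) = h3 p"
      using Fb.factor_iso unfolding \<sigma>(1) by blast
    have "\<psi> (genideal L3 {F_at \<sigma>} +>\<^bsub>L3\<^esub> Const c) = fibre_class \<sigma> (quot_const c)" for c
      using \<psi>(2)[OF Pol_Const[of c]] by (simp add: h3_def Q.h_Const \<sigma>(1))
    moreover have "\<psi> (genideal L3 {F_at \<sigma>} +>\<^bsub>L3\<^esub> Var v) = fibre_class \<sigma> (coord_fun v)"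
      if "v \<in> {X1, X2, X3}" for v
    proof -
      have "Var v \<in> carrier L3" using that by (intro Pol_Var) simp
      from \<psi>(2)[OF this] show ?thesis by (simp add: h3_def coord_fun_h6 \<sigma>(1))
    qed
    ultimately show "total_degree (F_at \<sigma>) = 3 \<and>
         (\<exists>\<psi> \<in> ring_iso (L3 Quot genideal L3 {F_at \<sigma>}) (fibre_ring \<sigma>).
            (\<forall>c. \<psi> (genideal L3 {F_at \<sigma>} +>\<^bsub>L3\<^esub> Const c) = fibre_class \<sigma> (quot_const c)) \<and>
            (\<forall>v \<in> {X1, X2, X3}.
               \<psi> (genideal L3 {F_at \<sigma>} +>\<^bsub>L3\<^esub> Var v) = fibre_class \<sigma> (coord_fun v)))"
      using \<psi>(1) total_degree_F_at \<sigma>(1) by blast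
  qed
  show "singular_locus quot_ring quot_const =
        {\<xi> \<in> alg_points quot_ring quot_const.
           \<xi> (\<lambda>P\<in>analytic_data. b1 P * c2 P) = 0 \<and>
           \<xi> (\<lambda>P\<in>analytic_data. b2 P * c1 P) = 0 \<and>
           \<xi> (\<lambda>P\<in>analytic_data. a1 P * d1 P - 1) = 0 \<and>
           \<xi> (\<lambda>P\<in>analytic_data. a2 P * d2 P - 1) = 0}"
    by (rule singular_locus_equations)
  show "singular_locus quot_ring quot_const =
        quot_map ` {P \<in> analytic_data. (b1 P = 0 \<and> b2 P = 0) \<or> (c1 P = 0 \<and> c2 P = 0)}"
    by (rule singular_locus_reducible)
  show "\<forall>\<sigma>1 \<sigma>2 \<sigma>3. (\<sigma>1, \<sigma>2, \<sigma>3) \<in> param_space \<longrightarrow>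
        (singular_locus (fibre_ring (\<sigma>1, \<sigma>2, \<sigma>3))
            (\<lambda>c. fibre_class (\<sigma>1, \<sigma>2, \<sigma>3) (quot_const c)) \<noteq> {}
         \<longleftrightarrow> (\<sigma>1^2 - 4) * (\<sigma>2^2 - 4) * R1 \<sigma>1 \<sigma>2 \<sigma>3 = 0)"
  proof (intro allI impI)
    fix \<sigma>1 \<sigma>2 \<sigma>3 assume "(\<sigma>1, \<sigma>2, \<sigma>3) \<in> param_space"
    then have "\<sigma>3 \<noteq> 0" by (simp add: param_space_def)
    then interpret cubic_fibre \<sigma>1 \<sigma>2 \<sigma>3 by (rule cubic_fibre.intro)
    show "singular_locus (fibre_ring (\<sigma>1, \<sigma>2, \<sigma>3))
            (\<lambda>c. fibre_class (\<sigma>1, \<sigma>2, \<sigma>3) (quot_const c)) \<noteq> {}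
         \<longleftrightarrow> (\<sigma>1^2 - 4) * (\<sigma>2^2 - 4) * R1 \<sigma>1 \<sigma>2 \<sigma>3 = 0"
      unfolding fibre_singular_iff by (rule discriminant[OF \<sigma>3])
  qed
qed

end
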